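(* Let $\mathcal{X}\subseteq\mathrm{Ob}(\mathbf{FA})$ and let $Sg$ be a small signature (not a proper class). Then the class of all $(\mathcal{D},Q)\in\mathrm{Ob}(\mathbf{FA})$ such that, for all $Sg$-theories $T,T'$, $T\models_{\mathcal{X}}T'$ implies $T\models_{(\mathcal{D},Q)}T'$, is equal to $\mathbb{U}_{Sg}\mathbb{S}\mathbb{P}(\mathcal{X})$.
   Context: Syntax: first-order language $\mathscr{L}$ (quantifier symbols $\mathscr{L}_q$, connectives $\mathscr{L}_\omega$ with arities, designated $e\in\mathscr{L}_0$, $\otimes\in\mathscr{L}_2$); signatures; terms- and formulas-in-context; assertions are equations-in-context and sequents-in-context; an $Sg$-theory $T$ is a set of $Sg$-assertions, $\mathrm{Sg}(T)$ its signature. $\mathcal{L}^m$ is the least logic (closure operator on theories satisfying typed equational logic) closed under Ax, Cut, context weakening, substitution of provably equal terms, congruence of quantifiers and connectives w.r.t. mutual derivability, and the two-way rules $\Phi,\alpha,\beta,\Psi\vdash\theta\iff\Phi,\alpha\otimes\beta,\Psi\vdash\theta$ and $\Phi,e,\Psi\vdash\phi\iff\Phi,\Psi\vdash\phi$. $\mathrm{Ob}(\mathbf{FA})$: prop-categories $(\mathcal{C},P)$ ($\mathcal{C}$ with designated finite products, $P:\mathcal{C}^{op}\to\mathbf{Pos}$) with $\mathscr{L}_\omega$-algebra structures on each $P(c)$ preserved by $P(f)$, elements $Eq_c\in P(c\times c)$, maps $\Omega_{b,c}:P(b\times c)\to P(b)$ natural in $b$, such that $(P(c),\otimes,e_c)$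 is a monoid, $\Omega_{b,1}\circ P(\pi_1^{b,1})=\mathrm{id}$, $\Omega_{b,c\times d}\circ P(a_{b,c,d})=\Omega_{b,c}\circ\Omega_{b\times c,d}$, $Eq_1=e_{1\times1}$, $Eq_{c_1\times c_2}=P(\langle\pi_1^{c_1,c_2}\pi_1,\pi_1^{c_1,c_2}\pi_2\rangle)(Eq_{c_1})\otimes P(\langle\pi_2^{c_1,c_2}\pi_1,\pi_2^{c_1,c_2}\pi_2\rangle)(Eq_{c_2})$. Structures interpret terms as morphisms and formulas as elements of $P$ in the standard way (equality via $Eq$, quantifiers via $\Omega$); equations are satisfied when both sides agree, sequents $\phi_1..\phi_n\vdash\phi$ when $\bigotimes[\![\phi_i]\!]\le[\![\phi]\!]$. For $\mathcal{X}\subseteq\mathrm{Ob}(\mathbf{FA})$, $T\models_{\mathcal{X}}T'$ iff every $T$-model in a member of $\mathcal{X}$ satisfies all of $T'$. Morphisms $F=(F^o,F^p)$: finite-product-preserving $F^o$ and natural $F^p:P\Rightarrow QF^o$ with $\mathscr{L}_\omega$-homomorphic components commuting with quantifiers and equality up to canonical product isomorphisms. A subprop-category of $(\mathcal{D},Q)$ is an $(\mathcal{E},R)\in\mathrm{Ob}(\mathbf{FA})$ with a morphism $\iota:(\mathcal{E},R)\to(\mathcal{D},Q)$ such that $\iota^o$ is faithful and each $\iota^p$-component is an order embedding. For an $\mathcal{L}^m$-theory $T$, $(\mathcal{C}_T,P_T)$ is its classifying prop-category: objects contexts, morphisms lists of terms modulo equality in $T$ (composition by substitution, products by concatenation), $P_T(\Gamma)$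 formulas in $[\Gamma]$ modulo mutual derivability in $T$ ordered by derivability, operations on representatives, $\Omega_{\Gamma,\Gamma'}[\phi]=[\Omega_{y_1:\tau_1}\cdots\Omega_{y_m:\tau_m}\phi]$, $Eq_\Gamma=[x_1=_{\sigma_1}x_1'\otimes\dots\otimes x_n=_{\sigma_n}x_n']$ ($[e]$ for empty $\Gamma$). A classifying subprop-category of $(\mathcal{D},Q)$ is a subprop-category of $(\mathcal{D},Q)$ of the form $(\mathcal{C}_T,P_T)$ for an $\mathcal{L}^m$-theory $T$. Operators on subclasses of $\mathrm{Ob}(\mathbf{FA})$: $\mathbb{P}(\mathcal{X})$ = closure under products (componentwise products $(\prod\mathcal{C}_i,\prod P_i)$, with operations componentwise); $\mathbb{S}(\mathcal{X})$ = closure under subprop-categories; $(\mathcal{D},Q)\in\mathbb{U}_{Sg}(\mathcal{X})$ iff every classifying subprop-category $(\mathcal{C}_T,P_T)$ of $(\mathcal{D},Q)$ with $\mathrm{Sg}(T)=Sg$ belongs to $\mathcal{X}$.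
   Formalization: Objects of FA are required to have ⊗ monotone in both arguments on each P(c) (a monoid in posets, not merely a monoid); without this Cut is unsound and the claim fails, e.g. for P(1)=Z/2 with e<r over the terminal category. *)

theory Defs
  imports "HOL-Library.FuncSet" "HOL-Library.Equipollence"
begin

section \<open>Languages, signatures, terms and formulas\<close>

record ('c, 'q) language =
  Conns :: "'c set"
  arity :: "'c \<Rightarrow> nat"
  Quants :: "'q set"
  unit_conn :: 'c
  tensor_conn :: 'c

definition is_language :: "('c, 'q) language \<Rightarrow> bool" where
  "is_language L \<longleftrightarrow>
     unit_conn L \<in> Conns L \<and> arity L (unit_conn L) = 0 \<and>
     tensor_conn L \<in> Conns L \<and> arity L (tensor_conn L) = 2"

record ('s, 'f, 'r) signature =
  Sorts :: "'s set"
  Funs :: "'f set"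
  fdom :: "'f \<Rightarrow> 's list"
  fcod :: "'f \<Rightarrow> 's"
  Rels :: "'r set"
  rdom :: "'r \<Rightarrow> 's list"

definition is_signature :: "('s, 'f, 'r) signature \<Rightarrow> bool" where
  "is_signature Sg \<longleftrightarrow>
     (\<forall>f \<in> Funs Sg. fdom Sg f \<in> lists (Sorts Sg) \<and> fcod Sg f \<in> Sorts Sg) \<and>
     (\<forall>r \<in> Rels Sg. rdom Sg r \<in> lists (Sorts Sg))"

text \<open>
  A context is a list of sorts, i.e. contexts are taken up to renaming of their variables.
  In a context \<open>\<Gamma>\<close>, the term \<open>Var i\<close> denotes the variable declared at position \<open>i\<close> of \<open>\<Gamma>\<close>.
  Binding is by de Bruijn levels: the body of \<open>Quant q \<sigma> \<phi>\<close> in context \<open>\<Gamma>\<close> is the formula \<open>\<phi>\<close>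
  in context \<open>\<Gamma> @ [\<sigma>]\<close>, so the bound variable is \<open>Var (length \<Gamma>)\<close>. Appending declarations to a
  context does not change the terms over it (but it renumbers the bound variables of formulas).
\<close>

datatype 'f tm = Var nat | Fun 'f "'f tm list"

datatype ('s, 'f, 'r, 'c, 'q) fm =
    Rel 'r "'f tm list"
  | Equ 's "'f tm" "'f tm"
  | Conn 'c "('s, 'f, 'r, 'c, 'q) fm list"
  | Quant 'q 's "('s, 'f, 'r, 'c, 'q) fm"

inductive wt_tm :: "('s, 'f, 'r) signature \<Rightarrow> 's list \<Rightarrow> 'f tm \<Rightarrow> 's \<Rightarrow> bool"
  for Sg \<Gamma> where
    "i < length \<Gamma> \<Longrightarrow> wt_tm Sg \<Gamma> (Var i) (\<Gamma> ! i)"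
  | "f \<in> Funs Sg \<Longrightarrow> list_all2 (wt_tm Sg \<Gamma>) ts (fdom Sg f) \<Longrightarrow> wt_tm Sg \<Gamma> (Fun f ts) (fcod Sg f)"

inductive wf_fm ::
  "('c, 'q) language \<Rightarrow> ('s, 'f, 'r) signature \<Rightarrow> 's list \<Rightarrow> ('s, 'f, 'r, 'c, 'q) fm \<Rightarrow> bool"
  for L Sg where
    "r \<in> Rels Sg \<Longrightarrow> list_all2 (wt_tm Sg \<Gamma>) ts (rdom Sg r) \<Longrightarrow> wf_fm L Sg \<Gamma> (Rel r ts)"
  | "\<sigma> \<in> Sorts Sg \<Longrightarrow> wt_tm Sg \<Gamma> t \<sigma> \<Longrightarrow> wt_tm Sg \<Gamma> u \<sigma> \<Longrightarrow> wf_fm L Sg \<Gamma> (Equ \<sigma> t u)"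
  | "k \<in> Conns L \<Longrightarrow> length \<phi>s = arity L k \<Longrightarrow> (\<forall>\<phi> \<in> set \<phi>s. wf_fm L Sg \<Gamma> \<phi>) \<Longrightarrow>
       wf_fm L Sg \<Gamma> (Conn k \<phi>s)"
  | "q \<in> Quants L \<Longrightarrow> \<sigma> \<in> Sorts Sg \<Longrightarrow> wf_fm L Sg (\<Gamma> @ [\<sigma>]) \<phi> \<Longrightarrow> wf_fm L Sg \<Gamma> (Quant q \<sigma> \<phi>)"

abbreviation unit_fm :: "('c, 'q) language \<Rightarrow> ('s, 'f, 'r, 'c, 'q) fm" where
  "unit_fm L \<equiv> Conn (unit_conn L) []"

abbreviation tensor_fm ::
  "('c, 'q) language \<Rightarrow> ('s, 'f, 'r, 'c, 'q) fm \<Rightarrow> ('s, 'f, 'r, 'c, 'q) fm \<Rightarrow>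
   ('s, 'f, 'r, 'c, 'q) fm" where
  "tensor_fm L \<alpha> \<beta> \<equiv> Conn (tensor_conn L) [\<alpha>, \<beta>]"

text \<open>
  Simultaneous substitution. In \<open>fm_subst n ts \<phi>\<close>, the entries of \<open>ts\<close> are terms over a context
  of length \<open>n\<close>, one for each variable of the context of \<open>\<phi>\<close>.
\<close>

primrec tm_subst :: "'f tm list \<Rightarrow> 'f tm \<Rightarrow> 'f tm" where
  "tm_subst ts (Var i) = ts ! i"
| "tm_subst ts (Fun f us) = Fun f (map (tm_subst ts) us)"

primrec fm_subst ::
  "nat \<Rightarrow> 'f tm list \<Rightarrow> ('s, 'f, 'r, 'c, 'q) fm \<Rightarrow> ('s, 'f, 'r, 'c, 'q) fm" where
  "fm_subst n ts (Rel r us) = Rel r (map (tm_subst ts) us)"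
| "fm_subst n ts (Equ \<sigma> t u) = Equ \<sigma> (tm_subst ts t) (tm_subst ts u)"
| "fm_subst n ts (Conn k \<phi>s) = Conn k (map (\<lambda>\<phi>. fm_subst n ts \<phi>) \<phi>s)"
| "fm_subst n ts (Quant q \<sigma> \<phi>) = Quant q \<sigma> (fm_subst (Suc n) (ts @ [Var n]) \<phi>)"

definition vars :: "'s list \<Rightarrow> 'f tm list" where
  "vars \<Gamma> = map Var [0..<length \<Gamma>]"


section \<open>Assertions, theories and the logic $\mathcal{L}^m$\<close>

datatype ('s, 'f, 'r, 'c, 'q) assertion =
    Eqn "'s list" 's "'f tm" "'f tm"
  | Seq "'s list" "('s, 'f, 'r, 'c, 'q) fm list" "('s, 'f, 'r, 'c, 'q) fm"

primrec wf_assertion ::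
  "('c, 'q) language \<Rightarrow> ('s, 'f, 'r) signature \<Rightarrow> ('s, 'f, 'r, 'c, 'q) assertion \<Rightarrow> bool" where
  "wf_assertion L Sg (Eqn \<Gamma> \<sigma> t u) \<longleftrightarrow>
     \<Gamma> \<in> lists (Sorts Sg) \<and> wt_tm Sg \<Gamma> t \<sigma> \<and> wt_tm Sg \<Gamma> u \<sigma>"
| "wf_assertion L Sg (Seq \<Gamma> \<Phi> \<phi>) \<longleftrightarrow>
     \<Gamma> \<in> lists (Sorts Sg) \<and> (\<forall>\<psi> \<in> set \<Phi>. wf_fm L Sg \<Gamma> \<psi>) \<and> wf_fm L Sg \<Gamma> \<phi>"

definition is_theory ::
  "('c, 'q) language \<Rightarrow> ('s, 'f, 'r) signature \<Rightarrow> ('s, 'f, 'r, 'c, 'q) assertion set \<Rightarrow> bool" where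
  "is_theory L Sg T \<longleftrightarrow> (\<forall>a \<in> T. wf_assertion L Sg a)"

text \<open>
  The closure of a theory under $\mathcal{L}^m$. Congruence of function symbols is the instance
  of \<open>eqn_subst\<close> for the term \<open>f(x\<^sub>1, \<dots>, x\<^sub>n)\<close>.
\<close>

inductive_set Lm ::
  "('c, 'q) language \<Rightarrow> ('s, 'f, 'r) signature \<Rightarrow> ('s, 'f, 'r, 'c, 'q) assertion set \<Rightarrow>
   ('s, 'f, 'r, 'c, 'q) assertion set"
  for L Sg T where
    axiom: "a \<in> T \<Longrightarrow> a \<in> Lm L Sg T"
  | eqn_refl: "\<Gamma> \<in> lists (Sorts Sg) \<Longrightarrow> wt_tm Sg \<Gamma> t \<sigma> \<Longrightarrow> Eqn \<Gamma> \<sigma> t t \<in> Lm L Sg T"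
  | eqn_sym: "Eqn \<Gamma> \<sigma> t u \<in> Lm L Sg T \<Longrightarrow> Eqn \<Gamma> \<sigma> u t \<in> Lm L Sg T"
  | eqn_trans: "Eqn \<Gamma> \<sigma> t u \<in> Lm L Sg T \<Longrightarrow> Eqn \<Gamma> \<sigma> u v \<in> Lm L Sg T \<Longrightarrow>
      Eqn \<Gamma> \<sigma> t v \<in> Lm L Sg T"
  | eqn_weaken: "Eqn \<Gamma> \<sigma> t u \<in> Lm L Sg T \<Longrightarrow> \<tau> \<in> Sorts Sg \<Longrightarrow> Eqn (\<Gamma> @ [\<tau>]) \<sigma> t u \<in> Lm L Sg T"
  | eqn_subst: "Eqn \<Gamma> \<sigma> t u \<in> Lm L Sg T \<Longrightarrow> \<Delta> \<in> lists (Sorts Sg) \<Longrightarrow>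
      length ts = length \<Gamma> \<Longrightarrow> length us = length \<Gamma> \<Longrightarrow>
      (\<forall>i < length \<Gamma>. Eqn \<Delta> (\<Gamma> ! i) (ts ! i) (us ! i) \<in> Lm L Sg T) \<Longrightarrow>
      Eqn \<Delta> \<sigma> (tm_subst ts t) (tm_subst us u) \<in> Lm L Sg T"
  | ax: "\<Gamma> \<in> lists (Sorts Sg) \<Longrightarrow> wf_fm L Sg \<Gamma> \<phi> \<Longrightarrow> Seq \<Gamma> [\<phi>] \<phi> \<in> Lm L Sg T"
  | cut: "Seq \<Gamma> \<Phi> \<phi> \<in> Lm L Sg T \<Longrightarrow> Seq \<Gamma> (\<Psi> @ [\<phi>] @ \<Psi>') \<theta> \<in> Lm L Sg T \<Longrightarrow>
      Seq \<Gamma> (\<Psi> @ \<Phi> @ \<Psi>') \<theta> \<in> Lm L Sg T"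
  | seq_weaken: "Seq \<Gamma> \<Phi> \<phi> \<in> Lm L Sg T \<Longrightarrow> \<tau> \<in> Sorts Sg \<Longrightarrow>
      Seq (\<Gamma> @ [\<tau>]) (map (fm_subst (Suc (length \<Gamma>)) (vars \<Gamma>)) \<Phi>)
        (fm_subst (Suc (length \<Gamma>)) (vars \<Gamma>) \<phi>) \<in> Lm L Sg T"
  | seq_subst: "Seq \<Gamma> \<Phi> \<phi> \<in> Lm L Sg T \<Longrightarrow> \<Delta> \<in> lists (Sorts Sg) \<Longrightarrow>
      length ts = length \<Gamma> \<Longrightarrow> length us = length \<Gamma> \<Longrightarrow>
      (\<forall>i < length \<Gamma>. Eqn \<Delta> (\<Gamma> ! i) (ts ! i) (us ! i) \<in> Lm L Sg T) \<Longrightarrow>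
      Seq \<Delta> (map (fm_subst (length \<Delta>) ts) \<Phi>) (fm_subst (length \<Delta>) us \<phi>) \<in> Lm L Sg T"
  | conn_cong: "\<Gamma> \<in> lists (Sorts Sg) \<Longrightarrow> k \<in> Conns L \<Longrightarrow>
      length \<phi>s = arity L k \<Longrightarrow> length \<psi>s = arity L k \<Longrightarrow>
      (\<forall>i < arity L k. Seq \<Gamma> [\<phi>s ! i] (\<psi>s ! i) \<in> Lm L Sg T \<and> Seq \<Gamma> [\<psi>s ! i] (\<phi>s ! i) \<in> Lm L Sg T) \<Longrightarrow>
      Seq \<Gamma> [Conn k \<phi>s] (Conn k \<psi>s) \<in> Lm L Sg T"
  | quant_cong: "q \<in> Quants L \<Longrightarrow>
      Seq (\<Gamma> @ [\<sigma>]) [\<phi>] \<psi> \<in> Lm L Sg T \<Longrightarrow> Seq (\<Gamma> @ [\<sigma>]) [\<psi>] \<phi> \<in> Lm L Sg T \<Longrightarrow>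
      Seq \<Gamma> [Quant q \<sigma> \<phi>] (Quant q \<sigma> \<psi>) \<in> Lm L Sg T"
  | tensor_join: "Seq \<Gamma> (\<Phi> @ [\<alpha>, \<beta>] @ \<Psi>) \<theta> \<in> Lm L Sg T \<Longrightarrow>
      Seq \<Gamma> (\<Phi> @ [tensor_fm L \<alpha> \<beta>] @ \<Psi>) \<theta> \<in> Lm L Sg T"
  | tensor_split: "Seq \<Gamma> (\<Phi> @ [tensor_fm L \<alpha> \<beta>] @ \<Psi>) \<theta> \<in> Lm L Sg T \<Longrightarrow>
      Seq \<Gamma> (\<Phi> @ [\<alpha>, \<beta>] @ \<Psi>) \<theta> \<in> Lm L Sg T"
  | unit_add: "Seq \<Gamma> (\<Phi> @ \<Psi>) \<phi> \<in> Lm L Sg T \<Longrightarrow> Seq \<Gamma> (\<Phi> @ [unit_fm L] @ \<Psi>) \<phi> \<in> Lm L Sg T"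
  | unit_drop: "Seq \<Gamma> (\<Phi> @ [unit_fm L] @ \<Psi>) \<phi> \<in> Lm L Sg T \<Longrightarrow> Seq \<Gamma> (\<Phi> @ \<Psi>) \<phi> \<in> Lm L Sg T"

definition Lm_theory ::
  "('c, 'q) language \<Rightarrow> ('s, 'f, 'r) signature \<Rightarrow> ('s, 'f, 'r, 'c, 'q) assertion set \<Rightarrow> bool" where
  "Lm_theory L Sg T \<longleftrightarrow> is_theory L Sg T \<and> Lm L Sg T = T"


section \<open>Prop-categories and the objects of FA\<close>

text \<open>
  \<open>Cmp C g f\<close> is the composite of \<open>f\<close> followed by \<open>g\<close>; \<open>Prp C c\<close> is the underlying set of
  the poset $P(c)$ and \<open>Rdx C f\<close> is the map $P(f)$; \<open>Opr C c k\<close> is the operation of the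
  connective \<open>k\<close> on $P(c)$, applied to the list of its arguments; \<open>Qnt C q b c\<close> is the map
  $\Omega_{b,c} : P(b \times c) \to P(b)$ of the quantifier symbol \<open>q\<close>.
\<close>

record ('o, 'm, 'p, 'c, 'q) propcat =
  Obj :: "'o set"
  Arr :: "'m set"
  Src :: "'m \<Rightarrow> 'o"
  Tgt :: "'m \<Rightarrow> 'o"
  Idn :: "'o \<Rightarrow> 'm"
  Cmp :: "'m \<Rightarrow> 'm \<Rightarrow> 'm"
  Trm :: "'o"
  Prd :: "'o \<Rightarrow> 'o \<Rightarrow> 'o"
  Pr1 :: "'o \<Rightarrow> 'o \<Rightarrow> 'm"
  Pr2 :: "'o \<Rightarrow> 'o \<Rightarrow> 'm"
  Prp :: "'o \<Rightarrow> 'p set"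
  Leq :: "'o \<Rightarrow> 'p \<Rightarrow> 'p \<Rightarrow> bool"
  Rdx :: "'m \<Rightarrow> 'p \<Rightarrow> 'p"
  Opr :: "'o \<Rightarrow> 'c \<Rightarrow> 'p list \<Rightarrow> 'p"
  Eql :: "'o \<Rightarrow> 'p"
  Qnt :: "'q \<Rightarrow> 'o \<Rightarrow> 'o \<Rightarrow> 'p \<Rightarrow> 'p"

definition hom :: "('o, 'm, 'p, 'c, 'q) propcat \<Rightarrow> 'o \<Rightarrow> 'o \<Rightarrow> 'm set" where
  "hom C a b = {f \<in> Arr C. Src C f = a \<and> Tgt C f = b}"

definition bang :: "('o, 'm, 'p, 'c, 'q) propcat \<Rightarrow> 'o \<Rightarrow> 'm" where
  "bang C a = (THE h. h \<in> hom C a (Trm C))"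

definition pair :: "('o, 'm, 'p, 'c, 'q) propcat \<Rightarrow> 'm \<Rightarrow> 'm \<Rightarrow> 'm" where
  "pair C f g = (THE h. h \<in> hom C (Src C f) (Prd C (Tgt C f) (Tgt C g)) \<and>
     Cmp C (Pr1 C (Tgt C f) (Tgt C g)) h = f \<and> Cmp C (Pr2 C (Tgt C f) (Tgt C g)) h = g)"

definition inverse_arr :: "('o, 'm, 'p, 'c, 'q) propcat \<Rightarrow> 'm \<Rightarrow> 'm \<Rightarrow> bool" where
  "inverse_arr C f g \<longleftrightarrow> f \<in> Arr C \<and> g \<in> hom C (Tgt C f) (Src C f) \<and>
     Cmp C g f = Idn C (Src C f) \<and> Cmp C f g = Idn C (Tgt C f)"

definition inv_arr :: "('o, 'm, 'p, 'c, 'q) propcat \<Rightarrow> 'm \<Rightarrow> 'm" where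
  "inv_arr C f = (THE g. inverse_arr C f g)"

definition iso_arr :: "('o, 'm, 'p, 'c, 'q) propcat \<Rightarrow> 'm \<Rightarrow> bool" where
  "iso_arr C f \<longleftrightarrow> (\<exists>g. inverse_arr C f g)"

locale fp_category =
  fixes C :: "('o, 'm, 'p, 'c, 'q) propcat"
  assumes src_obj: "f \<in> Arr C \<Longrightarrow> Src C f \<in> Obj C"
    and tgt_obj: "f \<in> Arr C \<Longrightarrow> Tgt C f \<in> Obj C"
    and idn_hom: "a \<in> Obj C \<Longrightarrow> Idn C a \<in> hom C a a"
    and cmp_hom: "f \<in> hom C a b \<Longrightarrow> g \<in> hom C b c \<Longrightarrow> Cmp C g f \<in> hom C a c"
    and cmp_idn_right: "f \<in> hom C a b \<Longrightarrow> Cmp C f (Idn C a) = f"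
    and cmp_idn_left: "f \<in> hom C a b \<Longrightarrow> Cmp C (Idn C b) f = f"
    and cmp_assoc: "f \<in> hom C a b \<Longrightarrow> g \<in> hom C b c \<Longrightarrow> h \<in> hom C c d \<Longrightarrow>
      Cmp C h (Cmp C g f) = Cmp C (Cmp C h g) f"
    and trm_obj: "Trm C \<in> Obj C"
    and trm_universal: "a \<in> Obj C \<Longrightarrow> \<exists>!h. h \<in> hom C a (Trm C)"
    and prd_obj: "a \<in> Obj C \<Longrightarrow> b \<in> Obj C \<Longrightarrow> Prd C a b \<in> Obj C"
    and pr1_hom: "a \<in> Obj C \<Longrightarrow> b \<in> Obj C \<Longrightarrow> Pr1 C a b \<in> hom C (Prd C a b) a"
    and pr2_hom: "a \<in> Obj C \<Longrightarrow> b \<in> Obj C \<Longrightarrow> Pr2 C a b \<in> hom C (Prd C a b) b"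
    and prd_universal: "f \<in> hom C d a \<Longrightarrow> g \<in> hom C d b \<Longrightarrow>
      \<exists>!h. h \<in> hom C d (Prd C a b) \<and> Cmp C (Pr1 C a b) h = f \<and> Cmp C (Pr2 C a b) h = g"

locale prop_category = fp_category C
  for C :: "('o, 'm, 'p, 'c, 'q) propcat" +
  assumes leq_refl: "c \<in> Obj C \<Longrightarrow> x \<in> Prp C c \<Longrightarrow> Leq C c x x"
    and leq_trans: "c \<in> Obj C \<Longrightarrow> x \<in> Prp C c \<Longrightarrow> y \<in> Prp C c \<Longrightarrow> z \<in> Prp C c \<Longrightarrow>
      Leq C c x y \<Longrightarrow> Leq C c y z \<Longrightarrow> Leq C c x z"
    and leq_antisym: "c \<in> Obj C \<Longrightarrow> x \<in> Prp C c \<Longrightarrow> y \<in> Prp C c \<Longrightarrow>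
      Leq C c x y \<Longrightarrow> Leq C c y x \<Longrightarrow> x = y"
    and rdx_closed: "f \<in> hom C a b \<Longrightarrow> x \<in> Prp C b \<Longrightarrow> Rdx C f x \<in> Prp C a"
    and rdx_mono: "f \<in> hom C a b \<Longrightarrow> x \<in> Prp C b \<Longrightarrow> y \<in> Prp C b \<Longrightarrow>
      Leq C b x y \<Longrightarrow> Leq C a (Rdx C f x) (Rdx C f y)"
    and rdx_idn: "c \<in> Obj C \<Longrightarrow> x \<in> Prp C c \<Longrightarrow> Rdx C (Idn C c) x = x"
    and rdx_cmp: "f \<in> hom C a b \<Longrightarrow> g \<in> hom C b c \<Longrightarrow> x \<in> Prp C c \<Longrightarrow>
      Rdx C (Cmp C g f) x = Rdx C f (Rdx C g x)"

abbreviation unit_op :: "('c, 'q) language \<Rightarrow> ('o, 'm, 'p, 'c, 'q) propcat \<Rightarrow> 'o \<Rightarrow> 'p" where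
  "unit_op L C c \<equiv> Opr C c (unit_conn L) []"

abbreviation tensor_op ::
  "('c, 'q) language \<Rightarrow> ('o, 'm, 'p, 'c, 'q) propcat \<Rightarrow> 'o \<Rightarrow> 'p \<Rightarrow> 'p \<Rightarrow> 'p" where
  "tensor_op L C c x y \<equiv> Opr C c (tensor_conn L) [x, y]"

text \<open>
  \<open>map_left C f c\<close> is $f \times \mathrm{id}_c$, and \<open>assoc_arr C b c d\<close> is the canonical arrow
  $b \times (c \times d) \to (b \times c) \times d$.
\<close>

definition map_left :: "('o, 'm, 'p, 'c, 'q) propcat \<Rightarrow> 'm \<Rightarrow> 'o \<Rightarrow> 'm" where
  "map_left C f c = pair C (Cmp C f (Pr1 C (Src C f) c)) (Pr2 C (Src C f) c)"

definition assoc_arr :: "('o, 'm, 'p, 'c, 'q) propcat \<Rightarrow> 'o \<Rightarrow> 'o \<Rightarrow> 'o \<Rightarrow> 'm" where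
  "assoc_arr C b c d =
     (let p1 = Pr1 C b (Prd C c d); p2 = Pr2 C b (Prd C c d)
      in pair C (pair C p1 (Cmp C (Pr1 C c d) p2)) (Cmp C (Pr2 C c d) p2))"

text \<open>
  In an object of FA each $P(c)$ is a monoid in posets: besides the monoid laws, the tensor is
  monotone in both arguments, as the soundness of Cut requires. The other connectives are not
  assumed to be monotone.
\<close>

locale FA_object = prop_category C
  for L :: "('c, 'q) language" and C :: "('o, 'm, 'p, 'c, 'q) propcat" +
  assumes opr_closed: "c \<in> Obj C \<Longrightarrow> k \<in> Conns L \<Longrightarrow> length xs = arity L k \<Longrightarrow>
      set xs \<subseteq> Prp C c \<Longrightarrow> Opr C c k xs \<in> Prp C c"
    and rdx_opr: "f \<in> hom C a b \<Longrightarrow> k \<in> Conns L \<Longrightarrow> length xs = arity L k \<Longrightarrow>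
      set xs \<subseteq> Prp C b \<Longrightarrow> Rdx C f (Opr C b k xs) = Opr C a k (map (Rdx C f) xs)"
    and tensor_assoc: "c \<in> Obj C \<Longrightarrow> x \<in> Prp C c \<Longrightarrow> y \<in> Prp C c \<Longrightarrow> z \<in> Prp C c \<Longrightarrow>
      tensor_op L C c (tensor_op L C c x y) z = tensor_op L C c x (tensor_op L C c y z)"
    and tensor_unit_left: "c \<in> Obj C \<Longrightarrow> x \<in> Prp C c \<Longrightarrow> tensor_op L C c (unit_op L C c) x = x"
    and tensor_unit_right: "c \<in> Obj C \<Longrightarrow> x \<in> Prp C c \<Longrightarrow> tensor_op L C c x (unit_op L C c) = x"
    and tensor_mono: "c \<in> Obj C \<Longrightarrow>
      x \<in> Prp C c \<Longrightarrow> x' \<in> Prp C c \<Longrightarrow> y \<in> Prp C c \<Longrightarrow> y' \<in> Prp C c \<Longrightarrow>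
      Leq C c x x' \<Longrightarrow> Leq C c y y' \<Longrightarrow> Leq C c (tensor_op L C c x y) (tensor_op L C c x' y')"
    and eql_closed: "c \<in> Obj C \<Longrightarrow> Eql C c \<in> Prp C (Prd C c c)"
    and eql_trm: "Eql C (Trm C) = unit_op L C (Prd C (Trm C) (Trm C))"
    and eql_prd: "c \<in> Obj C \<Longrightarrow> d \<in> Obj C \<Longrightarrow>
      Eql C (Prd C c d) =
        (let cd = Prd C c d; p1 = Pr1 C cd cd; p2 = Pr2 C cd cd
         in tensor_op L C (Prd C cd cd)
              (Rdx C (pair C (Cmp C (Pr1 C c d) p1) (Cmp C (Pr1 C c d) p2)) (Eql C c))
              (Rdx C (pair C (Cmp C (Pr2 C c d) p1) (Cmp C (Pr2 C c d) p2)) (Eql C d)))"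
    and qnt_closed: "q \<in> Quants L \<Longrightarrow> b \<in> Obj C \<Longrightarrow> c \<in> Obj C \<Longrightarrow> x \<in> Prp C (Prd C b c) \<Longrightarrow>
      Qnt C q b c x \<in> Prp C b"
    and qnt_natural: "q \<in> Quants L \<Longrightarrow> f \<in> hom C b' b \<Longrightarrow> c \<in> Obj C \<Longrightarrow> x \<in> Prp C (Prd C b c) \<Longrightarrow>
      Rdx C f (Qnt C q b c x) = Qnt C q b' c (Rdx C (map_left C f c) x)"
    and qnt_trm: "q \<in> Quants L \<Longrightarrow> b \<in> Obj C \<Longrightarrow> x \<in> Prp C b \<Longrightarrow>
      Qnt C q b (Trm C) (Rdx C (Pr1 C b (Trm C)) x) = x"
    and qnt_prd: "q \<in> Quants L \<Longrightarrow> b \<in> Obj C \<Longrightarrow> c \<in> Obj C \<Longrightarrow> d \<in> Obj C \<Longrightarrow>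
      x \<in> Prp C (Prd C (Prd C b c) d) \<Longrightarrow>
      Qnt C q b (Prd C c d) (Rdx C (assoc_arr C b c d) x) = Qnt C q b c (Qnt C q (Prd C b c) d x)"

definition Ob_FA :: "('c, 'q) language \<Rightarrow> ('o, 'm, 'p, 'c, 'q) propcat set" where
  "Ob_FA L = {C. FA_object L C}"


section \<open>Structures, satisfaction and semantic consequence\<close>

text \<open>The list \<open>[a\<^sub>1, \<dots>, a\<^sub>n]\<close> has the product $((1 \times a_1) \times \cdots) \times a_n$.\<close>

definition list_prd :: "('o, 'm, 'p, 'c, 'q) propcat \<Rightarrow> 'o list \<Rightarrow> 'o" where
  "list_prd C as = foldl (Prd C) (Trm C) as"

primrec list_proj_rev :: "('o, 'm, 'p, 'c, 'q) propcat \<Rightarrow> 'o list \<Rightarrow> nat \<Rightarrow> 'm" where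
  "list_proj_rev C [] i = undefined"
| "list_proj_rev C (a # as) i =
     (if i = length as then Pr2 C (list_prd C (rev as)) a
      else Cmp C (list_proj_rev C as i) (Pr1 C (list_prd C (rev as)) a))"

definition list_proj :: "('o, 'm, 'p, 'c, 'q) propcat \<Rightarrow> 'o list \<Rightarrow> nat \<Rightarrow> 'm" where
  "list_proj C as i = list_proj_rev C (rev as) i"

definition list_tuple :: "('o, 'm, 'p, 'c, 'q) propcat \<Rightarrow> 'o \<Rightarrow> 'm list \<Rightarrow> 'm" where
  "list_tuple C a fs = foldl (pair C) (bang C a) fs"

definition list_tensor ::
  "('c, 'q) language \<Rightarrow> ('o, 'm, 'p, 'c, 'q) propcat \<Rightarrow> 'o \<Rightarrow> 'p list \<Rightarrow> 'p" where
  "list_tensor L C c xs = foldr (tensor_op L C c) xs (unit_op L C c)"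

record ('s, 'f, 'r, 'o, 'm, 'p) struct =
  sort_int :: "'s \<Rightarrow> 'o"
  fun_int :: "'f \<Rightarrow> 'm"
  rel_int :: "'r \<Rightarrow> 'p"

definition ctx_int ::
  "('o, 'm, 'p, 'c, 'q) propcat \<Rightarrow> ('s, 'f, 'r, 'o, 'm, 'p) struct \<Rightarrow> 's list \<Rightarrow> 'o" where
  "ctx_int C M \<Gamma> = list_prd C (map (sort_int M) \<Gamma>)"

definition is_structure ::
  "('s, 'f, 'r) signature \<Rightarrow> ('o, 'm, 'p, 'c, 'q) propcat \<Rightarrow>
   ('s, 'f, 'r, 'o, 'm, 'p) struct \<Rightarrow> bool" where
  "is_structure Sg C M \<longleftrightarrow>
     (\<forall>\<sigma> \<in> Sorts Sg. sort_int M \<sigma> \<in> Obj C) \<and>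
     (\<forall>f \<in> Funs Sg. fun_int M f \<in> hom C (ctx_int C M (fdom Sg f)) (sort_int M (fcod Sg f))) \<and>
     (\<forall>r \<in> Rels Sg. rel_int M r \<in> Prp C (ctx_int C M (rdom Sg r)))"

primrec tm_int ::
  "('o, 'm, 'p, 'c, 'q) propcat \<Rightarrow> ('s, 'f, 'r, 'o, 'm, 'p) struct \<Rightarrow> 's list \<Rightarrow>
   'f tm \<Rightarrow> 'm" where
  "tm_int C M \<Gamma> (Var i) = list_proj C (map (sort_int M) \<Gamma>) i"
| "tm_int C M \<Gamma> (Fun f ts) =
     Cmp C (fun_int M f) (list_tuple C (ctx_int C M \<Gamma>) (map (tm_int C M \<Gamma>) ts))"

primrec fm_int ::
  "('o, 'm, 'p, 'c, 'q) propcat \<Rightarrow> ('s, 'f, 'r, 'o, 'm, 'p) struct \<Rightarrow> 's list \<Rightarrow>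
   ('s, 'f, 'r, 'c, 'q) fm \<Rightarrow> 'p" where
  "fm_int C M \<Gamma> (Rel r ts) =
     Rdx C (list_tuple C (ctx_int C M \<Gamma>) (map (tm_int C M \<Gamma>) ts)) (rel_int M r)"
| "fm_int C M \<Gamma> (Equ \<sigma> t u) =
     Rdx C (pair C (tm_int C M \<Gamma> t) (tm_int C M \<Gamma> u)) (Eql C (sort_int M \<sigma>))"
| "fm_int C M \<Gamma> (Conn k \<phi>s) = Opr C (ctx_int C M \<Gamma>) k (map (\<lambda>\<phi>. fm_int C M \<Gamma> \<phi>) \<phi>s)"
| "fm_int C M \<Gamma> (Quant q \<sigma> \<phi>) =
     Qnt C q (ctx_int C M \<Gamma>) (sort_int M \<sigma>) (fm_int C M (\<Gamma> @ [\<sigma>]) \<phi>)"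

primrec satisfies ::
  "('c, 'q) language \<Rightarrow> ('o, 'm, 'p, 'c, 'q) propcat \<Rightarrow>
   ('s, 'f, 'r, 'o, 'm, 'p) struct \<Rightarrow> ('s, 'f, 'r, 'c, 'q) assertion \<Rightarrow> bool" where
  "satisfies L C M (Eqn \<Gamma> \<sigma> t u) \<longleftrightarrow> tm_int C M \<Gamma> t = tm_int C M \<Gamma> u"
| "satisfies L C M (Seq \<Gamma> \<Phi> \<phi>) \<longleftrightarrow>
     Leq C (ctx_int C M \<Gamma>) (list_tensor L C (ctx_int C M \<Gamma>) (map (fm_int C M \<Gamma>) \<Phi>))
       (fm_int C M \<Gamma> \<phi>)"

definition is_model ::
  "('c, 'q) language \<Rightarrow> ('s, 'f, 'r) signature \<Rightarrow> ('o, 'm, 'p, 'c, 'q) propcat \<Rightarrow>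
   ('s, 'f, 'r, 'o, 'm, 'p) struct \<Rightarrow> ('s, 'f, 'r, 'c, 'q) assertion set \<Rightarrow> bool" where
  "is_model L Sg C M T \<longleftrightarrow> is_structure Sg C M \<and> (\<forall>a \<in> T. satisfies L C M a)"

definition entails ::
  "('c, 'q) language \<Rightarrow> ('s, 'f, 'r) signature \<Rightarrow> ('o, 'm, 'p, 'c, 'q) propcat set \<Rightarrow>
   ('s, 'f, 'r, 'c, 'q) assertion set \<Rightarrow> ('s, 'f, 'r, 'c, 'q) assertion set \<Rightarrow> bool" where
  "entails L Sg \<X> T T' \<longleftrightarrow>
     (\<forall>C \<in> \<X>. \<forall>M. is_model L Sg C M T \<longrightarrow> (\<forall>a \<in> T'. satisfies L C M a))"


section \<open>Morphisms and subprop-categories\<close>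

record ('o, 'm, 'p, 'o', 'm', 'p') fa_map =
  on_obj :: "'o \<Rightarrow> 'o'"
  on_arr :: "'m \<Rightarrow> 'm'"
  on_prp :: "'o \<Rightarrow> 'p \<Rightarrow> 'p'"

text \<open>The canonical comparison arrow $F(a \times b) \to F a \times F b$.\<close>

definition comparison ::
  "('o, 'm, 'p, 'c, 'q) propcat \<Rightarrow> ('o', 'm', 'p', 'c, 'q) propcat \<Rightarrow>
   ('o, 'm, 'p, 'o', 'm', 'p') fa_map \<Rightarrow> 'o \<Rightarrow> 'o \<Rightarrow> 'm'" where
  "comparison C D F a b = pair D (on_arr F (Pr1 C a b)) (on_arr F (Pr2 C a b))"

locale fp_functor =
  fixes C :: "('o, 'm, 'p, 'c, 'q) propcat"
    and D :: "('o', 'm', 'p', 'c, 'q) propcat"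
    and F :: "('o, 'm, 'p, 'o', 'm', 'p') fa_map"
  assumes on_obj_closed: "a \<in> Obj C \<Longrightarrow> on_obj F a \<in> Obj D"
    and on_arr_hom: "f \<in> hom C a b \<Longrightarrow> on_arr F f \<in> hom D (on_obj F a) (on_obj F b)"
    and on_arr_idn: "a \<in> Obj C \<Longrightarrow> on_arr F (Idn C a) = Idn D (on_obj F a)"
    and on_arr_cmp: "f \<in> hom C a b \<Longrightarrow> g \<in> hom C b c \<Longrightarrow>
      on_arr F (Cmp C g f) = Cmp D (on_arr F g) (on_arr F f)"
    and preserves_trm: "iso_arr D (bang D (on_obj F (Trm C)))"
    and preserves_prd: "a \<in> Obj C \<Longrightarrow> b \<in> Obj C \<Longrightarrow> iso_arr D (comparison C D F a b)"

locale FA_morphism = fp_functor C D F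
  for L :: "('c, 'q) language"
    and C :: "('o, 'm, 'p, 'c, 'q) propcat"
    and D :: "('o', 'm', 'p', 'c, 'q) propcat"
    and F :: "('o, 'm, 'p, 'o', 'm', 'p') fa_map" +
  assumes on_prp_closed: "c \<in> Obj C \<Longrightarrow> x \<in> Prp C c \<Longrightarrow> on_prp F c x \<in> Prp D (on_obj F c)"
    and on_prp_mono: "c \<in> Obj C \<Longrightarrow> x \<in> Prp C c \<Longrightarrow> y \<in> Prp C c \<Longrightarrow> Leq C c x y \<Longrightarrow>
      Leq D (on_obj F c) (on_prp F c x) (on_prp F c y)"
    and on_prp_natural: "f \<in> hom C a b \<Longrightarrow> x \<in> Prp C b \<Longrightarrow>
      on_prp F a (Rdx C f x) = Rdx D (on_arr F f) (on_prp F b x)"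
    and on_prp_opr: "c \<in> Obj C \<Longrightarrow> k \<in> Conns L \<Longrightarrow> length xs = arity L k \<Longrightarrow>
      set xs \<subseteq> Prp C c \<Longrightarrow>
      on_prp F c (Opr C c k xs) = Opr D (on_obj F c) k (map (on_prp F c) xs)"
    and on_prp_eql: "c \<in> Obj C \<Longrightarrow>
      on_prp F (Prd C c c) (Eql C c) = Rdx D (comparison C D F c c) (Eql D (on_obj F c))"
    and on_prp_qnt: "q \<in> Quants L \<Longrightarrow> b \<in> Obj C \<Longrightarrow> c \<in> Obj C \<Longrightarrow> x \<in> Prp C (Prd C b c) \<Longrightarrow>
      on_prp F b (Qnt C q b c x) =
        Qnt D q (on_obj F b) (on_obj F c)
          (Rdx D (inv_arr D (comparison C D F b c)) (on_prp F (Prd C b c) x))"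

definition faithful ::
  "('o, 'm, 'p, 'c, 'q) propcat \<Rightarrow> ('o, 'm, 'p, 'o', 'm', 'p') fa_map \<Rightarrow> bool" where
  "faithful C F \<longleftrightarrow>
     (\<forall>a \<in> Obj C. \<forall>b \<in> Obj C. \<forall>f \<in> hom C a b. \<forall>g \<in> hom C a b.
        on_arr F f = on_arr F g \<longrightarrow> f = g)"

definition order_embedding ::
  "('o, 'm, 'p, 'c, 'q) propcat \<Rightarrow> ('o', 'm', 'p', 'c, 'q) propcat \<Rightarrow>
   ('o, 'm, 'p, 'o', 'm', 'p') fa_map \<Rightarrow> bool" where
  "order_embedding C D F \<longleftrightarrow>
     (\<forall>c \<in> Obj C. \<forall>x \<in> Prp C c. \<forall>y \<in> Prp C c.
        Leq D (on_obj F c) (on_prp F c x) (on_prp F c y) \<longleftrightarrow> Leq C c x y)"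

definition subprop_category ::
  "('c, 'q) language \<Rightarrow> ('o, 'm, 'p, 'c, 'q) propcat \<Rightarrow> ('o', 'm', 'p', 'c, 'q) propcat \<Rightarrow> bool"
  where
  "subprop_category L E D \<longleftrightarrow> E \<in> Ob_FA L \<and>
     (\<exists>\<iota>. FA_morphism L E D \<iota> \<and> faithful E \<iota> \<and> order_embedding E D \<iota>)"


section \<open>Products of prop-categories\<close>

definition product_propcat ::
  "'i set \<Rightarrow> ('i \<Rightarrow> ('o, 'm, 'p, 'c, 'q) propcat) \<Rightarrow>
   ('i \<Rightarrow> 'o, 'i \<Rightarrow> 'm, 'i \<Rightarrow> 'p, 'c, 'q) propcat" where
  "product_propcat I C = \<lparr>
     Obj = (\<Pi>\<^sub>E i\<in>I. Obj (C i)),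
     Arr = (\<Pi>\<^sub>E i\<in>I. Arr (C i)),
     Src = (\<lambda>f. \<lambda>i\<in>I. Src (C i) (f i)),
     Tgt = (\<lambda>f. \<lambda>i\<in>I. Tgt (C i) (f i)),
     Idn = (\<lambda>a. \<lambda>i\<in>I. Idn (C i) (a i)),
     Cmp = (\<lambda>g f. \<lambda>i\<in>I. Cmp (C i) (g i) (f i)),
     Trm = (\<lambda>i\<in>I. Trm (C i)),
     Prd = (\<lambda>a b. \<lambda>i\<in>I. Prd (C i) (a i) (b i)),
     Pr1 = (\<lambda>a b. \<lambda>i\<in>I. Pr1 (C i) (a i) (b i)),
     Pr2 = (\<lambda>a b. \<lambda>i\<in>I. Pr2 (C i) (a i) (b i)),
     Prp = (\<lambda>c. \<Pi>\<^sub>E i\<in>I. Prp (C i) (c i)),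
     Leq = (\<lambda>c x y. \<forall>i\<in>I. Leq (C i) (c i) (x i) (y i)),
     Rdx = (\<lambda>f x. \<lambda>i\<in>I. Rdx (C i) (f i) (x i)),
     Opr = (\<lambda>c k xs. \<lambda>i\<in>I. Opr (C i) (c i) k (map (\<lambda>x. x i) xs)),
     Eql = (\<lambda>c. \<lambda>i\<in>I. Eql (C i) (c i)),
     Qnt = (\<lambda>q b c x. \<lambda>i\<in>I. Qnt (C i) q (b i) (c i) (x i)) \<rparr>"


section \<open>The classifying prop-category of a theory\<close>

definition tms_class ::
  "('s, 'f, 'r, 'c, 'q) assertion set \<Rightarrow> 's list \<Rightarrow> 's list \<Rightarrow> 'f tm list \<Rightarrow> 'f tm list set" where
  "tms_class T \<Gamma> \<Delta> ts =
     {us. length us = length \<Delta> \<and> (\<forall>i < length \<Delta>. Eqn \<Gamma> (\<Delta> ! i) (ts ! i) (us ! i) \<in> T)}"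

definition fm_class ::
  "('s, 'f, 'r, 'c, 'q) assertion set \<Rightarrow> 's list \<Rightarrow> ('s, 'f, 'r, 'c, 'q) fm \<Rightarrow>
   ('s, 'f, 'r, 'c, 'q) fm set" where
  "fm_class T \<Gamma> \<phi> = {\<psi>. Seq \<Gamma> [\<phi>] \<psi> \<in> T \<and> Seq \<Gamma> [\<psi>] \<phi> \<in> T}"

definition rep :: "'a set \<Rightarrow> 'a" where
  "rep A = (SOME x. x \<in> A)"

fun tensor_fms ::
  "('c, 'q) language \<Rightarrow> ('s, 'f, 'r, 'c, 'q) fm list \<Rightarrow> ('s, 'f, 'r, 'c, 'q) fm" where
  "tensor_fms L [] = unit_fm L"
| "tensor_fms L [\<phi>] = \<phi>"
| "tensor_fms L (\<phi> # \<psi> # \<psi>s) = tensor_fm L \<phi> (tensor_fms L (\<psi> # \<psi>s))"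

definition tms_arr ::
  "('s, 'f, 'r, 'c, 'q) assertion set \<Rightarrow> 's list \<Rightarrow> 's list \<Rightarrow> 'f tm list \<Rightarrow>
   's list \<times> 's list \<times> 'f tm list set" where
  "tms_arr T \<Gamma> \<Delta> ts = (\<Gamma>, \<Delta>, tms_class T \<Gamma> \<Delta> ts)"

definition classifying ::
  "('c, 'q) language \<Rightarrow> ('s, 'f, 'r) signature \<Rightarrow> ('s, 'f, 'r, 'c, 'q) assertion set \<Rightarrow>
   ('s list, 's list \<times> 's list \<times> 'f tm list set, ('s, 'f, 'r, 'c, 'q) fm set, 'c, 'q) propcat" where
  "classifying L Sg T = \<lparr>
     Obj = lists (Sorts Sg),
     Arr = {tms_arr T \<Gamma> \<Delta> ts | \<Gamma> \<Delta> ts.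
              \<Gamma> \<in> lists (Sorts Sg) \<and> \<Delta> \<in> lists (Sorts Sg) \<and> list_all2 (wt_tm Sg \<Gamma>) ts \<Delta>},
     Src = (\<lambda>(\<Gamma>, \<Delta>, A). \<Gamma>),
     Tgt = (\<lambda>(\<Gamma>, \<Delta>, A). \<Delta>),
     Idn = (\<lambda>\<Gamma>. tms_arr T \<Gamma> \<Gamma> (vars \<Gamma>)),
     Cmp = (\<lambda>(\<Delta>, \<Theta>, B) (\<Gamma>, \<Delta>', A). tms_arr T \<Gamma> \<Theta> (map (tm_subst (rep A)) (rep B))),
     Trm = [],
     Prd = (\<lambda>\<Gamma> \<Delta>. \<Gamma> @ \<Delta>),
     Pr1 = (\<lambda>\<Gamma> \<Delta>. tms_arr T (\<Gamma> @ \<Delta>) \<Gamma> (map Var [0..<length \<Gamma>])),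
     Pr2 = (\<lambda>\<Gamma> \<Delta>. tms_arr T (\<Gamma> @ \<Delta>) \<Delta> (map Var [length \<Gamma>..<length \<Gamma> + length \<Delta>])),
     Prp = (\<lambda>\<Gamma>. {fm_class T \<Gamma> \<phi> | \<phi>. wf_fm L Sg \<Gamma> \<phi>}),
     Leq = (\<lambda>\<Gamma> A B. \<exists>\<phi> \<in> A. \<exists>\<psi> \<in> B. Seq \<Gamma> [\<phi>] \<psi> \<in> T),
     Rdx = (\<lambda>(\<Gamma>, \<Delta>, A) B. fm_class T \<Gamma> (fm_subst (length \<Gamma>) (rep A) (rep B))),
     Opr = (\<lambda>\<Gamma> k As. fm_class T \<Gamma> (Conn k (map rep As))),
     Eql = (\<lambda>\<Gamma>. fm_class T (\<Gamma> @ \<Gamma>)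
              (tensor_fms L
                 (map (\<lambda>i. Equ (\<Gamma> ! i) (Var i) (Var (length \<Gamma> + i))) [0..<length \<Gamma>]))),
     Qnt = (\<lambda>q \<Gamma> \<Delta> A. fm_class T \<Gamma> (foldr (Quant q) \<Delta> (rep A))) \<rparr>"


section \<open>Operators on classes of prop-categories\<close>

text \<open>
  The carriers of a product, of a subprop-category and of a classifying prop-category live in types
  different from those of the prop-categories they are built from, so the operators below are
  typed accordingly. The type \<open>'i\<close> of indices plays the role of the universe of small sets:
  products are formed over arbitrary subsets of \<open>'i\<close>, and a set is small if it injects
  into \<open>'i\<close>. A product of products is, up to isomorphism, a single product, and
  subprop-categories of subprop-categories are subprop-categories, so one step suffices in
  \<open>prod_op\<close> (up to isomorphism) and in \<open>sub_op\<close>.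
\<close>

definition prod_op ::
  "('o, 'm, 'p, 'c, 'q) propcat set \<Rightarrow> ('i \<Rightarrow> 'o, 'i \<Rightarrow> 'm, 'i \<Rightarrow> 'p, 'c, 'q) propcat set" where
  "prod_op \<X> = {product_propcat I C | I C. \<forall>i \<in> I. C i \<in> \<X>}"

definition sub_op ::
  "('c, 'q) language \<Rightarrow> ('o, 'm, 'p, 'c, 'q) propcat set \<Rightarrow> ('o', 'm', 'p', 'c, 'q) propcat set" where
  "sub_op L \<X> = {E. \<exists>D \<in> \<X>. subprop_category L E D}"

definition classifying_op ::
  "('c, 'q) language \<Rightarrow> ('s, 'f, 'r) signature \<Rightarrow>
   ('s list, 's list \<times> 's list \<times> 'f tm list set, ('s, 'f, 'r, 'c, 'q) fm set, 'c, 'q) propcat set \<Rightarrow>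
   ('o, 'm, 'p, 'c, 'q) propcat set" where
  "classifying_op L Sg \<X> = {D \<in> Ob_FA L.
     \<forall>T. Lm_theory L Sg T \<and> subprop_category L (classifying L Sg T) D \<longrightarrow>
         classifying L Sg T \<in> \<X>}"

definition small :: "'i itself \<Rightarrow> 'a set \<Rightarrow> bool" where
  "small _ A \<longleftrightarrow> A \<lesssim> (UNIV :: 'i set)"

definition small_language :: "'i itself \<Rightarrow> ('c, 'q) language \<Rightarrow> bool" where
  "small_language U L \<longleftrightarrow> small U (Conns L) \<and> small U (Quants L)"

definition small_signature :: "'i itself \<Rightarrow> ('s, 'f, 'r) signature \<Rightarrow> bool" where
  "small_signature U Sg \<longleftrightarrow> small U (Sorts Sg) \<and> small U (Funs Sg) \<and> small U (Rels Sg)"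

end

theory Submission
  imports Defs
begin

text \<open>
  For a structure $M$ in a prop-category $D$, the set $\mathrm{Th}(M)$ of all assertions satisfied
  by $M$ is an $\mathcal{L}^m$-theory, and interpretation in $M$ embeds its classifying prop-category
  into $D$. Conversely, if $(\mathcal{C}_T,P_T)$ embeds into $D$, then the image of the generic model
  is a structure whose theory is exactly $T$. So the theories of the classifying subprop-categories
  of $D$ are precisely the theories of structures in $D$. A structure in a product is a family of
  structures, and its theory is the intersection of theirs.

  Both inclusions follow. If $D$ respects the consequences of $\mathcal{X}$ and $T = \mathrm{Th}(M)$,
  then every assertion outside $T$ is refuted by a model of $T$ in a member of $\mathcal{X}$; since
  there is only a small set of assertions, the product of these counterexamples has theory $T$. If
  conversely $\mathrm{Th}(M)$ is the theory of a structure in a product of members of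
  $\mathcal{X}$, it is an intersection of theories of structures in members of $\mathcal{X}$ and
  hence closed under their common consequences.
\<close>


section \<open>Categories with finite products\<close>

text \<open>The difficulty is a gap in strictness. Products in \<open>classifying\<close> are
  concatenations of contexts and associate strictly. A structure interprets a context as a
  left-nested product starting from the terminal object, and morphisms preserve products only up to
  isomorphism. So interpretation carries concatenation to a product only through the isomorphism
  \<open>split_ctx\<close>, and an embedding of the classifying prop-category is compared with
  interpretation through another one, \<open>kappa\<close>. Quantification over a whole context and
  equality at a context are transported along these; for this the axioms \<open>qnt_trm\<close>,
  \<open>qnt_prd\<close>, \<open>eql_trm\<close> and \<open>eql_prd\<close> are used. An embedding
  must also reflect: faithfulness turns an equation that holds in the image into a provable one, and
  order embedding does this for sequents once the antecedent is folded into one formula by the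
  two-way tensor and unit rules. Hence the image has theory T and not a larger one. A theory
  containing all well-formed assertions leaves nothing to refute. The family of counterexamples is
  then empty, and the empty product, in which every well-formed assertion holds, is the right
  one.\<close>

context fp_category
begin

lemma hom_iff: "f \<in> hom C a b \<longleftrightarrow> f \<in> Arr C \<and> Src C f = a \<and> Tgt C f = b"
  by (auto simp: hom_def)

lemma src_in_obj [simp]: "f \<in> Arr C \<Longrightarrow> Src C f \<in> Obj C"
  and tgt_in_obj [simp]: "f \<in> Arr C \<Longrightarrow> Tgt C f \<in> Obj C"
  by (fact src_obj tgt_obj)+

lemma idn_arr [simp]:
  assumes "a \<in> Obj C"
  shows "Idn C a \<in> Arr C" "Src C (Idn C a) = a" "Tgt C (Idn C a) = a"
  using idn_hom[OF assms] by (auto simp: hom_def)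

lemma cmp_arr [simp]:
  assumes "f \<in> Arr C" "g \<in> Arr C" "Src C g = Tgt C f"
  shows "Cmp C g f \<in> Arr C" "Src C (Cmp C g f) = Src C f" "Tgt C (Cmp C g f) = Tgt C g"
  using cmp_hom[of f "Src C f" "Tgt C f" g "Tgt C g"] assms by (auto simp: hom_def)

lemma cmp_idn [simp]:
  "f \<in> Arr C \<Longrightarrow> Src C f = a \<Longrightarrow> Cmp C f (Idn C a) = f"
  "f \<in> Arr C \<Longrightarrow> Tgt C f = b \<Longrightarrow> Cmp C (Idn C b) f = f"
  using cmp_idn_right cmp_idn_left by (auto simp: hom_def)

text \<open>Oriented to the right as a rewrite rule, so that composites have a normal form. Where
  the opposite bracketing is wanted, it is stated as a separate equation.\<close>

lemma cmp_assoc_simp [simp]: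
  assumes "f \<in> Arr C" "g \<in> Arr C" "h \<in> Arr C" "Src C g = Tgt C f" "Src C h = Tgt C g"
  shows "Cmp C (Cmp C h g) f = Cmp C h (Cmp C g f)"
  using cmp_assoc[of f "Src C f" "Tgt C f" g "Tgt C g" h "Tgt C h"] assms by (auto simp: hom_def)

declare trm_obj [simp] prd_obj [simp]

lemma pr_arr [simp]:
  assumes "a \<in> Obj C" "b \<in> Obj C"
  shows "Pr1 C a b \<in> Arr C" "Src C (Pr1 C a b) = Prd C a b" "Tgt C (Pr1 C a b) = a"
    and "Pr2 C a b \<in> Arr C" "Src C (Pr2 C a b) = Prd C a b" "Tgt C (Pr2 C a b) = b"
  using pr1_hom[OF assms] pr2_hom[OF assms] by (auto simp: hom_def)

lemma bang_hom: "a \<in> Obj C \<Longrightarrow> bang C a \<in> hom C a (Trm C)"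
  unfolding bang_def by (rule theI') (rule trm_universal)

lemma bang_arr [simp]:
  assumes "a \<in> Obj C"
  shows "bang C a \<in> Arr C" "Src C (bang C a) = a" "Tgt C (bang C a) = Trm C"
  using bang_hom[OF assms] by (auto simp: hom_def)

lemma trm_ext: "f \<in> hom C a (Trm C) \<Longrightarrow> g \<in> hom C a (Trm C) \<Longrightarrow> f = g"
  using trm_universal[of a] by (auto simp: hom_def)

lemma bang_unique: "f \<in> Arr C \<Longrightarrow> Tgt C f = Trm C \<Longrightarrow> f = bang C (Src C f)"
  by (rule trm_ext[of _ "Src C f"]) (simp_all add: hom_iff)

lemma bang_cmp [simp]:
  assumes "h \<in> Arr C" "Tgt C h = a"
  shows "Cmp C (bang C a) h = bang C (Src C h)"
  using assms by (intro trm_ext[of _ "Src C h"]) (auto simp: hom_iff)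

lemma pair_props:
  assumes "f \<in> Arr C" "g \<in> Arr C" "Src C g = Src C f"
  shows "pair C f g \<in> hom C (Src C f) (Prd C (Tgt C f) (Tgt C g)) \<and>
    Cmp C (Pr1 C (Tgt C f) (Tgt C g)) (pair C f g) = f \<and>
    Cmp C (Pr2 C (Tgt C f) (Tgt C g)) (pair C f g) = g"
proof -
  have "f \<in> hom C (Src C f) (Tgt C f)" "g \<in> hom C (Src C f) (Tgt C g)"
    using assms by (auto simp: hom_def)
  from prd_universal[OF this] show ?thesis
    unfolding pair_def by (rule theI')
qed

lemma pair_arr [simp]:
  assumes "f \<in> Arr C" "g \<in> Arr C" "Src C g = Src C f"
  shows "pair C f g \<in> Arr C" "Src C (pair C f g) = Src C f"
    "Tgt C (pair C f g) = Prd C (Tgt C f) (Tgt C g)"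
    "Tgt C f = a \<Longrightarrow> Tgt C g = b \<Longrightarrow> Cmp C (Pr1 C a b) (pair C f g) = f"
    "Tgt C f = a \<Longrightarrow> Tgt C g = b \<Longrightarrow> Cmp C (Pr2 C a b) (pair C f g) = g"
  using pair_props[OF assms] by (auto simp: hom_iff)

text \<open>Joint monicity of the two projections, the uniqueness half of the universal property.
  Equations between pairings reduce to it.\<close>

lemma prd_ext:
  assumes "h \<in> Arr C" "k \<in> Arr C" "Src C h = Src C k"
    "Tgt C h = Prd C a b" "Tgt C k = Prd C a b" "a \<in> Obj C" "b \<in> Obj C"
    "Cmp C (Pr1 C a b) h = Cmp C (Pr1 C a b) k"
    "Cmp C (Pr2 C a b) h = Cmp C (Pr2 C a b) k"
  shows "h = k"
proof -
  have "Cmp C (Pr1 C a b) k \<in> hom C (Src C k) a" "Cmp C (Pr2 C a b) k \<in> hom C (Src C k) b"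
    using assms(1-7) by (simp_all add: hom_iff)
  from prd_universal[OF this] show ?thesis
    using assms unfolding hom_iff by blast
qed

lemma pair_eta [simp]:
  assumes "h \<in> Arr C" "Tgt C h = Prd C a b" "a \<in> Obj C" "b \<in> Obj C"
  shows "pair C (Cmp C (Pr1 C a b) h) (Cmp C (Pr2 C a b) h) = h"
  by (rule prd_ext[where a=a and b=b]) (use assms in simp_all)

lemma pair_pr [simp]: "a \<in> Obj C \<Longrightarrow> b \<in> Obj C \<Longrightarrow> pair C (Pr1 C a b) (Pr2 C a b) = Idn C (Prd C a b)"
  by (rule prd_ext[where a=a and b=b]) simp_all

lemma pair_cmp [simp]:
  assumes "f \<in> Arr C" "g \<in> Arr C" "h \<in> Arr C" "Src C g = Src C f" "Src C f = Tgt C h"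
  shows "Cmp C (pair C f g) h = pair C (Cmp C f h) (Cmp C g h)"
proof (rule prd_ext[where a="Tgt C f" and b="Tgt C g"])
  show "Cmp C (Pr1 C (Tgt C f) (Tgt C g)) (Cmp C (pair C f g) h) =
    Cmp C (Pr1 C (Tgt C f) (Tgt C g)) (pair C (Cmp C f h) (Cmp C g h))"
    using assms by (simp flip: cmp_assoc_simp)
  show "Cmp C (Pr2 C (Tgt C f) (Tgt C g)) (Cmp C (pair C f g) h) =
    Cmp C (Pr2 C (Tgt C f) (Tgt C g)) (pair C (Cmp C f h) (Cmp C g h))"
    using assms by (simp flip: cmp_assoc_simp)
qed (use assms in simp_all)

section \<open>Isomorphisms and their inverses\<close>

lemma inverse_arr_unique:
  assumes "inverse_arr C f g" "inverse_arr C f h"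
  shows "g = h"
proof -
  have "g = Cmp C (Cmp C h f) g"
    using assms by (auto simp: inverse_arr_def hom_iff)
  also have "\<dots> = Cmp C h (Cmp C f g)"
    using assms by (intro cmp_assoc_simp) (auto simp: inverse_arr_def hom_iff)
  also have "\<dots> = h"
    using assms by (auto simp: inverse_arr_def hom_iff)
  finally show ?thesis .
qed

lemma inv_arr_eq: "inverse_arr C f g \<Longrightarrow> inv_arr C f = g"
  unfolding inv_arr_def by (blast intro: inverse_arr_unique)

lemma inv_arr_props:
  assumes "iso_arr C f"
  shows "f \<in> Arr C" "inv_arr C f \<in> Arr C" "Src C (inv_arr C f) = Tgt C f"
    "Tgt C (inv_arr C f) = Src C f" "Cmp C (inv_arr C f) f = Idn C (Src C f)"
    "Cmp C f (inv_arr C f) = Idn C (Tgt C f)"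
proof -
  obtain g where g: "inverse_arr C f g"
    using assms by (auto simp: iso_arr_def)
  then show "f \<in> Arr C" "inv_arr C f \<in> Arr C" "Src C (inv_arr C f) = Tgt C f"
    "Tgt C (inv_arr C f) = Src C f" "Cmp C (inv_arr C f) f = Idn C (Src C f)"
    "Cmp C f (inv_arr C f) = Idn C (Tgt C f)"
    unfolding inv_arr_eq[OF g] by (auto simp: inverse_arr_def hom_iff)
qed

lemma iso_arrI:
  assumes "f \<in> Arr C" "g \<in> Arr C" "Src C g = Tgt C f" "Tgt C g = Src C f"
    "Cmp C g f = Idn C (Src C f)" "Cmp C f g = Idn C (Tgt C f)"
  shows "iso_arr C f" "inv_arr C f = g"
proof -
  have "inverse_arr C f g"
    using assms by (auto simp: inverse_arr_def hom_iff)
  then show "iso_arr C f" "inv_arr C f = g"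
    by (auto simp: iso_arr_def intro: inv_arr_eq)
qed

text \<open>The inverse is given explicitly because \<open>on_prp_qnt\<close> reindexes along the
  inverse of a comparison arrow, which later has to be computed.\<close>

lemma iso_cmp:
  assumes "iso_arr C f" "iso_arr C g" "Src C g = Tgt C f"
  shows "iso_arr C (Cmp C g f)" "inv_arr C (Cmp C g f) = Cmp C (inv_arr C f) (inv_arr C g)"
proof -
  note [simp] = inv_arr_props[OF assms(1)] inv_arr_props[OF assms(2)] assms(3)
  have 1: "Cmp C (Cmp C (inv_arr C f) (inv_arr C g)) (Cmp C g f) = Idn C (Src C f)"
  proof -
    have "Cmp C (inv_arr C g) (Cmp C g f) = Cmp C (Cmp C (inv_arr C g) g) f"
      by (subst cmp_assoc_simp) (simp_all del: cmp_assoc_simp)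
    then show ?thesis by simp
  qed
  have 2: "Cmp C (Cmp C g f) (Cmp C (inv_arr C f) (inv_arr C g)) = Idn C (Tgt C g)"
  proof -
    have "Cmp C f (Cmp C (inv_arr C f) (inv_arr C g)) = Cmp C (Cmp C f (inv_arr C f)) (inv_arr C g)"
      by (subst cmp_assoc_simp) (simp_all del: cmp_assoc_simp)
    then show ?thesis by simp
  qed
  show "iso_arr C (Cmp C g f)" "inv_arr C (Cmp C g f) = Cmp C (inv_arr C f) (inv_arr C g)"
    by (rule iso_arrI[where g="Cmp C (inv_arr C f) (inv_arr C g)"]; use 1 2 in simp)+
qed

lemma map_left_arr [simp]:
  assumes "f \<in> Arr C" "c \<in> Obj C"
  shows "map_left C f c \<in> Arr C" "Src C (map_left C f c) = Prd C (Src C f) c"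
    "Tgt C (map_left C f c) = Prd C (Tgt C f) c"
  using assms by (simp_all add: map_left_def)

lemma map_left_cmp:
  assumes "f \<in> Arr C" "g \<in> Arr C" "Src C g = Tgt C f" "c \<in> Obj C"
  shows "Cmp C (map_left C g c) (map_left C f c) = map_left C (Cmp C g f) c"
  using assms by (simp add: map_left_def)

lemma map_left_idn: "a \<in> Obj C \<Longrightarrow> c \<in> Obj C \<Longrightarrow> map_left C (Idn C a) c = Idn C (Prd C a c)"
  by (simp add: map_left_def)

lemma iso_map_left:
  assumes "iso_arr C f" "c \<in> Obj C"
  shows "iso_arr C (map_left C f c)" "inv_arr C (map_left C f c) = map_left C (inv_arr C f) c"
proof -
  note [simp] = inv_arr_props[OF assms(1)] assms(2)
  show "iso_arr C (map_left C f c)" "inv_arr C (map_left C f c) = map_left C (inv_arr C f) c"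
    by (rule iso_arrI[where g="map_left C (inv_arr C f) c"]; simp add: map_left_cmp map_left_idn)+
qed

text \<open>This is the comparison arrow for appending the empty context; its inverse is the
  projection along which \<open>qnt_trm\<close> reindexes.\<close>

lemma iso_pair_bang:
  assumes "a \<in> Obj C"
  shows "iso_arr C (pair C (Idn C a) (bang C a))"
    "inv_arr C (pair C (Idn C a) (bang C a)) = Pr1 C a (Trm C)"
proof -
  have "Cmp C (pair C (Idn C a) (bang C a)) (Pr1 C a (Trm C)) = Idn C (Prd C a (Trm C))"
    by (rule prd_ext[where a=a and b="Trm C"])
      (use assms bang_unique[of "Pr2 C a (Trm C)"] in simp_all)
  then show "iso_arr C (pair C (Idn C a) (bang C a))"
    "inv_arr C (pair C (Idn C a) (bang C a)) = Pr1 C a (Trm C)"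
    using iso_arrI[of "pair C (Idn C a) (bang C a)" "Pr1 C a (Trm C)"] assms by simp_all
qed

lemma assoc_arr_arr [simp]:
  assumes "b \<in> Obj C" "c \<in> Obj C" "d \<in> Obj C"
  shows "assoc_arr C b c d \<in> Arr C" "Src C (assoc_arr C b c d) = Prd C b (Prd C c d)"
    "Tgt C (assoc_arr C b c d) = Prd C (Prd C b c) d"
  using assms by (simp_all add: assoc_arr_def Let_def)

end

section \<open>Products, projections and tuples for lists of objects\<close>

lemma list_prd_simps [simp]:
  "list_prd C [] = Trm C"
  "list_prd C (as @ [a]) = Prd C (list_prd C as) a"
  by (simp_all add: list_prd_def)

text \<open>Products nest to the left, so projections are computed at the right end of the list;
  this is the form used by inductions that append a sort to a context.\<close>

lemma list_proj_snoc:
  "list_proj C (as @ [a]) i =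
    (if i = length as then Pr2 C (list_prd C as) a
     else Cmp C (list_proj C as i) (Pr1 C (list_prd C as) a))"
  by (simp add: list_proj_def)

lemma list_tuple_simps [simp]:
  "list_tuple C x [] = bang C x"
  "list_tuple C x (fs @ [f]) = pair C (list_tuple C x fs) f"
  by (simp_all add: list_tuple_def)

context fp_category
begin

lemma list_prd_obj [simp]: "set as \<subseteq> Obj C \<Longrightarrow> list_prd C as \<in> Obj C"
  by (induction as rule: rev_induct) auto

lemma list_proj_arr [simp]:
  assumes "set as \<subseteq> Obj C" "i < length as"
  shows "list_proj C as i \<in> Arr C" "Src C (list_proj C as i) = list_prd C as"
    "Tgt C (list_proj C as i) = as ! i"
  using assms
  by (induction as rule: rev_induct)
    (auto simp: list_proj_snoc nth_append less_Suc_eq)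

lemma list_tuple_arr [simp]:
  assumes "x \<in> Obj C" "\<forall>f \<in> set fs. f \<in> Arr C \<and> Src C f = x"
  shows "list_tuple C x fs \<in> Arr C" "Src C (list_tuple C x fs) = x"
    "Tgt C (list_tuple C x fs) = list_prd C (map (Tgt C) fs)"
  using assms(2)
  by (induction fs rule: rev_induct) (auto simp: assms(1))

lemma list_proj_tuple:
  assumes "x \<in> Obj C" "\<forall>f \<in> set fs. f \<in> Arr C \<and> Src C f = x"
    and "i < length fs" "as = map (Tgt C) fs"
  shows "Cmp C (list_proj C as i) (list_tuple C x fs) = fs ! i"
  using assms(2-)
proof (induction fs arbitrary: as rule: rev_induct)
  case (snoc f fs)
  have [simp]: "f \<in> Arr C" "Src C f = x" "\<forall>f \<in> set fs. f \<in> Arr C \<and> Src C f = x"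
    using snoc.prems by auto
  have obj: "Tgt C ` set fs \<subseteq> Obj C"
    by auto
  show ?case
    using snoc.prems(2,3) snoc.IH[of "map (Tgt C) fs"] assms(1) obj
    by (auto simp: list_proj_snoc nth_append less_Suc_eq)
qed simp

lemma list_tuple_cmp:
  assumes "x \<in> Obj C" "\<forall>f \<in> set fs. f \<in> Arr C \<and> Src C f = x"
    and "h \<in> Arr C" "Tgt C h = x"
  shows "Cmp C (list_tuple C x fs) h = list_tuple C (Src C h) (map (\<lambda>f. Cmp C f h) fs)"
  using assms(2) by (induction fs rule: rev_induct) (simp_all add: assms(1,3,4))

text \<open>Iterates \<open>prd_ext\<close> along the list; at the empty list the terminal object
  leaves only one arrow.\<close>

lemma list_prd_ext:
  assumes "set as \<subseteq> Obj C" "f \<in> Arr C" "g \<in> Arr C" "Src C f = Src C g"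
    "Tgt C f = list_prd C as" "Tgt C g = list_prd C as"
    "\<And>i. i < length as \<Longrightarrow> Cmp C (list_proj C as i) f = Cmp C (list_proj C as i) g"
  shows "f = g"
  using assms
proof (induction as arbitrary: f g rule: rev_induct)
  case Nil
  then show ?case by (simp add: trm_ext[of f "Src C g" g] hom_iff)
next
  case (snoc a as)
  have [simp]: "set as \<subseteq> Obj C" "a \<in> Obj C"
    using snoc.prems(1) by auto
  note [simp] = snoc.prems(2-6)
  have "Cmp C (Pr1 C (list_prd C as) a) f = Cmp C (Pr1 C (list_prd C as) a) g"
  proof (rule snoc.IH)
    fix i assume "i < length as"
    then show "Cmp C (list_proj C as i) (Cmp C (Pr1 C (list_prd C as) a) f) =
      Cmp C (list_proj C as i) (Cmp C (Pr1 C (list_prd C as) a) g)"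
      using snoc.prems(7)[of i] by (simp add: list_proj_snoc)
  qed simp_all
  moreover have "Cmp C (Pr2 C (list_prd C as) a) f = Cmp C (Pr2 C (list_prd C as) a) g"
    using snoc.prems(7)[of "length as"] by (simp add: list_proj_snoc)
  ultimately show ?case
    by - (rule prd_ext[where a="list_prd C as" and b=a]; simp)
qed

end


section \<open>Interpretation of terms and formulas\<close>

lemma in_lists_subset: "xs \<in> lists A \<longleftrightarrow> set xs \<subseteq> A"
  by auto

lemma ctx_int_simps [simp]:
  "ctx_int C M [] = Trm C"
  "ctx_int C M (\<Gamma> @ [\<sigma>]) = Prd C (ctx_int C M \<Gamma>) (sort_int M \<sigma>)"
  by (simp_all add: ctx_int_def)

section \<open>Typing and syntactic substitution\<close>

lemma wt_tm_append: "wt_tm Sg \<Gamma> t \<sigma> \<Longrightarrow> wt_tm Sg (\<Gamma> @ \<Delta>) t \<sigma>"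
proof (induction rule: wt_tm.induct)
  case (1 i)
  then show ?case
    using wt_tm.intros(1)[of i "\<Gamma> @ \<Delta>"] by (simp add: nth_append)
next
  case (2 f ts)
  then show ?case
    by (intro wt_tm.intros) (auto elim!: list_all2_mono)
qed

lemma wt_tm_Var: "wt_tm Sg \<Gamma> (Var i) \<sigma> \<longleftrightarrow> i < length \<Gamma> \<and> \<sigma> = \<Gamma> ! i"
  by (auto elim: wt_tm.cases intro: wt_tm.intros)

lemma wt_tm_Fun:
  "wt_tm Sg \<Gamma> (Fun f ts) \<sigma> \<longleftrightarrow>
    f \<in> Funs Sg \<and> list_all2 (wt_tm Sg \<Gamma>) ts (fdom Sg f) \<and> \<sigma> = fcod Sg f"
  by (auto elim: wt_tm.cases intro: wt_tm.intros)

lemma wf_fm_simps [simp]: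
  "wf_fm L Sg \<Gamma> (Rel r ts) \<longleftrightarrow> r \<in> Rels Sg \<and> list_all2 (wt_tm Sg \<Gamma>) ts (rdom Sg r)"
  "wf_fm L Sg \<Gamma> (Equ \<sigma> t u) \<longleftrightarrow> \<sigma> \<in> Sorts Sg \<and> wt_tm Sg \<Gamma> t \<sigma> \<and> wt_tm Sg \<Gamma> u \<sigma>"
  "wf_fm L Sg \<Gamma> (Conn k \<phi>s) \<longleftrightarrow>
    k \<in> Conns L \<and> length \<phi>s = arity L k \<and> (\<forall>\<phi> \<in> set \<phi>s. wf_fm L Sg \<Gamma> \<phi>)"
  "wf_fm L Sg \<Gamma> (Quant q \<sigma> \<phi>) \<longleftrightarrow> q \<in> Quants L \<and> \<sigma> \<in> Sorts Sg \<and> wf_fm L Sg (\<Gamma> @ [\<sigma>]) \<phi>"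
  by (auto elim: wf_fm.cases intro: wf_fm.intros)

lemma wt_tm_in_Sorts:
  "is_signature Sg \<Longrightarrow> wt_tm Sg \<Gamma> t \<sigma> \<Longrightarrow> set \<Gamma> \<subseteq> Sorts Sg \<Longrightarrow> \<sigma> \<in> Sorts Sg"
  by (erule wt_tm.cases) (auto simp: is_signature_def)

lemma wt_tm_subst:
  "wt_tm Sg \<Gamma> t \<sigma> \<Longrightarrow> list_all2 (wt_tm Sg \<Delta>) ts \<Gamma> \<Longrightarrow> wt_tm Sg \<Delta> (tm_subst ts t) \<sigma>"
proof (induction rule: wt_tm.induct)
  case (1 i)
  then show ?case by (simp add: list_all2_conv_all_nth)
next
  case (2 f us)
  then show ?case
    by (auto simp: wt_tm_Fun list_all2_conv_all_nth)
qed

lemma wt_tms_subst: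
  "list_all2 (wt_tm Sg \<Gamma>) us \<Theta> \<Longrightarrow> list_all2 (wt_tm Sg \<Delta>) ts \<Gamma> \<Longrightarrow>
    list_all2 (wt_tm Sg \<Delta>) (map (tm_subst ts) us) \<Theta>"
  unfolding list_all2_map1 by (erule list_all2_mono) (rule wt_tm_subst)

lemma wt_tms_append: "list_all2 (wt_tm Sg \<Gamma>) ts \<Theta> \<Longrightarrow> list_all2 (wt_tm Sg (\<Gamma> @ \<Delta>)) ts \<Theta>"
  by (auto simp: list_all2_conv_all_nth intro: wt_tm_append)

lemma wt_vars: "list_all2 (wt_tm Sg (\<Gamma> @ \<Delta>)) (vars \<Gamma>) \<Gamma>"
  by (auto simp: list_all2_conv_all_nth vars_def wt_tm_Var nth_append)

lemma wt_vars_same: "list_all2 (wt_tm Sg \<Gamma>) (vars \<Gamma>) \<Gamma>"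
  using wt_vars[of Sg \<Gamma> "[]"] by simp

text \<open>The substitution that \<open>fm_subst\<close> uses under a binder: the old terms are
  kept, and the bound variable is sent to the one at the first free level of the target
  context.\<close>

lemma wt_lift:
  "list_all2 (wt_tm Sg \<Delta>) ts \<Gamma> \<Longrightarrow>
    list_all2 (wt_tm Sg (\<Delta> @ [\<sigma>])) (ts @ [Var (length \<Delta>)]) (\<Gamma> @ [\<sigma>])"
  by (rule list_all2_appendI) (simp_all add: wt_tms_append wt_tm_Var)

lemma wf_fm_subst:
  "wf_fm L Sg \<Gamma> \<phi> \<Longrightarrow> list_all2 (wt_tm Sg \<Delta>) ts \<Gamma> \<Longrightarrow> wf_fm L Sg \<Delta> (fm_subst (length \<Delta>) ts \<phi>)"
proof (induction arbitrary: \<Delta> ts rule: wf_fm.induct)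
  case (4 q \<sigma> \<Gamma> \<phi>)
  then show ?case
    using "4.IH"[OF wt_lift, of \<Delta> ts] by simp
qed (auto intro: wt_tms_subst wt_tm_subst)

lemma tm_subst_vars: "wt_tm Sg \<Gamma> t \<sigma> \<Longrightarrow> tm_subst (vars \<Gamma>) t = t"
proof (induction rule: wt_tm.induct)
  case (2 f ts)
  then show ?case
    by (auto simp: list_all2_conv_all_nth in_set_conv_nth intro!: map_idI)
qed (simp add: vars_def)

lemma tms_subst_vars: "list_all2 (wt_tm Sg \<Gamma>) ts \<Delta> \<Longrightarrow> map (tm_subst (vars \<Gamma>)) ts = ts"
  by (induction rule: list_all2_induct) (simp_all add: tm_subst_vars)

text \<open>Adds the arities of the unit and tensor symbols, so that \<open>opr_closed\<close> and
  \<open>rdx_opr\<close> apply to the monoid operations.\<close>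

locale FA_language = FA_object L C
  for L :: "('c, 'q) language" and C :: "('o, 'm, 'p, 'c, 'q) propcat" +
  assumes lang: "is_language L"
begin

lemma unit_tensor_conn [simp]:
  "unit_conn L \<in> Conns L" "arity L (unit_conn L) = 0"
  "tensor_conn L \<in> Conns L" "arity L (tensor_conn L) = 2"
  using lang by (auto simp: is_language_def)

lemma unit_closed [simp]: "c \<in> Obj C \<Longrightarrow> unit_op L C c \<in> Prp C c"
  by (rule opr_closed) simp_all

lemma tensor_closed [simp]:
  "c \<in> Obj C \<Longrightarrow> x \<in> Prp C c \<Longrightarrow> y \<in> Prp C c \<Longrightarrow> tensor_op L C c x y \<in> Prp C c"
  by (rule opr_closed) simp_all

declare tensor_unit_left [simp] tensor_unit_right [simp] leq_refl [simp]

lemma rdx_in [simp]: "f \<in> Arr C \<Longrightarrow> Tgt C f = b \<Longrightarrow> Src C f = a \<Longrightarrow> x \<in> Prp C b \<Longrightarrow> Rdx C f x \<in> Prp C a"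
  by (rule rdx_closed[of f a b]) (auto simp: hom_iff)

lemma rdx_rdx: "f \<in> Arr C \<Longrightarrow> g \<in> Arr C \<Longrightarrow> Tgt C f = Src C g \<Longrightarrow> x \<in> Prp C (Tgt C g) \<Longrightarrow>
   Rdx C f (Rdx C g x) = Rdx C (Cmp C g f) x"
  by (rule rdx_cmp[of f "Src C f" "Src C g" g "Tgt C g", symmetric]) (auto simp: hom_iff)

text \<open>Reindexing along the inverse undoes reindexing along the isomorphism, and both are
  monotone. Sequents can thus be compared after transport along \<open>kappa\<close>.\<close>

lemma rdx_iso_leq:
  assumes "iso_arr C f" "x \<in> Prp C (Tgt C f)" "y \<in> Prp C (Tgt C f)"
  shows "Leq C (Src C f) (Rdx C f x) (Rdx C f y) \<longleftrightarrow> Leq C (Tgt C f) x y"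
proof
  note [simp] = inv_arr_props[OF assms(1)] assms(2,3)
  have inv: "inv_arr C f \<in> hom C (Tgt C f) (Src C f)" "f \<in> hom C (Src C f) (Tgt C f)"
    by (simp_all add: hom_iff)
  show "Leq C (Src C f) (Rdx C f x) (Rdx C f y)" if "Leq C (Tgt C f) x y"
    by (rule rdx_mono[OF inv(2)]) (use that in simp_all)
  have "Rdx C (inv_arr C f) (Rdx C f z) = z" if "z \<in> Prp C (Tgt C f)" for z
    using that by (simp add: rdx_rdx rdx_idn)
  then show "Leq C (Tgt C f) x y" if "Leq C (Src C f) (Rdx C f x) (Rdx C f y)"
    using rdx_mono[OF inv(1) _ _ that] by simp
qed

lemma list_tensor_closed [simp]:
  "c \<in> Obj C \<Longrightarrow> set xs \<subseteq> Prp C c \<Longrightarrow> list_tensor L C c xs \<in> Prp C c"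
  by (induction xs) (simp_all add: list_tensor_def)

lemma list_tensor_simps [simp]:
  "list_tensor L C c [] = unit_op L C c"
  "list_tensor L C c (x # xs) = tensor_op L C c x (list_tensor L C c xs)"
  by (simp_all add: list_tensor_def)

text \<open>By the monoid laws the bracketing of an antecedent does not matter, so a formula in the
  middle of a list can be isolated, as Cut and the tensor and unit rules require.\<close>

lemma list_tensor_append:
  "c \<in> Obj C \<Longrightarrow> set xs \<subseteq> Prp C c \<Longrightarrow> set ys \<subseteq> Prp C c \<Longrightarrow>
    list_tensor L C c (xs @ ys) = tensor_op L C c (list_tensor L C c xs) (list_tensor L C c ys)"
  by (induction xs) (simp_all add: tensor_assoc)

lemma rdx_unit:
  "f \<in> Arr C \<Longrightarrow> Rdx C f (unit_op L C (Tgt C f)) = unit_op L C (Src C f)"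
  using rdx_opr[of f "Src C f" "Tgt C f" "unit_conn L" "[]"] by (simp add: hom_iff)

lemma rdx_tensor:
  "f \<in> Arr C \<Longrightarrow> x \<in> Prp C (Tgt C f) \<Longrightarrow> y \<in> Prp C (Tgt C f) \<Longrightarrow>
    Rdx C f (tensor_op L C (Tgt C f) x y) = tensor_op L C (Src C f) (Rdx C f x) (Rdx C f y)"
  using rdx_opr[of f "Src C f" "Tgt C f" "tensor_conn L" "[x, y]"] by (simp add: hom_iff)

lemma rdx_list_tensor:
  "f \<in> Arr C \<Longrightarrow> set xs \<subseteq> Prp C (Tgt C f) \<Longrightarrow>
    Rdx C f (list_tensor L C (Tgt C f) xs) = list_tensor L C (Src C f) (map (Rdx C f) xs)"
  by (induction xs) (simp_all add: rdx_unit rdx_tensor)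

lemma qnt_in [simp]:
  "q \<in> Quants L \<Longrightarrow> b \<in> Obj C \<Longrightarrow> c \<in> Obj C \<Longrightarrow> x \<in> Prp C (Prd C b c) \<Longrightarrow> Qnt C q b c x \<in> Prp C b"
  by (rule qnt_closed)

end

text \<open>A list of terms read as a single arrow between contexts, the semantic counterpart of a
  substitution.\<close>

definition tms_int ::
  "('o, 'm, 'p, 'c, 'q) propcat \<Rightarrow> ('s, 'f, 'r, 'o, 'm, 'p) struct \<Rightarrow> 's list \<Rightarrow> 'f tm list \<Rightarrow> 'm"
  where "tms_int C M \<Gamma> ts = list_tuple C (ctx_int C M \<Gamma>) (map (tm_int C M \<Gamma>) ts)"

lemma tm_int_Fun: "tm_int C M \<Gamma> (Fun f ts) = Cmp C (fun_int M f) (tms_int C M \<Gamma> ts)"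
  by (simp add: tms_int_def)

lemma fm_int_Rel: "fm_int C M \<Gamma> (Rel r ts) = Rdx C (tms_int C M \<Gamma> ts) (rel_int M r)"
  by (simp add: tms_int_def)

lemma tms_int_snoc:
  "tms_int C M \<Gamma> (ts @ [t]) = pair C (tms_int C M \<Gamma> ts) (tm_int C M \<Gamma> t)"
  by (simp add: tms_int_def)

text \<open>Restricted to well-formed assertions: \<open>satisfies\<close> is a total function and
  may hold by accident of ill-typed ones, which no theory over \<open>Sg\<close> contains.\<close>

definition theory_of ::
  "('c, 'q) language \<Rightarrow> ('s, 'f, 'r) signature \<Rightarrow> ('o, 'm, 'p, 'c, 'q) propcat \<Rightarrow>
   ('s, 'f, 'r, 'o, 'm, 'p) struct \<Rightarrow> ('s, 'f, 'r, 'c, 'q) assertion set" where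
  "theory_of L Sg C M = {a. wf_assertion L Sg a \<and> satisfies L C M a}"

locale FA_structure = FA_language L C
  for L :: "('c, 'q) language" and C :: "('o, 'm, 'p, 'c, 'q) propcat" +
  fixes Sg :: "('s, 'f, 'r) signature" and M :: "('s, 'f, 'r, 'o, 'm, 'p) struct"
  assumes sig: "is_signature Sg" and struct: "is_structure Sg C M"
begin

lemma sort_obj [simp]: "\<sigma> \<in> Sorts Sg \<Longrightarrow> sort_int M \<sigma> \<in> Obj C"
  using struct by (simp add: is_structure_def)

lemma sorts_obj: "set \<Gamma> \<subseteq> Sorts Sg \<Longrightarrow> set (map (sort_int M) \<Gamma>) \<subseteq> Obj C"
  by auto

lemma ctx_obj [simp]: "set \<Gamma> \<subseteq> Sorts Sg \<Longrightarrow> ctx_int C M \<Gamma> \<in> Obj C"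
  unfolding ctx_int_def using sorts_obj by (rule list_prd_obj)

lemma fun_arr [simp]:
  assumes "f \<in> Funs Sg"
  shows "fun_int M f \<in> Arr C" "Src C (fun_int M f) = ctx_int C M (fdom Sg f)"
    "Tgt C (fun_int M f) = sort_int M (fcod Sg f)"
  using struct assms by (auto simp: is_structure_def hom_iff)

lemma sig_sorts [simp]:
  "f \<in> Funs Sg \<Longrightarrow> set (fdom Sg f) \<subseteq> Sorts Sg"
  "f \<in> Funs Sg \<Longrightarrow> fcod Sg f \<in> Sorts Sg"
  "r \<in> Rels Sg \<Longrightarrow> set (rdom Sg r) \<subseteq> Sorts Sg"
  using sig by (auto simp: is_signature_def)

lemma rel_in [simp]: "r \<in> Rels Sg \<Longrightarrow> rel_int M r \<in> Prp C (ctx_int C M (rdom Sg r))"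
  using struct by (simp add: is_structure_def)

lemmas wt_tm_sort = wt_tm_in_Sorts[OF sig]

lemma tm_int_arr:
  assumes "wt_tm Sg \<Gamma> t \<sigma>" "set \<Gamma> \<subseteq> Sorts Sg"
  shows "tm_int C M \<Gamma> t \<in> Arr C \<and> Src C (tm_int C M \<Gamma> t) = ctx_int C M \<Gamma> \<and>
    Tgt C (tm_int C M \<Gamma> t) = sort_int M \<sigma>"
  using assms
proof (induction rule: wt_tm.induct)
  case (1 i)
  then show ?case
    using sorts_obj by (simp add: ctx_int_def)
next
  case (2 f ts)
  have "\<forall>g \<in> set (map (tm_int C M \<Gamma>) ts). g \<in> Arr C \<and> Src C g = ctx_int C M \<Gamma>"
    using 2 by (auto simp: list_all2_conv_all_nth in_set_conv_nth)
  moreover have "map (Tgt C) (map (tm_int C M \<Gamma>) ts) = map (sort_int M) (fdom Sg f)"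
    using 2 by (auto simp: list_all2_conv_all_nth intro!: nth_equalityI)
  ultimately show ?case
    using 2 list_tuple_arr[of "ctx_int C M \<Gamma>" "map (tm_int C M \<Gamma>) ts"]
    by (simp add: ctx_int_def[of C M "fdom Sg f"] del: list_tuple_arr)
qed

lemma tms_int_args:
  assumes "list_all2 (wt_tm Sg \<Gamma>) ts \<Delta>" "set \<Gamma> \<subseteq> Sorts Sg"
  shows "\<forall>g \<in> set (map (tm_int C M \<Gamma>) ts). g \<in> Arr C \<and> Src C g = ctx_int C M \<Gamma>"
    and "map (Tgt C) (map (tm_int C M \<Gamma>) ts) = map (sort_int M) \<Delta>"
proof -
  have *: "\<forall>i < length \<Delta>. tm_int C M \<Gamma> (ts ! i) \<in> Arr C \<and> Src C (tm_int C M \<Gamma> (ts ! i)) =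
    ctx_int C M \<Gamma> \<and>
    Tgt C (tm_int C M \<Gamma> (ts ! i)) = sort_int M (\<Delta> ! i)" "length ts = length \<Delta>"
    using assms tm_int_arr by (auto simp: list_all2_conv_all_nth)
  then show "\<forall>g \<in> set (map (tm_int C M \<Gamma>) ts). g \<in> Arr C \<and> Src C g = ctx_int C M \<Gamma>"
    by (auto simp: in_set_conv_nth)
  show "map (Tgt C) (map (tm_int C M \<Gamma>) ts) = map (sort_int M) \<Delta>"
    using * by (auto intro!: nth_equalityI)
qed

lemma tms_int_arr:
  assumes "list_all2 (wt_tm Sg \<Gamma>) ts \<Delta>" "set \<Gamma> \<subseteq> Sorts Sg"
  shows "tms_int C M \<Gamma> ts \<in> Arr C" "Src C (tms_int C M \<Gamma> ts) = ctx_int C M \<Gamma>"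
    "Tgt C (tms_int C M \<Gamma> ts) = ctx_int C M \<Delta>"
  using list_tuple_arr[OF _ tms_int_args(1)[OF assms]] assms(2) tms_int_args(2)[OF assms]
  by (simp_all add: tms_int_def ctx_int_def[of C M \<Delta>])

lemma proj_tms_int:
  assumes "list_all2 (wt_tm Sg \<Gamma>) ts \<Delta>" "set \<Gamma> \<subseteq> Sorts Sg" "i < length \<Delta>"
  shows "Cmp C (list_proj C (map (sort_int M) \<Delta>) i) (tms_int C M \<Gamma> ts) = tm_int C M \<Gamma> (ts ! i)"
proof -
  have "length ts = length \<Delta>"
    using assms(1) by (rule list_all2_lengthD)
  then show ?thesis
    unfolding tms_int_def using assms(2,3) tms_int_args(2)[OF assms(1,2)]
    by (subst list_proj_tuple[OF _ tms_int_args(1)[OF assms(1,2)]]) auto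
qed

lemma tms_int_eqI:
  assumes "list_all2 (wt_tm Sg \<Gamma>) ts \<Delta>" "set \<Gamma> \<subseteq> Sorts Sg" "set \<Delta> \<subseteq> Sorts Sg"
    and "h \<in> Arr C" "Src C h = ctx_int C M \<Gamma>" "Tgt C h = ctx_int C M \<Delta>"
    and "\<And>i. i < length \<Delta> \<Longrightarrow>
      Cmp C (list_proj C (map (sort_int M) \<Delta>) i) h = tm_int C M \<Gamma> (ts ! i)"
  shows "tms_int C M \<Gamma> ts = h"
  by (rule list_prd_ext[OF sorts_obj[OF assms(3)]])
    (use assms(4-) tms_int_arr[OF assms(1,2)] proj_tms_int[OF assms(1,2)] in
      \<open>simp_all add: ctx_int_def\<close>)

lemma tms_int_eq_iff:
  assumes "list_all2 (wt_tm Sg \<Gamma>) ts \<Delta>" "list_all2 (wt_tm Sg \<Gamma>) us \<Delta>" "set \<Gamma> \<subseteq> Sorts Sg"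
  shows "tms_int C M \<Gamma> ts = tms_int C M \<Gamma> us \<longleftrightarrow>
    (\<forall>i < length \<Delta>. tm_int C M \<Gamma> (ts ! i) = tm_int C M \<Gamma> (us ! i))"
proof
  assume "tms_int C M \<Gamma> ts = tms_int C M \<Gamma> us"
  then show "\<forall>i < length \<Delta>. tm_int C M \<Gamma> (ts ! i) = tm_int C M \<Gamma> (us ! i)"
    using proj_tms_int[OF assms(1,3)] proj_tms_int[OF assms(2,3)] by metis
next
  assume "\<forall>i < length \<Delta>. tm_int C M \<Gamma> (ts ! i) = tm_int C M \<Gamma> (us ! i)"
  moreover have "length ts = length \<Delta>" "length us = length \<Delta>"
    using assms(1,2) by (auto dest: list_all2_lengthD)
  ultimately have "map (tm_int C M \<Gamma>) ts = map (tm_int C M \<Gamma>) us"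
    by (auto intro: nth_equalityI)
  then show "tms_int C M \<Gamma> ts = tms_int C M \<Gamma> us"
    by (simp add: tms_int_def)
qed

text \<open>Substitution is composition: a variable meets the tuple through the projection law, and
  a function symbol by precomposing the tuple of its arguments.\<close>

lemma tm_int_subst:
  assumes "wt_tm Sg \<Gamma> t \<sigma>" "list_all2 (wt_tm Sg \<Delta>) ts \<Gamma>"
    and "set \<Gamma> \<subseteq> Sorts Sg" "set \<Delta> \<subseteq> Sorts Sg"
  shows "tm_int C M \<Delta> (tm_subst ts t) = Cmp C (tm_int C M \<Gamma> t) (tms_int C M \<Delta> ts)"
  using assms
proof (induction rule: wt_tm.induct)
  case (1 i)
  then show ?case by (simp add: proj_tms_int)
next
  case (2 f us)
  have us: "list_all2 (wt_tm Sg \<Gamma>) us (fdom Sg f)"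
    using "2.IH" by (auto elim: list_all2_mono)
  have eq: "map (\<lambda>u. tm_int C M \<Delta> (tm_subst ts u)) us =
    map (\<lambda>u. Cmp C (tm_int C M \<Gamma> u) (tms_int C M \<Delta> ts)) us"
    using "2.IH" "2.prems" by (auto simp: list_all2_conv_all_nth in_set_conv_nth)
  have "Cmp C (tms_int C M \<Gamma> us) (tms_int C M \<Delta> ts) = tms_int C M \<Delta> (map (tm_subst ts) us)"
    unfolding tms_int_def[of C M \<Gamma>] using "2.prems" tms_int_arr[OF "2.prems"(1)]
    by (subst list_tuple_cmp[OF _ tms_int_args(1)[OF us]])
      (simp_all add: o_def eq tms_int_def[of C M \<Delta> "map (tm_subst ts) us"])
  then show ?case
    using 2 tms_int_arr[OF us] tms_int_arr[OF "2.prems"(1)]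
    by (simp add: tm_int_Fun del: tm_int.simps(2))
qed

lemma tms_int_subst:
  assumes "list_all2 (wt_tm Sg \<Gamma>) us \<Theta>" "list_all2 (wt_tm Sg \<Delta>) ts \<Gamma>"
    and "set \<Gamma> \<subseteq> Sorts Sg" "set \<Delta> \<subseteq> Sorts Sg" "set \<Theta> \<subseteq> Sorts Sg"
  shows "tms_int C M \<Delta> (map (tm_subst ts) us) = Cmp C (tms_int C M \<Gamma> us) (tms_int C M \<Delta> ts)"
proof (rule tms_int_eqI[OF wt_tms_subst[OF assms(1,2)] assms(4,5)])
  fix i assume i: "i < length \<Theta>"
  then have i': "i < length us" "wt_tm Sg \<Gamma> (us ! i) (\<Theta> ! i)"
    using assms(1) by (auto simp: list_all2_conv_all_nth)
  \<comment> \<open>Bracketed to the left, against the default orientation, so that the projection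
    meets the tuple \<open>us\<close>.\<close>
  have "Cmp C (list_proj C (map (sort_int M) \<Theta>) i) (Cmp C (tms_int C M \<Gamma> us) (tms_int C M \<Delta> ts)) =
    Cmp C (Cmp C (list_proj C (map (sort_int M) \<Theta>) i) (tms_int C M \<Gamma> us)) (tms_int C M \<Delta> ts)"
    using i tms_int_arr[OF assms(1,3)] tms_int_arr[OF assms(2,4)] sorts_obj[OF assms(5)]
    by (subst cmp_assoc_simp) (simp_all add: ctx_int_def del: cmp_assoc_simp)
  then show "Cmp C (list_proj C (map (sort_int M) \<Theta>) i) (Cmp C (tms_int C M \<Gamma> us) (tms_int C M \<Delta>
    ts)) =
    tm_int C M \<Delta> (map (tm_subst ts) us ! i)"
    using i i' tm_int_subst[OF i'(2) assms(2-4)] proj_tms_int[OF assms(1,3)] by simp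
qed (use tms_int_arr[OF assms(1,3)] tms_int_arr[OF assms(2,4)] in simp_all)

lemma tms_int_vars: "set \<Gamma> \<subseteq> Sorts Sg \<Longrightarrow> tms_int C M \<Gamma> (vars \<Gamma>) = Idn C (ctx_int C M \<Gamma>)"
  by (rule tms_int_eqI[OF wt_vars_same])
    (use sorts_obj[of \<Gamma>] in \<open>simp_all add: vars_def ctx_int_def\<close>)

text \<open>Makes context weakening the instance of substitution whose arrow is a
  projection.\<close>

lemma tms_int_vars_snoc:
  assumes "set \<Gamma> \<subseteq> Sorts Sg" "\<tau> \<in> Sorts Sg"
  shows "tms_int C M (\<Gamma> @ [\<tau>]) (vars \<Gamma>) = Pr1 C (ctx_int C M \<Gamma>) (sort_int M \<tau>)"
  by (rule tms_int_eqI[OF wt_vars])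
    (use assms in \<open>simp_all add: vars_def list_proj_snoc flip: ctx_int_def\<close>)

lemma tm_int_weaken:
  assumes "wt_tm Sg \<Gamma> t \<sigma>" "set \<Gamma> \<subseteq> Sorts Sg" "\<tau> \<in> Sorts Sg"
  shows "tm_int C M (\<Gamma> @ [\<tau>]) t = Cmp C (tm_int C M \<Gamma> t) (Pr1 C (ctx_int C M \<Gamma>) (sort_int M \<tau>))"
  using tm_int_subst[OF assms(1) wt_vars, of "[\<tau>]"] assms
  by (simp add: tms_int_vars_snoc tm_subst_vars[OF assms(1)])

lemma tms_int_weaken:
  assumes "list_all2 (wt_tm Sg \<Delta>) ts \<Gamma>" "set \<Gamma> \<subseteq> Sorts Sg" "set \<Delta> \<subseteq> Sorts Sg" "\<sigma> \<in> Sorts Sg"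
  shows "tms_int C M (\<Delta> @ [\<sigma>]) ts = Cmp C (tms_int C M \<Delta> ts) (Pr1 C (ctx_int C M \<Delta>) (sort_int M \<sigma>))"
proof -
  have "tms_int C M (\<Delta> @ [\<sigma>]) ts =
    tms_int C M (\<Delta> @ [\<sigma>]) (map (tm_subst (vars \<Delta>)) ts)"
    by (simp add: tms_subst_vars[OF assms(1)])
  also have "\<dots> = Cmp C (tms_int C M \<Delta> ts) (Pr1 C (ctx_int C M \<Delta>) (sort_int M \<sigma>))"
    using tms_int_subst[OF assms(1) wt_vars, of "[\<sigma>]"] assms by (simp add: tms_int_vars_snoc)
  finally show ?thesis .
qed

text \<open>Substitution under a binder becomes the arrow of the naturality axiom
  \<open>qnt_natural\<close>.\<close>

lemma tms_int_lift:
  assumes "list_all2 (wt_tm Sg \<Delta>) ts \<Gamma>" "set \<Gamma> \<subseteq> Sorts Sg" "set \<Delta> \<subseteq> Sorts Sg" "\<sigma> \<in> Sorts Sg"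
  shows "tms_int C M (\<Delta> @ [\<sigma>]) (ts @ [Var (length \<Delta>)]) =
    map_left C (tms_int C M \<Delta> ts) (sort_int M \<sigma>)"
  using assms tms_int_arr[OF assms(1,3)]
  by (simp add: tms_int_snoc tms_int_weaken map_left_def list_proj_snoc flip: ctx_int_def)

lemma fm_int_closed:
  assumes "wf_fm L Sg \<Gamma> \<phi>" "set \<Gamma> \<subseteq> Sorts Sg"
  shows "fm_int C M \<Gamma> \<phi> \<in> Prp C (ctx_int C M \<Gamma>)"
  using assms
proof (induction rule: wf_fm.induct)
  case (1 r \<Gamma> ts)
  then show ?case
    using tms_int_arr[OF 1(2,3)] by (simp add: fm_int_Rel del: fm_int.simps(1))
next
  case (2 \<sigma> \<Gamma> t u)
  then show ?case
    using tm_int_arr[OF 2(2,4)] tm_int_arr[OF 2(3,4)] eql_closed by simp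
next
  case (3 k \<phi>s \<Gamma>)
  then show ?case by (auto intro!: opr_closed)
qed simp

text \<open>Substitution is reindexing. Atoms use functoriality of \<open>Rdx\<close>, connectives
  that \<open>Rdx\<close> is a homomorphism, and quantifiers their naturality together with
  \<open>tms_int_lift\<close>.\<close>

lemma fm_int_subst:
  assumes "wf_fm L Sg \<Gamma> \<phi>" "list_all2 (wt_tm Sg \<Delta>) ts \<Gamma>"
    and "set \<Gamma> \<subseteq> Sorts Sg" "set \<Delta> \<subseteq> Sorts Sg"
  shows "fm_int C M \<Delta> (fm_subst (length \<Delta>) ts \<phi>) = Rdx C (tms_int C M \<Delta> ts) (fm_int C M \<Gamma> \<phi>)"
  using assms
proof (induction arbitrary: \<Delta> ts rule: wf_fm.induct)
  case (1 r \<Gamma> us)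
  then show ?case
    using tms_int_arr[OF 1(3,5)] tms_int_arr[OF 1(2,4)]
    by (simp add: fm_int_Rel tms_int_subst rdx_rdx del: fm_int.simps(1))
next
  case (2 \<sigma> \<Gamma> t u)
  then show ?case
    using tms_int_arr[OF 2(4,6)] tm_int_arr[OF 2(2,5)] tm_int_arr[OF 2(3,5)] eql_closed
    by (simp add: tm_int_subst rdx_rdx)
next
  case (3 k \<phi>s \<Gamma>)
  have "Rdx C (tms_int C M \<Delta> ts) (Opr C (ctx_int C M \<Gamma>) k (map (fm_int C M \<Gamma>) \<phi>s)) =
    Opr C (ctx_int C M \<Delta>) k (map (Rdx C (tms_int C M \<Delta> ts)) (map (fm_int C M \<Gamma>) \<phi>s))"
    using 3 tms_int_arr[OF 3(4,6)] by (intro rdx_opr) (auto simp: hom_iff intro: fm_int_closed)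
  moreover have "map (\<lambda>\<phi>. fm_int C M \<Delta> (fm_subst (length \<Delta>) ts \<phi>)) \<phi>s =
    map (\<lambda>\<phi>. Rdx C (tms_int C M \<Delta> ts) (fm_int C M \<Gamma> \<phi>)) \<phi>s"
    using 3 by auto
  ultimately show ?case by (simp add: o_def del: map_eq_conv)
next
  case (4 q \<sigma> \<Gamma> \<phi>)
  have "fm_int C M (\<Delta> @ [\<sigma>]) (fm_subst (Suc (length \<Delta>)) (ts @ [Var (length \<Delta>)]) \<phi>) =
    Rdx C (map_left C (tms_int C M \<Delta> ts) (sort_int M \<sigma>)) (fm_int C M (\<Gamma> @ [\<sigma>]) \<phi>)"
    using "4.IH"[OF wt_lift[OF 4(5)]] 4 by (simp add: tms_int_lift)
  moreover have "Rdx C (tms_int C M \<Delta> ts)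
      (Qnt C q (ctx_int C M \<Gamma>) (sort_int M \<sigma>) (fm_int C M (\<Gamma> @ [\<sigma>]) \<phi>)) =
    Qnt C q (ctx_int C M \<Delta>) (sort_int M \<sigma>)
      (Rdx C (map_left C (tms_int C M \<Delta> ts) (sort_int M \<sigma>)) (fm_int C M (\<Gamma> @ [\<sigma>]) \<phi>))"
    using 4 tms_int_arr[OF 4(5,7)] fm_int_closed[OF 4(3)]
    by (intro qnt_natural) (auto simp: hom_iff)
  ultimately show ?case by simp
qed

end


section \<open>Soundness\<close>

context FA_structure
begin

lemma fms_int_closed:
  "\<forall>\<psi> \<in> set \<Phi>. wf_fm L Sg \<Gamma> \<psi> \<Longrightarrow> set \<Gamma> \<subseteq> Sorts Sg \<Longrightarrow>
    set (map (fm_int C M \<Gamma>) \<Phi>) \<subseteq> Prp C (ctx_int C M \<Gamma>)"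
  by (auto intro: fm_int_closed)

lemma theory_of_Eqn:
  "Eqn \<Gamma> \<sigma> t u \<in> theory_of L Sg C M \<longleftrightarrow>
    set \<Gamma> \<subseteq> Sorts Sg \<and> wt_tm Sg \<Gamma> t \<sigma> \<and> wt_tm Sg \<Gamma> u \<sigma> \<and> tm_int C M \<Gamma> t = tm_int C M \<Gamma> u"
  by (auto simp: theory_of_def)

lemma theory_of_Seq:
  "Seq \<Gamma> \<Phi> \<phi> \<in> theory_of L Sg C M \<longleftrightarrow>
    set \<Gamma> \<subseteq> Sorts Sg \<and> (\<forall>\<psi> \<in> set \<Phi>. wf_fm L Sg \<Gamma> \<psi>) \<and> wf_fm L Sg \<Gamma> \<phi> \<and>
    Leq C (ctx_int C M \<Gamma>) (list_tensor L C (ctx_int C M \<Gamma>) (map (fm_int C M \<Gamma>) \<Phi>))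
      (fm_int C M \<Gamma> \<phi>)"
  by (auto simp: theory_of_def)

text \<open>A one-element antecedent is interpreted as that element tensored with the unit, which
  the right unit law removes.\<close>

lemma theory_of_Seq1:
  "Seq \<Gamma> [\<psi>] \<phi> \<in> theory_of L Sg C M \<longleftrightarrow>
    set \<Gamma> \<subseteq> Sorts Sg \<and> wf_fm L Sg \<Gamma> \<psi> \<and> wf_fm L Sg \<Gamma> \<phi> \<and>
    Leq C (ctx_int C M \<Gamma>) (fm_int C M \<Gamma> \<psi>) (fm_int C M \<Gamma> \<phi>)"
  by (auto simp: theory_of_Seq fm_int_closed)

lemma tms_eqs_theory_of:
  assumes "length ts = length \<Gamma>" "length us = length \<Gamma>"
    "\<forall>i < length \<Gamma>. Eqn \<Delta> (\<Gamma> ! i) (ts ! i) (us ! i) \<in> theory_of L Sg C M" "set \<Delta> \<subseteq> Sorts Sg"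
  shows "list_all2 (wt_tm Sg \<Delta>) ts \<Gamma>" "list_all2 (wt_tm Sg \<Delta>) us \<Gamma>"
    "tms_int C M \<Delta> ts = tms_int C M \<Delta> us"
proof -
  show wt: "list_all2 (wt_tm Sg \<Delta>) ts \<Gamma>" "list_all2 (wt_tm Sg \<Delta>) us \<Gamma>"
    using assms by (auto simp: list_all2_conv_all_nth theory_of_Eqn)
  show "tms_int C M \<Delta> ts = tms_int C M \<Delta> us"
    using assms by (subst tms_int_eq_iff[OF wt]) (auto simp: theory_of_Eqn)
qed

text \<open>By associativity both antecedents denote the same element, so one equivalence covers the
  rule and its converse. Ill-formed instances lie on neither side.\<close>

lemma theory_of_tensor:
  "Seq \<Gamma> (\<Phi> @ [tensor_fm L \<alpha> \<beta>] @ \<Psi>) \<theta> \<in> theory_of L Sg C M \<longleftrightarrow>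
    Seq \<Gamma> (\<Phi> @ [\<alpha>, \<beta>] @ \<Psi>) \<theta> \<in> theory_of L Sg C M"
proof (cases "set \<Gamma> \<subseteq> Sorts Sg \<and> (\<forall>\<psi> \<in> set (\<Phi> @ [\<alpha>, \<beta>] @ \<Psi>). wf_fm L Sg \<Gamma> \<psi>)")
  case True
  then have *: "set \<Gamma> \<subseteq> Sorts Sg" "\<forall>\<psi> \<in> set \<Phi>. wf_fm L Sg \<Gamma> \<psi>" "wf_fm L Sg \<Gamma> \<alpha>"
    "wf_fm L Sg \<Gamma> \<beta>" "\<forall>\<psi> \<in> set \<Psi>. wf_fm L Sg \<Gamma> \<psi>"
    by auto
  then show ?thesis
    using fms_int_closed[OF *(2,1)] fms_int_closed[OF *(5,1)] fm_int_closed[OF *(3,1)]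
      fm_int_closed[OF *(4,1)]
    by (simp add: theory_of_Seq list_tensor_append tensor_assoc del: set_map)
qed (auto simp: theory_of_Seq)

lemma theory_of_unit:
  "Seq \<Gamma> (\<Phi> @ [unit_fm L] @ \<Psi>) \<theta> \<in> theory_of L Sg C M \<longleftrightarrow>
    Seq \<Gamma> (\<Phi> @ \<Psi>) \<theta> \<in> theory_of L Sg C M"
proof (cases "set \<Gamma> \<subseteq> Sorts Sg \<and> (\<forall>\<psi> \<in> set (\<Phi> @ \<Psi>). wf_fm L Sg \<Gamma> \<psi>)")
  case True
  then have *: "set \<Gamma> \<subseteq> Sorts Sg" "\<forall>\<psi> \<in> set \<Phi>. wf_fm L Sg \<Gamma> \<psi>" "\<forall>\<psi> \<in> set \<Psi>. wf_fm L Sg \<Gamma> \<psi>"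
    by auto
  then show ?thesis
    using fms_int_closed[OF *(2,1)] fms_int_closed[OF *(3,1)]
    by (simp add: theory_of_Seq list_tensor_append del: set_map)
qed (auto simp: theory_of_Seq)

text \<open>The two lists of terms may differ as long as they denote the same arrow; reindexing
  along it is monotone and preserves the tensor of the antecedent. Both the weakening and the
  substitution rule are instances.\<close>

lemma theory_of_subst:
  assumes "Seq \<Gamma> \<Phi> \<phi> \<in> theory_of L Sg C M" "set \<Delta> \<subseteq> Sorts Sg"
    "list_all2 (wt_tm Sg \<Delta>) ts \<Gamma>" "list_all2 (wt_tm Sg \<Delta>) us \<Gamma>"
    "tms_int C M \<Delta> ts = tms_int C M \<Delta> us"
  shows "Seq \<Delta> (map (fm_subst (length \<Delta>) ts) \<Phi>) (fm_subst (length \<Delta>) us \<phi>) \<in> theory_of L Sg C M"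
proof -
  let ?f = "tms_int C M \<Delta> us"
  have wf: "set \<Gamma> \<subseteq> Sorts Sg" "\<forall>\<psi> \<in> set \<Phi>. wf_fm L Sg \<Gamma> \<psi>" "wf_fm L Sg \<Gamma> \<phi>"
    and leq: "Leq C (ctx_int C M \<Gamma>) (list_tensor L C (ctx_int C M \<Gamma>) (map (fm_int C M \<Gamma>) \<Phi>))
      (fm_int C M \<Gamma> \<phi>)"
    using assms(1) by (auto simp: theory_of_Seq)
  note f = tms_int_arr[OF assms(4,2)]
  note closed = fms_int_closed[OF wf(2,1)] fm_int_closed[OF wf(3,1)]
  have "Leq C (ctx_int C M \<Delta>)
      (Rdx C ?f (list_tensor L C (ctx_int C M \<Gamma>) (map (fm_int C M \<Gamma>) \<Phi>)))
      (Rdx C ?f (fm_int C M \<Gamma> \<phi>))"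
    by (rule rdx_mono[OF _ _ _ leq]) (use f closed wf in \<open>simp_all add: hom_iff del: set_map\<close>)
  moreover have "Rdx C ?f (list_tensor L C (ctx_int C M \<Gamma>) (map (fm_int C M \<Gamma>) \<Phi>)) =
    list_tensor L C (ctx_int C M \<Delta>) (map (Rdx C ?f) (map (fm_int C M \<Gamma>) \<Phi>))"
    using rdx_list_tensor[OF f(1)] f closed by (simp del: set_map map_map)
  moreover have "map (Rdx C ?f) (map (fm_int C M \<Gamma>) \<Phi>) =
    map (fm_int C M \<Delta>) (map (fm_subst (length \<Delta>) ts) \<Phi>)"
    using wf assms(5) by (auto simp: fm_int_subst[OF _ assms(3) wf(1) assms(2)])
  ultimately have "Leq C (ctx_int C M \<Delta>)
      (list_tensor L C (ctx_int C M \<Delta>) (map (fm_int C M \<Delta>) (map (fm_subst (length \<Delta>) ts) \<Phi>)))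
      (fm_int C M \<Delta> (fm_subst (length \<Delta>) us \<phi>))"
    by (simp only: fm_int_subst[OF wf(3) assms(4) wf(1) assms(2)])
  then show ?thesis
    unfolding theory_of_Seq using wf wf_fm_subst[OF _ assms(3)] wf_fm_subst[OF _ assms(4)] assms(2)
    by auto
qed

text \<open>The induction runs over derivations from the theory of \<open>M\<close> itself, so the
  hypotheses supply the truth of the premises together with their well-formedness.\<close>

lemma Lm_sound: "a \<in> Lm L Sg (theory_of L Sg C M) \<Longrightarrow> a \<in> theory_of L Sg C M"
proof (induction rule: Lm.induct)
  case (eqn_weaken \<Gamma> \<sigma> t u \<tau>)
  then show ?case
    by (auto simp: theory_of_Eqn wt_tm_append tm_int_weaken)
next
  case (eqn_subst \<Gamma> \<sigma> t u \<Delta> ts us)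
  then have *: "list_all2 (wt_tm Sg \<Delta>) ts \<Gamma>" "list_all2 (wt_tm Sg \<Delta>) us \<Gamma>"
    "tms_int C M \<Delta> ts = tms_int C M \<Delta> us"
    using tms_eqs_theory_of[of ts \<Gamma> us \<Delta>] by auto
  have "set \<Delta> \<subseteq> Sorts Sg"
    using eqn_subst.hyps(2) by auto
  then show ?case
    using eqn_subst.IH(1) *(3)
    by (auto simp: theory_of_Eqn tm_int_subst[OF _ *(1)] tm_int_subst[OF _ *(2)]
      intro: wt_tm_subst[OF _ *(1)] wt_tm_subst[OF _ *(2)])
next
  case (cut \<Gamma> \<Phi> \<phi> \<Psi> \<Psi>' \<theta>)
  let ?c = "ctx_int C M \<Gamma>"
  let ?t = "\<lambda>\<Phi>. list_tensor L C ?c (map (fm_int C M \<Gamma>) \<Phi>)"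
  have wf: "set \<Gamma> \<subseteq> Sorts Sg" "\<forall>\<psi> \<in> set \<Phi>. wf_fm L Sg \<Gamma> \<psi>" "wf_fm L Sg \<Gamma> \<phi>"
    "\<forall>\<psi> \<in> set \<Psi>. wf_fm L Sg \<Gamma> \<psi>" "\<forall>\<psi> \<in> set \<Psi>'. wf_fm L Sg \<Gamma> \<psi>" "wf_fm L Sg \<Gamma> \<theta>"
    using cut.IH by (auto simp: theory_of_Seq)
  note closed [simp] = fms_int_closed[OF wf(2,1)] fms_int_closed[OF wf(4,1)]
    fms_int_closed[OF wf(5,1)] fm_int_closed[OF wf(3,1)] fm_int_closed[OF wf(6,1)]
    ctx_obj[OF wf(1)]
  have tc [simp]: "?t \<Phi> \<in> Prp C ?c" "?t \<Psi> \<in> Prp C ?c" "?t \<Psi>' \<in> Prp C ?c"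
    by (intro list_tensor_closed closed)+
  \<comment> \<open>Monotonicity of the tensor allows \<open>\<Phi>\<close> to be replaced by
    \<open>\<phi>\<close> inside the longer antecedent.\<close>
  have "Leq C ?c (tensor_op L C ?c (?t \<Psi>) (tensor_op L C ?c (?t \<Phi>) (?t \<Psi>')))
    (tensor_op L C ?c (?t \<Psi>) (tensor_op L C ?c (fm_int C M \<Gamma> \<phi>) (?t \<Psi>')))"
    using cut.IH(1) by (intro tensor_mono) (auto simp: theory_of_Seq)
  moreover have "Leq C ?c (tensor_op L C ?c (?t \<Psi>) (tensor_op L C ?c (fm_int C M \<Gamma> \<phi>) (?t \<Psi>')))
    (fm_int C M \<Gamma> \<theta>)"
    using cut.IH(2) list_tensor_append[OF closed(6,2), of "fm_int C M \<Gamma> \<phi> # map (fm_int C M \<Gamma>) \<Psi>'"]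
      closed(3)
    by (simp add: theory_of_Seq del: set_map)
  ultimately have "Leq C ?c (tensor_op L C ?c (?t \<Psi>) (tensor_op L C ?c (?t \<Phi>) (?t \<Psi>')))
    (fm_int C M \<Gamma> \<theta>)"
    by (rule leq_trans[rotated -2]) simp_all
  then show ?case
    using wf closed(1-3) by (auto simp: theory_of_Seq list_tensor_append simp del: set_map)
next
  case (seq_weaken \<Gamma> \<Phi> \<phi> \<tau>)
  then have "set (\<Gamma> @ [\<tau>]) \<subseteq> Sorts Sg"
    by (auto simp: theory_of_Seq)
  from theory_of_subst[OF seq_weaken.IH this wt_vars wt_vars] show ?case by simp
next
  case (seq_subst \<Gamma> \<Phi> \<phi> \<Delta> ts us)
  then have "set \<Delta> \<subseteq> Sorts Sg" by auto
  moreover from this have "list_all2 (wt_tm Sg \<Delta>) ts \<Gamma>" "list_all2 (wt_tm Sg \<Delta>) us \<Gamma>"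
    "tms_int C M \<Delta> ts = tms_int C M \<Delta> us"
    using tms_eqs_theory_of[of ts \<Gamma> us \<Delta>] seq_subst by auto
  ultimately show ?case
    by (rule theory_of_subst[OF seq_subst.IH(1)])
next
  case (conn_cong \<Gamma> k \<phi>s \<psi>s)
  then have wf: "\<forall>\<phi> \<in> set \<phi>s. wf_fm L Sg \<Gamma> \<phi>" "\<forall>\<phi> \<in> set \<psi>s. wf_fm L Sg \<Gamma> \<phi>" "set \<Gamma> \<subseteq> Sorts Sg"
    by (auto simp: theory_of_Seq1 in_set_conv_nth)
  \<comment> \<open>Antisymmetry turns mutual derivability into equality of interpretations, so
    congruence holds for connectives of any variance.\<close>
  have "map (fm_int C M \<Gamma>) \<phi>s = map (fm_int C M \<Gamma>) \<psi>s"
  proof (rule nth_equalityI)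
    fix i assume "i < length (map (fm_int C M \<Gamma>) \<phi>s)"
    then have "Seq \<Gamma> [\<phi>s ! i] (\<psi>s ! i) \<in> theory_of L Sg C M"
      "Seq \<Gamma> [\<psi>s ! i] (\<phi>s ! i) \<in> theory_of L Sg C M"
      using conn_cong by auto
    then have "fm_int C M \<Gamma> (\<phi>s ! i) = fm_int C M \<Gamma> (\<psi>s ! i)"
      by (intro leq_antisym[of "ctx_int C M \<Gamma>"]) (auto simp: theory_of_Seq1 fm_int_closed)
    then show "map (fm_int C M \<Gamma>) \<phi>s ! i = map (fm_int C M \<Gamma>) \<psi>s ! i"
      using \<open>i < _\<close> conn_cong by simp
  qed (use conn_cong in simp)
  moreover have "wf_fm L Sg \<Gamma> (Conn k \<phi>s)" "wf_fm L Sg \<Gamma> (Conn k \<psi>s)"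
    using conn_cong wf by auto
  ultimately show ?case
    using wf fm_int_closed[of \<Gamma> "Conn k \<psi>s"] by (simp add: theory_of_Seq1 del: wf_fm_simps)
next
  case (quant_cong q \<Gamma> \<sigma> \<phi> \<psi>)
  then have wf: "set \<Gamma> \<subseteq> Sorts Sg" "\<sigma> \<in> Sorts Sg" "wf_fm L Sg (\<Gamma> @ [\<sigma>]) \<phi>" "wf_fm L Sg (\<Gamma> @ [\<sigma>]) \<psi>"
    by (auto simp: theory_of_Seq1)
  have "fm_int C M (\<Gamma> @ [\<sigma>]) \<phi> = fm_int C M (\<Gamma> @ [\<sigma>]) \<psi>"
    using quant_cong fm_int_closed[OF wf(3)] fm_int_closed[OF wf(4)] wf
    by (intro leq_antisym[of "ctx_int C M (\<Gamma> @ [\<sigma>])"]) (auto simp: theory_of_Seq1)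
  then show ?case
    using quant_cong wf fm_int_closed[OF wf(4)] by (auto simp: theory_of_Seq1)
next
  case (tensor_join \<Gamma> \<Phi> \<alpha> \<beta> \<Psi> \<theta>)
  show ?case by (rule theory_of_tensor[THEN iffD2, OF tensor_join.IH])
next
  case (tensor_split \<Gamma> \<Phi> \<alpha> \<beta> \<Psi> \<theta>)
  show ?case by (rule theory_of_tensor[THEN iffD1, OF tensor_split.IH])
next
  case (unit_add \<Gamma> \<Phi> \<Psi> \<phi>)
  show ?case by (rule theory_of_unit[THEN iffD2, OF unit_add.IH])
next
  case (unit_drop \<Gamma> \<Phi> \<Psi> \<phi>)
  show ?case by (rule theory_of_unit[THEN iffD1, OF unit_drop.IH])
next
  case (ax \<Gamma> \<phi>)
  then have "set \<Gamma> \<subseteq> Sorts Sg" by auto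
  then show ?case
    using ax(2) by (simp add: theory_of_Seq1 fm_int_closed)
qed (auto simp: theory_of_Eqn)

theorem Lm_theory_theory_of: "Lm_theory L Sg (theory_of L Sg C M)"
proof -
  have "Lm L Sg (theory_of L Sg C M) = theory_of L Sg C M"
    by (rule set_eqI iffI)+ (erule Lm_sound Lm.axiom)+
  then show ?thesis
    by (simp add: Lm_theory_def is_theory_def theory_of_def)
qed

end


section \<open>The classifying prop-category\<close>

lemma tm_subst_append:
  "wt_tm Sg \<Gamma> t \<sigma> \<Longrightarrow> length ts = length \<Gamma> \<Longrightarrow> tm_subst (ts @ us) t = tm_subst ts t"
proof (induction rule: wt_tm.induct)
  case (2 f vs)
  then show ?case
    by (auto simp: list_all2_conv_all_nth in_set_conv_nth)
qed (simp add: nth_append)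

lemma tm_subst_subst:
  "wt_tm Sg \<Gamma> t \<sigma> \<Longrightarrow> length us = length \<Gamma> \<Longrightarrow>
    tm_subst ts (tm_subst us t) = tm_subst (map (tm_subst ts) us) t"
proof (induction rule: wt_tm.induct)
  case (2 f vs)
  then show ?case
    by (auto simp: list_all2_conv_all_nth in_set_conv_nth)
qed simp

lemma tms_subst_subst:
  assumes "list_all2 (wt_tm Sg \<Gamma>) vs \<Theta>" "length us = length \<Gamma>"
  shows "map (tm_subst ts) (map (tm_subst us) vs) = map (tm_subst (map (tm_subst ts) us)) vs"
  using assms by (induction rule: list_all2_induct) (simp_all add: tm_subst_subst)

lemma tms_subst_append:
  assumes "list_all2 (wt_tm Sg \<Gamma>) vs \<Theta>" "length ts = length \<Gamma>"
  shows "map (tm_subst (ts @ us)) vs = map (tm_subst ts) vs"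
  using assms by (induction rule: list_all2_induct) (simp_all add: tm_subst_append)

lemma vars_snoc: "vars (\<Gamma> @ [\<sigma>]) = vars \<Gamma> @ [Var (length \<Gamma>)]"
  by (simp add: vars_def)

lemma fm_subst_vars: "wf_fm L Sg \<Gamma> \<phi> \<Longrightarrow> fm_subst (length \<Gamma>) (vars \<Gamma>) \<phi> = \<phi>"
proof (induction rule: wf_fm.induct)
  case (4 q \<sigma> \<Gamma> \<phi>)
  then show ?case by (simp add: vars_snoc)
qed (auto simp: tms_subst_vars tm_subst_vars intro!: map_idI)

text \<open>Under a binder both substitutions gain an entry. The one added to \<open>ts\<close> does
  not affect the terms in \<open>us\<close>, which only mention variables of
  \<open>\<Delta>\<close>.\<close>

lemma fm_subst_subst:
  assumes "wf_fm L Sg \<Theta> \<phi>" "list_all2 (wt_tm Sg \<Delta>) us \<Theta>" "length ts = length \<Delta>"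
  shows "fm_subst n ts (fm_subst (length \<Delta>) us \<phi>) = fm_subst n (map (tm_subst ts) us) \<phi>"
  using assms
proof (induction arbitrary: n \<Delta> us ts rule: wf_fm.induct)
  case (1 r \<Gamma> vs)
  then show ?case
    by (simp only: fm_subst.simps tms_subst_subst[OF 1(2) list_all2_lengthD[OF 1(3)]])
next
  case (2 \<sigma> \<Gamma> t u)
  then show ?case
    by (auto simp: tm_subst_subst dest: list_all2_lengthD)
next
  case (4 q \<sigma> \<Gamma> \<phi>)
  have "fm_subst (Suc n) (ts @ [Var n]) (fm_subst (length (\<Delta> @ [\<sigma>])) (us @ [Var (length \<Delta>)]) \<phi>) =
    fm_subst (Suc n) (map (tm_subst (ts @ [Var n])) (us @ [Var (length \<Delta>)])) \<phi>"
    by (rule "4.IH"[OF wt_lift]) (use 4 in simp_all)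
  then show ?case
    using 4 tms_subst_append[of Sg \<Delta> us \<Gamma> ts "[Var n]"] by (simp add: nth_append)
qed auto

lemma fm_subst_tensor_fms:
  "fm_subst n ts (tensor_fms L \<phi>s) = tensor_fms L (map (fm_subst n ts) \<phi>s)"
  by (induction L \<phi>s rule: tensor_fms.induct) simp_all

text \<open>Each binder of the block contributes one fresh variable, with levels counted upwards
  from \<open>n\<close>.\<close>

lemma fm_subst_foldr_Quant:
  "fm_subst n ts (foldr (Quant q) \<Delta> \<phi>) =
    foldr (Quant q) \<Delta> (fm_subst (n + length \<Delta>) (ts @ map Var [n..<n + length \<Delta>]) \<phi>)"
  by (induction \<Delta> arbitrary: n ts) (simp_all add: upt_conv_Cons del: upt_Suc)

lemma wf_foldr_Quant:
  "wf_fm L Sg (\<Gamma> @ \<Delta>) \<phi> \<Longrightarrow> set \<Delta> \<subseteq> Sorts Sg \<Longrightarrow> q \<in> Quants L \<Longrightarrow> wf_fm L Sg \<Gamma> (foldr (Quant q) \<Delta> \<phi>)"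
proof (induction \<Delta> arbitrary: \<Gamma>)
  case (Cons \<sigma> \<Delta>)
  then show ?case
    using Cons.IH[of "\<Gamma> @ [\<sigma>]"] by simp
qed simp

text \<open>The tensor factors of equality at a context, over the doubled context: position i of the
  first copy is matched with position i of the second.\<close>

definition var_eqs :: "'s list \<Rightarrow> ('s, 'f, 'r, 'c, 'q) fm list" where
  "var_eqs \<Gamma> = map (\<lambda>i. Equ (\<Gamma> ! i) (Var i) (Var (length \<Gamma> + i))) [0..<length \<Gamma>]"

locale classified_theory =
  fixes L :: "('c, 'q) language" and Sg :: "('s, 'f, 'r) signature"
    and T :: "('s, 'f, 'r, 'c, 'q) assertion set"
  assumes lang: "is_language L" and sig: "is_signature Sg" and Lm_theory: "Lm_theory L Sg T"
begin

abbreviation "K \<equiv> classifying L Sg T"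

lemma Lm_closed: "Lm L Sg T = T"
  using Lm_theory by (simp add: Lm_theory_def)

lemma conns [simp]:
  "unit_conn L \<in> Conns L" "arity L (unit_conn L) = 0"
  "tensor_conn L \<in> Conns L" "arity L (tensor_conn L) = 2"
  using lang by (auto simp: is_language_def)

lemma wf_in_theory: "a \<in> T \<Longrightarrow> wf_assertion L Sg a"
  using Lm_theory by (auto simp: Lm_theory_def is_theory_def)

lemma wf_Eqn: "Eqn \<Gamma> \<sigma> t u \<in> T \<Longrightarrow> set \<Gamma> \<subseteq> Sorts Sg \<and> wt_tm Sg \<Gamma> t \<sigma> \<and> wt_tm Sg \<Gamma> u \<sigma>"
  by (drule wf_in_theory) auto

lemma wf_Seq:
  "Seq \<Gamma> \<Phi> \<phi> \<in> T \<Longrightarrow> set \<Gamma> \<subseteq> Sorts Sg \<and> (\<forall>\<psi> \<in> set \<Phi>. wf_fm L Sg \<Gamma> \<psi>) \<and> wf_fm L Sg \<Gamma> \<phi>"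
  by (drule wf_in_theory) auto

text \<open>As \<open>T\<close> is its own closure, the introduction rules of \<open>Lm\<close>
  become closure rules of \<open>T\<close>.\<close>

lemmas rules = Lm.intros[where L=L and Sg=Sg and T=T, unfolded Lm_closed]

lemmas eqn_refl = rules(2) and eqn_sym = rules(3) and eqn_trans = rules(4)
  and eqn_subst = rules(6) and ax = rules(7) and cut = rules(8) and seq_subst = rules(10)
  and conn_cong = rules(11) and quant_cong = rules(12) and tensor_join = rules(13)
  and tensor_split = rules(14) and unit_add = rules(15) and unit_drop = rules(16)

text \<open>Lengths and the source context are built in, so that symmetry and transitivity hold
  without side conditions.\<close>

definition teq :: "'s list \<Rightarrow> 's list \<Rightarrow> 'f tm list \<Rightarrow> 'f tm list \<Rightarrow> bool" where
  "teq \<Gamma> \<Delta> ts us \<longleftrightarrow> length ts = length \<Delta> \<and> length us = length \<Delta> \<and> set \<Gamma> \<subseteq> Sorts Sg \<and>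
    (\<forall>i < length \<Delta>. Eqn \<Gamma> (\<Delta> ! i) (ts ! i) (us ! i) \<in> T)"

definition feq :: "'s list \<Rightarrow> ('s, 'f, 'r, 'c, 'q) fm \<Rightarrow> ('s, 'f, 'r, 'c, 'q) fm \<Rightarrow> bool" where
  "feq \<Gamma> \<phi> \<psi> \<longleftrightarrow> Seq \<Gamma> [\<phi>] \<psi> \<in> T \<and> Seq \<Gamma> [\<psi>] \<phi> \<in> T"

definition wt :: "'s list \<Rightarrow> 's list \<Rightarrow> 'f tm list \<Rightarrow> bool" where
  "wt \<Gamma> \<Delta> ts \<longleftrightarrow> set \<Gamma> \<subseteq> Sorts Sg \<and> set \<Delta> \<subseteq> Sorts Sg \<and> list_all2 (wt_tm Sg \<Gamma>) ts \<Delta>"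

definition wf :: "'s list \<Rightarrow> ('s, 'f, 'r, 'c, 'q) fm \<Rightarrow> bool" where
  "wf \<Gamma> \<phi> \<longleftrightarrow> set \<Gamma> \<subseteq> Sorts Sg \<and> wf_fm L Sg \<Gamma> \<phi>"

abbreviation "arr \<equiv> tms_arr T"
abbreviation "cls \<equiv> fm_class T"

section \<open>Provable equality, interderivability and their classes\<close>

lemma wt_length: "wt \<Gamma> \<Delta> ts \<Longrightarrow> length ts = length \<Delta>"
  by (auto simp: wt_def dest: list_all2_lengthD)

lemma teq_refl: "wt \<Gamma> \<Delta> ts \<Longrightarrow> teq \<Gamma> \<Delta> ts ts"
  by (auto simp: teq_def wt_def list_all2_conv_all_nth in_lists_subset intro!: eqn_refl)

lemma teq_sym: "teq \<Gamma> \<Delta> ts us \<Longrightarrow> teq \<Gamma> \<Delta> us ts"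
  by (auto simp: teq_def intro: eqn_sym)

lemma teq_trans: "teq \<Gamma> \<Delta> ts us \<Longrightarrow> teq \<Gamma> \<Delta> us vs \<Longrightarrow> teq \<Gamma> \<Delta> ts vs"
  by (auto simp: teq_def intro: eqn_trans)

lemma teq_wt: "teq \<Gamma> \<Delta> ts us \<Longrightarrow> set \<Delta> \<subseteq> Sorts Sg \<Longrightarrow> wt \<Gamma> \<Delta> us"
  using wf_Eqn by (auto simp: teq_def wt_def list_all2_conv_all_nth)

lemma tms_class_teq: "set \<Gamma> \<subseteq> Sorts Sg \<Longrightarrow> length ts = length \<Delta> \<Longrightarrow> tms_class T \<Gamma> \<Delta> ts =
  {us. teq \<Gamma> \<Delta> ts us}"
  by (auto simp: tms_class_def teq_def)

lemma arr_eq_iff: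
  assumes "wt \<Gamma> \<Delta> ts" "wt \<Gamma> \<Delta> us"
  shows "arr \<Gamma> \<Delta> ts = arr \<Gamma> \<Delta> us \<longleftrightarrow> teq \<Gamma> \<Delta> ts us"
proof -
  have "arr \<Gamma> \<Delta> ts = arr \<Gamma> \<Delta> us \<longleftrightarrow> {vs. teq \<Gamma> \<Delta> ts vs} = {vs. teq \<Gamma> \<Delta> us vs}"
    using assms by (auto simp: tms_arr_def tms_class_teq wt_length wt_def)
  also have "\<dots> \<longleftrightarrow> teq \<Gamma> \<Delta> ts us"
    using teq_refl[OF assms(2)] by (auto intro: teq_sym teq_trans)
  finally show ?thesis .
qed

text \<open>The operations of \<open>classifying\<close> act on representatives chosen by
  \<open>rep\<close>; this allows any given representative to take the place of the chosen
  one.\<close>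

lemma teq_rep:
  assumes "wt \<Gamma> \<Delta> ts"
  shows "teq \<Gamma> \<Delta> ts (rep (tms_class T \<Gamma> \<Delta> ts))"
proof -
  have "tms_class T \<Gamma> \<Delta> ts = {us. teq \<Gamma> \<Delta> ts us}"
    using assms by (intro tms_class_teq) (auto simp: wt_length wt_def)
  then show ?thesis
    unfolding rep_def using teq_refl[OF assms] by (auto intro: someI)
qed

lemma feq_refl: "wf \<Gamma> \<phi> \<Longrightarrow> feq \<Gamma> \<phi> \<phi>"
  by (auto simp: feq_def wf_def in_lists_subset intro!: ax)

lemma feq_sym: "feq \<Gamma> \<phi> \<psi> \<Longrightarrow> feq \<Gamma> \<psi> \<phi>"
  by (auto simp: feq_def)

lemma seq_trans: "Seq \<Gamma> [\<phi>] \<psi> \<in> T \<Longrightarrow> Seq \<Gamma> [\<psi>] \<theta> \<in> T \<Longrightarrow> Seq \<Gamma> [\<phi>] \<theta> \<in> T"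
  using cut[of \<Gamma> "[\<phi>]" \<psi> "[]" "[]"] by simp

lemma feq_trans: "feq \<Gamma> \<phi> \<psi> \<Longrightarrow> feq \<Gamma> \<psi> \<theta> \<Longrightarrow> feq \<Gamma> \<phi> \<theta>"
  by (auto simp: feq_def intro: seq_trans)

lemma feq_wf: "feq \<Gamma> \<phi> \<psi> \<Longrightarrow> wf \<Gamma> \<psi>"
  unfolding feq_def wf_def by (auto dest: wf_Seq)

lemma cls_eq_iff: "wf \<Gamma> \<phi> \<Longrightarrow> wf \<Gamma> \<psi> \<Longrightarrow> cls \<Gamma> \<phi> = cls \<Gamma> \<psi> \<longleftrightarrow> feq \<Gamma> \<phi> \<psi>"
  unfolding fm_class_def feq_def[symmetric] using feq_refl by (auto intro: feq_sym feq_trans)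

lemma feq_rep: "wf \<Gamma> \<phi> \<Longrightarrow> feq \<Gamma> \<phi> (rep (cls \<Gamma> \<phi>))"
  unfolding fm_class_def feq_def[symmetric] rep_def using feq_refl by (auto intro: someI)

lemma wt_idn: "set \<Gamma> \<subseteq> Sorts Sg \<Longrightarrow> wt \<Gamma> \<Gamma> (vars \<Gamma>)"
  by (simp add: wt_def wt_vars_same)

lemma wt_comp: "wt \<Gamma> \<Delta> ts \<Longrightarrow> wt \<Delta> \<Theta> us \<Longrightarrow> wt \<Gamma> \<Theta> (map (tm_subst ts) us)"
  by (auto simp: wt_def intro: wt_tms_subst)

lemma wt_append: "wt \<Gamma> \<Delta> ts \<Longrightarrow> wt \<Gamma> \<Theta> us \<Longrightarrow> wt \<Gamma> (\<Delta> @ \<Theta>) (ts @ us)"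
  by (auto simp: wt_def intro: list_all2_appendI)

lemma wt_pr1: "set \<Gamma> \<subseteq> Sorts Sg \<Longrightarrow> set \<Delta> \<subseteq> Sorts Sg \<Longrightarrow> wt (\<Gamma> @ \<Delta>) \<Gamma> (vars \<Gamma>)"
  by (simp add: wt_def wt_vars)

lemma wt_pr2:
  "set \<Gamma> \<subseteq> Sorts Sg \<Longrightarrow> set \<Delta> \<subseteq> Sorts Sg \<Longrightarrow>
    wt (\<Gamma> @ \<Delta>) \<Delta> (map Var [length \<Gamma>..<length \<Gamma> + length \<Delta>])"
  by (auto simp: wt_def list_all2_conv_all_nth wt_tm_Var)

lemma wf_subst: "wf \<Delta> \<phi> \<Longrightarrow> wt \<Gamma> \<Delta> ts \<Longrightarrow> wf \<Gamma> (fm_subst (length \<Gamma>) ts \<phi>)"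
  by (auto simp: wt_def wf_def intro: wf_fm_subst)

lemma wf_tensor: "wf \<Gamma> \<phi> \<Longrightarrow> wf \<Gamma> \<psi> \<Longrightarrow> wf \<Gamma> (tensor_fm L \<phi> \<psi>)"
  by (auto simp: wf_def)

lemma wf_unit: "set \<Gamma> \<subseteq> Sorts Sg \<Longrightarrow> wf \<Gamma> (unit_fm L)"
  by (auto simp: wf_def)

lemma wf_tensor_fms: "set \<Gamma> \<subseteq> Sorts Sg \<Longrightarrow> \<forall>\<phi> \<in> set \<phi>s. wf \<Gamma> \<phi> \<Longrightarrow> wf \<Gamma> (tensor_fms L \<phi>s)"
  by (induction \<phi>s rule: induct_list012) (auto simp: wf_unit wf_tensor)

lemma wf_var_eqs: "set \<Gamma> \<subseteq> Sorts Sg \<Longrightarrow> \<forall>\<phi> \<in> set (var_eqs \<Gamma>). wf (\<Gamma> @ \<Gamma>) \<phi>"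
  by (auto simp: wf_def var_eqs_def wt_tm_Var nth_append)

lemma teq_subst: "teq \<Delta> \<Theta> us us' \<Longrightarrow> teq \<Gamma> \<Delta> ts ts' \<Longrightarrow>
    teq \<Gamma> \<Theta> (map (tm_subst ts) us) (map (tm_subst ts') us')"
  by (auto simp: teq_def in_lists_subset intro!: eqn_subst)

lemma seq_subst_teq:
  "Seq \<Delta> \<Phi> \<psi> \<in> T \<Longrightarrow> teq \<Gamma> \<Delta> ts ts' \<Longrightarrow>
    Seq \<Gamma> (map (fm_subst (length \<Gamma>) ts) \<Phi>) (fm_subst (length \<Gamma>) ts' \<psi>) \<in> T"
  by (auto simp: teq_def in_lists_subset intro!: seq_subst)

lemma feq_subst: "feq \<Delta> \<phi> \<psi> \<Longrightarrow> teq \<Gamma> \<Delta> ts ts' \<Longrightarrow>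
    feq \<Gamma> (fm_subst (length \<Gamma>) ts \<phi>) (fm_subst (length \<Gamma>) ts' \<psi>)"
  using seq_subst_teq[of \<Delta> "[\<phi>]" \<psi> \<Gamma> ts ts'] seq_subst_teq[of \<Delta> "[\<psi>]" \<phi> \<Gamma> ts' ts] teq_sym
  by (auto simp: feq_def)

lemma feq_conn:
  assumes "set \<Gamma> \<subseteq> Sorts Sg" "k \<in> Conns L" "length \<phi>s = arity L k" "list_all2 (feq \<Gamma>) \<phi>s \<psi>s"
  shows "feq \<Gamma> (Conn k \<phi>s) (Conn k \<psi>s)"
  using assms by (auto simp: feq_def list_all2_conv_all_nth in_lists_subset intro!: conn_cong)

lemma feq_foldr_Quant:
  "feq (\<Gamma> @ \<Delta>) \<phi> \<psi> \<Longrightarrow> q \<in> Quants L \<Longrightarrow> feq \<Gamma> (foldr (Quant q) \<Delta> \<phi>) (foldr (Quant q) \<Delta> \<psi>)"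
proof (induction \<Delta> arbitrary: \<Gamma>)
  case (Cons \<sigma> \<Delta>)
  then have "feq (\<Gamma> @ [\<sigma>]) (foldr (Quant q) \<Delta> \<phi>) (foldr (Quant q) \<Delta> \<psi>)"
    by simp
  then show ?case
    using Cons.prems(2) by (auto simp: feq_def intro: quant_cong)
qed simp

section \<open>The operations of the classifying prop-category on representatives\<close>

lemma classifying_sel [simp]:
  "Obj K = lists (Sorts Sg)" "Trm K = []" "Prd K = (@)"
  "Src K (arr \<Gamma> \<Delta> ts) = \<Gamma>" "Tgt K (arr \<Gamma> \<Delta> ts) = \<Delta>"
  "Idn K \<Gamma> = arr \<Gamma> \<Gamma> (vars \<Gamma>)"
  "Pr1 K \<Gamma> \<Delta> = arr (\<Gamma> @ \<Delta>) \<Gamma> (vars \<Gamma>)"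
  "Pr2 K \<Gamma> \<Delta> = arr (\<Gamma> @ \<Delta>) \<Delta> (map Var [length \<Gamma>..<length \<Gamma> + length \<Delta>])"
  by (simp_all add: classifying_def tms_arr_def vars_def)

lemma Arr_K: "f \<in> Arr K \<longleftrightarrow> (\<exists>\<Gamma> \<Delta> ts. f = arr \<Gamma> \<Delta> ts \<and> wt \<Gamma> \<Delta> ts)"
  by (auto simp: classifying_def wt_def in_lists_subset)

lemma hom_K: "f \<in> hom K \<Gamma> \<Delta> \<longleftrightarrow> (\<exists>ts. f = arr \<Gamma> \<Delta> ts \<and> wt \<Gamma> \<Delta> ts)"
  by (auto simp: hom_def Arr_K)

lemma arr_hom: "wt \<Gamma> \<Delta> ts \<Longrightarrow> arr \<Gamma> \<Delta> ts \<in> hom K \<Gamma> \<Delta>"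
  unfolding hom_K by blast

lemma Prp_K: "set \<Gamma> \<subseteq> Sorts Sg \<Longrightarrow> x \<in> Prp K \<Gamma> \<longleftrightarrow> (\<exists>\<phi>. x = cls \<Gamma> \<phi> \<and> wf \<Gamma> \<phi>)"
  by (auto simp: classifying_def wf_def)

text \<open>Well defined because equal terms may be substituted into equal terms, which is the rule
  \<open>eqn_subst\<close>.\<close>

lemma Cmp_K:
  assumes "wt \<Gamma> \<Delta> ts" "wt \<Delta> \<Theta> us"
  shows "Cmp K (arr \<Delta> \<Theta> us) (arr \<Gamma> \<Delta> ts) = arr \<Gamma> \<Theta> (map (tm_subst ts) us)"
proof -
  let ?ts = "rep (tms_class T \<Gamma> \<Delta> ts)" and ?us = "rep (tms_class T \<Delta> \<Theta> us)"
  have teq: "teq \<Gamma> \<Theta> (map (tm_subst ts) us) (map (tm_subst ?ts) ?us)"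
    by (rule teq_subst[OF teq_rep[OF assms(2)] teq_rep[OF assms(1)]])
  then have "arr \<Gamma> \<Theta> (map (tm_subst ?ts) ?us) = arr \<Gamma> \<Theta> (map (tm_subst ts) us)"
    using teq_wt[OF teq] wt_comp[OF assms] assms(2) by (subst arr_eq_iff) (auto simp: wt_def teq_sym)
  then show ?thesis
    by (simp add: classifying_def tms_arr_def)
qed

lemma Rdx_K:
  assumes "wt \<Gamma> \<Delta> ts" "wf \<Delta> \<phi>"
  shows "Rdx K (arr \<Gamma> \<Delta> ts) (cls \<Delta> \<phi>) = cls \<Gamma> (fm_subst (length \<Gamma>) ts \<phi>)"
proof -
  let ?ts = "rep (tms_class T \<Gamma> \<Delta> ts)" and ?\<phi> = "rep (cls \<Delta> \<phi>)"
  have feq: "feq \<Gamma> (fm_subst (length \<Gamma>) ts \<phi>) (fm_subst (length \<Gamma>) ?ts ?\<phi>)"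
    by (rule feq_subst[OF feq_rep[OF assms(2)] teq_rep[OF assms(1)]])
  then have "cls \<Gamma> (fm_subst (length \<Gamma>) ?ts ?\<phi>) = cls \<Gamma> (fm_subst (length \<Gamma>) ts \<phi>)"
    using feq_wf[OF feq] wf_subst[OF assms(2,1)] by (subst cls_eq_iff) (auto simp: feq_sym)
  then show ?thesis
    by (simp add: classifying_def tms_arr_def)
qed

lemma Opr_K:
  assumes "set \<Gamma> \<subseteq> Sorts Sg" "k \<in> Conns L" "length \<phi>s = arity L k" "\<forall>\<phi> \<in> set \<phi>s. wf \<Gamma> \<phi>"
  shows "Opr K \<Gamma> k (map (cls \<Gamma>) \<phi>s) = cls \<Gamma> (Conn k \<phi>s)"
proof -
  let ?\<psi>s = "map (\<lambda>\<phi>. rep (cls \<Gamma> \<phi>)) \<phi>s"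
  have "feq \<Gamma> (Conn k \<phi>s) (Conn k ?\<psi>s)"
    using assms feq_rep by (intro feq_conn) (auto simp: list_all2_conv_all_nth)
  from this feq_wf[OF this] have "cls \<Gamma> (Conn k \<phi>s) = cls \<Gamma> (Conn k ?\<psi>s)"
    using assms by (subst cls_eq_iff) (auto simp: wf_def)
  then show ?thesis
    by (simp add: classifying_def o_def)
qed

text \<open>Well defined by the congruence rule for quantifiers, iterated along the block.\<close>

lemma Qnt_K:
  assumes "set \<Gamma> \<subseteq> Sorts Sg" "set \<Delta> \<subseteq> Sorts Sg" "q \<in> Quants L" "wf (\<Gamma> @ \<Delta>) \<phi>"
  shows "Qnt K q \<Gamma> \<Delta> (cls (\<Gamma> @ \<Delta>) \<phi>) = cls \<Gamma> (foldr (Quant q) \<Delta> \<phi>)"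
proof -
  have feq: "feq \<Gamma> (foldr (Quant q) \<Delta> \<phi>) (foldr (Quant q) \<Delta> (rep (cls (\<Gamma> @ \<Delta>) \<phi>)))"
    by (intro feq_foldr_Quant feq_rep assms)
  have "cls \<Gamma> (foldr (Quant q) \<Delta> \<phi>) = cls \<Gamma> (foldr (Quant q) \<Delta> (rep (cls (\<Gamma> @ \<Delta>) \<phi>)))"
    using feq feq_wf[OF feq] feq_wf[OF feq_sym[OF feq]] by (subst cls_eq_iff)
  then show ?thesis
    by (simp add: classifying_def)
qed

lemma Eql_K: "Eql K \<Gamma> = cls (\<Gamma> @ \<Gamma>) (tensor_fms L (var_eqs \<Gamma>))"
  by (simp add: classifying_def var_eqs_def)

text \<open>\<open>Leq\<close> asks only for some derivable pair of members. Members of one class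
  are interderivable, so Cut carries derivability to the given pair.\<close>

lemma Leq_K:
  assumes "wf \<Gamma> \<phi>" "wf \<Gamma> \<psi>"
  shows "Leq K \<Gamma> (cls \<Gamma> \<phi>) (cls \<Gamma> \<psi>) \<longleftrightarrow> Seq \<Gamma> [\<phi>] \<psi> \<in> T"
  using feq_refl[OF assms(1)] feq_refl[OF assms(2)]
  by (auto simp: classifying_def fm_class_def feq_def intro: seq_trans)

lemma tms_subst_vars_self: "length ts = length \<Gamma> \<Longrightarrow> map (tm_subst ts) (vars \<Gamma>) = ts"
  by (auto simp: vars_def intro!: nth_equalityI)

lemma tms_subst_pr1: "length ts = length \<Gamma> \<Longrightarrow> map (tm_subst (ts @ us)) (vars \<Gamma>) = ts"
  by (auto simp: vars_def nth_append intro!: nth_equalityI)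

lemma tms_subst_pr2:
  "length ts = length \<Gamma> \<Longrightarrow> length us = length \<Delta> \<Longrightarrow>
    map (tm_subst (ts @ us)) (map Var [length \<Gamma>..<length \<Gamma> + length \<Delta>]) = us"
  by (auto simp: nth_append intro!: nth_equalityI)

text \<open>A list of terms into a concatenated context is a pair of lists, and only the empty list
  goes into the empty context.\<close>

lemma fp_category_K: "fp_category K"
proof
  fix f g h a b c d
  show "Src K f \<in> Obj K" "Tgt K f \<in> Obj K" if "f \<in> Arr K"
    using that by (auto simp: Arr_K wt_def)
  show "Idn K a \<in> hom K a a" if "a \<in> Obj K"
    using that wt_idn by (auto simp: hom_K in_lists_subset)
  show "Cmp K g f \<in> hom K a c" if "f \<in> hom K a b" "g \<in> hom K b c"
    using that by (auto simp: hom_K Cmp_K intro: wt_comp)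
  show "Cmp K f (Idn K a) = f" "Cmp K (Idn K b) f = f" if "f \<in> hom K a b"
  proof -
    obtain ts where ts: "f = arr a b ts" "wt a b ts"
      using \<open>f \<in> hom K a b\<close> by (auto simp: hom_K)
    then have *: "wt a a (vars a)" "wt b b (vars b)" "list_all2 (wt_tm Sg a) ts b"
      by (auto simp: wt_def intro: wt_vars_same)
    show "Cmp K f (Idn K a) = f"
      using ts *(1) tms_subst_vars[OF *(3)] by (simp add: Cmp_K)
    show "Cmp K (Idn K b) f = f"
      using ts *(2) tms_subst_vars_self[OF wt_length[OF ts(2)]] by (simp add: Cmp_K)
  qed
  show "Cmp K h (Cmp K g f) = Cmp K (Cmp K h g) f"
    if "f \<in> hom K a b" "g \<in> hom K b c" "h \<in> hom K c d"
  proof -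
    obtain ts us vs where *: "f = arr a b ts" "g = arr b c us" "h = arr c d vs"
      "wt a b ts" "wt b c us" "wt c d vs"
      using \<open>f \<in> hom K a b\<close> \<open>g \<in> hom K b c\<close> \<open>h \<in> hom K c d\<close> by (auto simp: hom_K)
    have "map (tm_subst ts) (map (tm_subst us) vs) = map (tm_subst (map (tm_subst ts) us)) vs"
      by (rule tms_subst_subst) (use *(5,6) in \<open>auto simp: wt_length wt_def list_all2_lengthD\<close>)
    then show ?thesis
      using * wt_comp[OF *(4,5)] wt_comp[OF *(5,6)] by (simp add: Cmp_K del: map_map)
  qed
  show "Trm K \<in> Obj K" by simp
  show "\<exists>!h. h \<in> hom K a (Trm K)" if "a \<in> Obj K"
    using that by (intro ex1I[of _ "arr a [] []"]) (auto simp: hom_K wt_def)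
  show "Prd K a b \<in> Obj K" if "a \<in> Obj K" "b \<in> Obj K"
    using that by auto
  show "Pr1 K a b \<in> hom K (Prd K a b) a" if "a \<in> Obj K" "b \<in> Obj K"
    using that wt_pr1 by (auto simp: hom_K in_lists_subset)
  show "Pr2 K a b \<in> hom K (Prd K a b) b" if "a \<in> Obj K" "b \<in> Obj K"
    using that wt_pr2 by (auto simp: hom_K in_lists_subset)
  show "\<exists>!h. h \<in> hom K d (Prd K a b) \<and> Cmp K (Pr1 K a b) h = f \<and> Cmp K (Pr2 K a b) h = g"
    if "f \<in> hom K d a" "g \<in> hom K d b"
  proof -
    obtain ts us where *: "f = arr d a ts" "g = arr d b us" "wt d a ts" "wt d b us"
      using \<open>f \<in> hom K d a\<close> \<open>g \<in> hom K d b\<close> by (auto simp: hom_K)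
    have objs: "set a \<subseteq> Sorts Sg" "set b \<subseteq> Sorts Sg"
      using * by (auto simp: wt_def)
    show ?thesis
    proof (rule ex1I[of _ "arr d (a @ b) (ts @ us)"])
      show "arr d (a @ b) (ts @ us) \<in> hom K d (Prd K a b) \<and>
        Cmp K (Pr1 K a b) (arr d (a @ b) (ts @ us)) = f \<and>
        Cmp K (Pr2 K a b) (arr d (a @ b) (ts @ us)) = g"
        using * wt_append[OF *(3,4)] wt_pr1[OF objs] wt_pr2[OF objs]
          wt_length[OF *(3)] wt_length[OF *(4)]
        by (auto simp: hom_K Cmp_K tms_subst_pr1 tms_subst_pr2 simp del: map_map)
    next
      fix h assume h: "h \<in> hom K d (Prd K a b) \<and> Cmp K (Pr1 K a b) h = f \<and> Cmp K (Pr2 K a b) h = g"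
      then obtain vs where vs: "h = arr d (a @ b) vs" "wt d (a @ b) vs"
        by (auto simp: hom_K)
      have "arr d a (map (tm_subst vs) (vars a)) = arr d a ts"
        "arr d b (map (tm_subst vs) (map Var [length a..<length a + length b])) = arr d b us"
        using h vs * wt_pr1[OF objs] wt_pr2[OF objs] by (auto simp: Cmp_K simp del: map_map)
      then have "teq d a (map (tm_subst vs) (vars a)) ts"
        "teq d b (map (tm_subst vs) (map Var [length a..<length a + length b])) us"
        using * wt_comp[OF vs(2) wt_pr1[OF objs]] wt_comp[OF vs(2) wt_pr2[OF objs]]
        by (simp_all add: arr_eq_iff del: map_map)
      \<comment> \<open>A position below \<open>length a\<close> is handled by the first equation,
        any other by the second after subtracting \<open>length a\<close>.\<close>
      then have "teq d (a @ b) vs (ts @ us)"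
        using wt_length[OF vs(2)] wt_length[OF *(3)] wt_length[OF *(4)]
        by (auto simp: teq_def vars_def nth_append)
          (metis add_diff_inverse_nat nat_add_left_cancel_less)
      then show "h = arr d (a @ b) (ts @ us)"
        using vs wt_append[OF *(3,4)] by (simp add: arr_eq_iff)
    qed
  qed
qed

end

section \<open>The monoid of formulas and the structure of an object of FA\<close>

context classified_theory
begin

sublocale fp_K: fp_category K
  by (rule fp_category_K)

text \<open>\<open>pair\<close> is a definite description; its value is found by computing both
  projections of the concatenated list and applying \<open>pair_eta\<close>.\<close>

lemma pair_K:
  assumes "wt \<Gamma> \<Delta> ts" "wt \<Gamma> \<Theta> us"
  shows "pair K (arr \<Gamma> \<Delta> ts) (arr \<Gamma> \<Theta> us) = arr \<Gamma> (\<Delta> @ \<Theta>) (ts @ us)"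
proof -
  have objs: "set \<Delta> \<subseteq> Sorts Sg" "set \<Theta> \<subseteq> Sorts Sg"
    using assms by (auto simp: wt_def)
  have h: "arr \<Gamma> (\<Delta> @ \<Theta>) (ts @ us) \<in> Arr K"
    using wt_append[OF assms] by (auto simp: Arr_K)
  have "Cmp K (Pr1 K \<Delta> \<Theta>) (arr \<Gamma> (\<Delta> @ \<Theta>) (ts @ us)) = arr \<Gamma> \<Delta> ts"
    "Cmp K (Pr2 K \<Delta> \<Theta>) (arr \<Gamma> (\<Delta> @ \<Theta>) (ts @ us)) = arr \<Gamma> \<Theta> us"
    using wt_append[OF assms] wt_pr1[OF objs] wt_pr2[OF objs] assms[THEN wt_length]
    by (simp_all add: Cmp_K tms_subst_pr1 tms_subst_pr2 del: map_map)
  then show ?thesis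
    using fp_K.pair_eta[OF h, of \<Delta> \<Theta>] objs by (auto simp: in_lists_subset)
qed

text \<open>Right introduction of the tensor is derived, not primitive: splitting the antecedent of
  the axiom for the tensor formula leaves both factors on the left, and two cuts replace them by the
  given antecedents.\<close>

lemma seq_tensor:
  assumes "Seq \<Gamma> \<Phi> \<phi> \<in> T" "Seq \<Gamma> \<Psi> \<psi> \<in> T"
  shows "Seq \<Gamma> (\<Phi> @ \<Psi>) (tensor_fm L \<phi> \<psi>) \<in> T"
proof -
  have "wf \<Gamma> (tensor_fm L \<phi> \<psi>)"
    using assms[THEN wf_Seq] by (auto simp: wf_def)
  then have "Seq \<Gamma> [tensor_fm L \<phi> \<psi>] (tensor_fm L \<phi> \<psi>) \<in> T"
    using feq_refl by (auto simp: feq_def)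
  then have "Seq \<Gamma> [\<phi>, \<psi>] (tensor_fm L \<phi> \<psi>) \<in> T"
    using tensor_split[of \<Gamma> "[]" \<phi> \<psi> "[]"] by simp
  then have "Seq \<Gamma> (\<Phi> @ [\<psi>]) (tensor_fm L \<phi> \<psi>) \<in> T"
    using cut[OF assms(1), of "[]" "[\<psi>]"] by simp
  then show ?thesis
    using cut[OF assms(2), of \<Phi> "[]"] by simp
qed

lemma seq_join: "Seq \<Gamma> [\<phi>, \<psi>] \<theta> \<in> T \<Longrightarrow> Seq \<Gamma> [tensor_fm L \<phi> \<psi>] \<theta> \<in> T"
  using tensor_join[of \<Gamma> "[]" \<phi> \<psi> "[]"] by simp

lemma seq_refl: "wf \<Gamma> \<phi> \<Longrightarrow> Seq \<Gamma> [\<phi>] \<phi> \<in> T"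
  using feq_refl by (auto simp: feq_def)

lemma seq_unit: "set \<Gamma> \<subseteq> Sorts Sg \<Longrightarrow> Seq \<Gamma> [] (unit_fm L) \<in> T"
  using unit_drop[of \<Gamma> "[]" "[]"] seq_refl[OF wf_unit] by simp

text \<open>Yields \<open>tensor_mono\<close> for the classifying prop-category, the counterpart of
  what soundness of Cut consumes.\<close>

lemma seq_tensor_mono:
  "Seq \<Gamma> [\<phi>] \<phi>' \<in> T \<Longrightarrow> Seq \<Gamma> [\<psi>] \<psi>' \<in> T \<Longrightarrow> Seq \<Gamma> [tensor_fm L \<phi> \<psi>] (tensor_fm L \<phi>' \<psi>') \<in> T"
  by (rule seq_join) (use seq_tensor[of \<Gamma> "[\<phi>]" \<phi>' "[\<psi>]" \<psi>'] in simp)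

lemma feq_tensor: "feq \<Gamma> \<phi> \<phi>' \<Longrightarrow> feq \<Gamma> \<psi> \<psi>' \<Longrightarrow> feq \<Gamma> (tensor_fm L \<phi> \<psi>) (tensor_fm L \<phi>' \<psi>')"
  by (auto simp: feq_def intro: seq_tensor_mono)

lemma feq_unit_left: "wf \<Gamma> \<phi> \<Longrightarrow> feq \<Gamma> (tensor_fm L (unit_fm L) \<phi>) \<phi>"
  using unit_add[of \<Gamma> "[]" "[\<phi>]"] seq_tensor[of \<Gamma> "[]" "unit_fm L" "[\<phi>]" \<phi>]
  by (auto simp: feq_def wf_def seq_refl[unfolded wf_def] seq_unit intro!: seq_join)

lemma feq_unit_right: "wf \<Gamma> \<phi> \<Longrightarrow> feq \<Gamma> (tensor_fm L \<phi> (unit_fm L)) \<phi>"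
  using unit_add[of \<Gamma> "[\<phi>]" "[]"] seq_tensor[of \<Gamma> "[\<phi>]" \<phi> "[]" "unit_fm L"]
  by (auto simp: feq_def wf_def seq_refl[unfolded wf_def] seq_unit intro!: seq_join)

text \<open>Each bracketing is derivable from the plain list of the three formulas, and joining that
  list in either way gives the other bracketing as antecedent.\<close>

lemma feq_assoc:
  assumes "wf \<Gamma> \<phi>" "wf \<Gamma> \<psi>" "wf \<Gamma> \<theta>"
  shows "feq \<Gamma> (tensor_fm L (tensor_fm L \<phi> \<psi>) \<theta>) (tensor_fm L \<phi> (tensor_fm L \<psi> \<theta>))"
proof -
  note refl = assms[THEN seq_refl]
  have "Seq \<Gamma> [\<phi>, \<psi>, \<theta>] (tensor_fm L \<phi> (tensor_fm L \<psi> \<theta>)) \<in> T"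
    using seq_tensor[OF refl(1) seq_tensor[OF refl(2,3)]] by simp
  then have 1: "Seq \<Gamma> [tensor_fm L (tensor_fm L \<phi> \<psi>) \<theta>] (tensor_fm L \<phi> (tensor_fm L \<psi> \<theta>)) \<in> T"
    using tensor_join[of \<Gamma> "[]" \<phi> \<psi> "[\<theta>]"] by (intro seq_join) simp
  have "Seq \<Gamma> [\<phi>, \<psi>, \<theta>] (tensor_fm L (tensor_fm L \<phi> \<psi>) \<theta>) \<in> T"
    using seq_tensor[OF seq_tensor[OF refl(1,2)] refl(3)] by simp
  then have "Seq \<Gamma> [tensor_fm L \<phi> (tensor_fm L \<psi> \<theta>)] (tensor_fm L (tensor_fm L \<phi> \<psi>) \<theta>) \<in> T"
    using tensor_join[of \<Gamma> "[\<phi>]" \<psi> \<theta> "[]"] by (intro seq_join) simp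
  with 1 show ?thesis
    by (simp add: feq_def)
qed

text \<open>\<open>tensor_fms\<close> ends in its last formula and not in a unit, so the empty and
  the one-element list are separate cases, settled by the unit laws.\<close>

lemma feq_tensor_fms_append:
  assumes "set \<Gamma> \<subseteq> Sorts Sg" "\<forall>\<phi> \<in> set \<phi>s. wf \<Gamma> \<phi>" "\<forall>\<phi> \<in> set \<psi>s. wf \<Gamma> \<phi>"
  shows "feq \<Gamma> (tensor_fms L (\<phi>s @ \<psi>s)) (tensor_fm L (tensor_fms L \<phi>s) (tensor_fms L \<psi>s))"
  using assms(2)
proof (induction \<phi>s rule: induct_list012)
  case 1
  then show ?case
    using assms by (simp add: feq_sym[OF feq_unit_left] wf_tensor_fms)
next
  case (2 \<phi>)
  then show ?case
    using assms(1,3) wf_tensor_fms[of \<Gamma> \<psi>s]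
    by (cases \<psi>s) (auto simp: feq_sym[OF feq_unit_right] feq_refl wf_tensor)
next
  case (3 \<phi> \<phi>' \<phi>s)
  have wfs: "wf \<Gamma> \<phi>" "wf \<Gamma> (tensor_fms L (\<phi>' # \<phi>s))" "wf \<Gamma> (tensor_fms L \<psi>s)"
    using "3.prems" assms(3) wf_tensor_fms[OF assms(1), of
      "\<phi>' # \<phi>s"] wf_tensor_fms[OF assms(1), of \<psi>s]
    by simp_all
  have "feq \<Gamma> (tensor_fms L ((\<phi>' # \<phi>s) @ \<psi>s))
      (tensor_fm L (tensor_fms L (\<phi>' # \<phi>s)) (tensor_fms L \<psi>s))"
    by (rule "3.IH"(2)) (use "3.prems" in simp)
  then have "feq \<Gamma> (tensor_fm L \<phi> (tensor_fms L ((\<phi>' # \<phi>s) @ \<psi>s)))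
      (tensor_fm L \<phi> (tensor_fm L (tensor_fms L (\<phi>' # \<phi>s)) (tensor_fms L \<psi>s)))"
    by (rule feq_tensor[OF feq_refl[OF wfs(1)]])
  then show ?case
    using feq_trans feq_sym[OF feq_assoc[OF wfs]] by auto
qed

text \<open>Reduces arbitrary sequents to those with a single antecedent formula, which are what the
  order of the classifying prop-category sees. The prefix \<open>\<Psi>\<close> is there for the
  induction, which moves one formula at a time into it.\<close>

lemma Seq_tensor_fms_iff: "Seq \<Gamma> (\<Psi> @ [tensor_fms L \<Phi>]) \<phi> \<in> T \<longleftrightarrow> Seq \<Gamma> (\<Psi> @ \<Phi>) \<phi> \<in> T"
proof (induction \<Phi> arbitrary: \<Psi> rule: induct_list012)
  case 1
  then show ?case
    using unit_add[of \<Gamma> \<Psi> "[]"] unit_drop[of \<Gamma> \<Psi> "[]"] by auto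
next
  case (3 \<psi> \<psi>' \<Phi>)
  have "Seq \<Gamma> (\<Psi> @ [tensor_fms L (\<psi> # \<psi>' # \<Phi>)]) \<phi> \<in> T \<longleftrightarrow>
    Seq \<Gamma> ((\<Psi> @ [\<psi>]) @ [tensor_fms L (\<psi>' # \<Phi>)]) \<phi> \<in> T"
    using tensor_join[of \<Gamma> \<Psi> \<psi> _ "[]"] tensor_split[of \<Gamma> \<Psi> \<psi> _ "[]"] by auto
  also have "\<dots> \<longleftrightarrow> Seq \<Gamma> ((\<Psi> @ [\<psi>]) @ (\<psi>' # \<Phi>)) \<phi> \<in> T"
    by (rule "3.IH"(2))
  finally show ?case by simp
qed simp

lemma tensor_K:
  assumes "wf \<Gamma> \<phi>" "wf \<Gamma> \<psi>"
  shows "tensor_op L K \<Gamma> (cls \<Gamma> \<phi>) (cls \<Gamma> \<psi>) = cls \<Gamma> (tensor_fm L \<phi> \<psi>)"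
  using Opr_K[of \<Gamma> "tensor_conn L" "[\<phi>, \<psi>]"] assms by (auto simp: wf_def)

lemma unit_K: "set \<Gamma> \<subseteq> Sorts Sg \<Longrightarrow> unit_op L K \<Gamma> = cls \<Gamma> (unit_fm L)"
  using Opr_K[of \<Gamma> "unit_conn L" "[]"] by simp

lemma Prp_list_K:
  assumes "set \<Gamma> \<subseteq> Sorts Sg" "set xs \<subseteq> Prp K \<Gamma>"
  obtains \<phi>s where "xs = map (cls \<Gamma>) \<phi>s" "\<forall>\<phi> \<in> set \<phi>s. wf \<Gamma> \<phi>"
proof -
  have "\<exists>\<phi>s. xs = map (cls \<Gamma>) \<phi>s \<and> (\<forall>\<phi> \<in> set \<phi>s. wf \<Gamma> \<phi>)"
    using assms(2)
  proof (induction xs)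
    case (Cons x xs)
    then obtain \<phi> \<phi>s where "x = cls \<Gamma> \<phi>" "wf \<Gamma> \<phi>" "xs = map (cls \<Gamma>) \<phi>s" "\<forall>\<phi> \<in> set \<phi>s. wf \<Gamma> \<phi>"
      using assms(1) by (auto simp: Prp_K)
    then show ?case
      by (intro exI[of _ "\<phi> # \<phi>s"]) simp
  qed simp
  then show ?thesis using that by blast
qed

lemma cls_eqI: "feq \<Gamma> \<phi> \<psi> \<Longrightarrow> cls \<Gamma> \<phi> = cls \<Gamma> \<psi>"
  using cls_eq_iff feq_wf feq_sym by blast

lemma cls_in: "wf \<Gamma> \<phi> \<Longrightarrow> cls \<Gamma> \<phi> \<in> Prp K \<Gamma>"
  using Prp_K[of \<Gamma>] by (auto simp: wf_def)

lemma prop_category_K: "prop_category K"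
proof
  fix f g a b c x y z
  show "Leq K c x x" if prems: "c \<in> Obj K" "x \<in> Prp K c"
    using prems by (auto simp: in_lists_subset Prp_K Leq_K seq_refl)
  show "Leq K c x z" if prems: "c \<in> Obj K" "x \<in> Prp K c" "y \<in> Prp K c" "z \<in> Prp K c" "Leq K c x y"
    "Leq K c y z"
    using prems by (auto simp: in_lists_subset Prp_K Leq_K intro: seq_trans)
  show "x = y" if prems: "c \<in> Obj K" "x \<in> Prp K c" "y \<in> Prp K c" "Leq K c x y" "Leq K c y x"
  proof -
    obtain \<phi> \<psi> where "x = cls c \<phi>" "wf c \<phi>" "y = cls c \<psi>" "wf c \<psi>"
      using prems(1-3) by (auto simp: in_lists_subset Prp_K)
    then show ?thesis
      using prems(4,5) by (simp add: Leq_K cls_eq_iff feq_def)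
  qed
  show "Rdx K f x \<in> Prp K a" if prems: "f \<in> hom K a b" "x \<in> Prp K b"
  proof -
    obtain ts where ts: "f = arr a b ts" "wt a b ts"
      using prems(1) unfolding hom_K by blast
    then obtain \<phi> where "x = cls b \<phi>" "wf b \<phi>"
      using prems(2) by (auto simp: Prp_K wt_def)
    then show ?thesis
      using ts by (auto simp: Rdx_K intro: cls_in wf_subst)
  qed
  show "Leq K a (Rdx K f x) (Rdx K f y)"
    if prems: "f \<in> hom K a b" "x \<in> Prp K b" "y \<in> Prp K b" "Leq K b x y"
  proof -
    obtain ts where ts: "f = arr a b ts" "wt a b ts"
      using prems(1) unfolding hom_K by blast
    then obtain \<phi> \<psi> where *: "x = cls b \<phi>" "y = cls b \<psi>" "wf b \<phi>" "wf b \<psi>"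
      using prems(2,3) by (auto simp: Prp_K wt_def)
    then show ?thesis
      using prems(4) ts seq_subst_teq[of b "[\<phi>]" \<psi>, OF _ teq_refl[OF ts(2)]]
      by (simp add: Rdx_K Leq_K wf_subst)
  qed
  show "Rdx K (Idn K c) x = x" if prems: "c \<in> Obj K" "x \<in> Prp K c"
    using prems by (auto simp: in_lists_subset Prp_K Rdx_K wt_idn wf_def fm_subst_vars)
  show "Rdx K (Cmp K g f) x = Rdx K f (Rdx K g x)"
    if prems: "f \<in> hom K a b" "g \<in> hom K b c" "x \<in> Prp K c"
  proof -
    obtain ts us where ts: "f = arr a b ts" "wt a b ts" "g = arr b c us" "wt b c us"
      using prems(1,2) by (auto simp: hom_K)
    then obtain \<phi> where "x = cls c \<phi>" "wf c \<phi>"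
      using prems(3) by (auto simp: Prp_K wt_def)
    then show ?thesis
      using ts fm_subst_subst[of L Sg c \<phi> b us ts "length a"] wt_length[OF ts(2)]
      by (simp add: Cmp_K Rdx_K wt_comp wf_subst) (auto simp: wf_def wt_def)
  qed
qed

text \<open>In the doubled concatenation the two copies of any variable are
  \<open>length \<Gamma> + length \<Delta>\<close> positions apart.\<close>

lemma var_eqs_append:
  "var_eqs (\<Gamma> @ \<Delta>) =
    map (\<lambda>i. Equ (\<Gamma> ! i) (Var i) (Var (length \<Gamma> + length \<Delta> + i))) [0..<length \<Gamma>] @
    map (\<lambda>i. Equ (\<Delta> ! i) (Var (length \<Gamma> + i)) (Var (length \<Gamma> + length \<Delta> + length \<Gamma> + i)))
      [0..<length \<Delta>]"
  by (rule nth_equalityI) (auto simp: var_eqs_def nth_append)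

text \<open>Reindexing renames the equality formulas of \<open>c\<close> and \<open>d\<close> into
  the two blocks of \<open>var_eqs_append\<close>. What remains is a difference in bracketing,
  settled by \<open>feq_tensor_fms_append\<close>.\<close>

lemma Eql_prd_K:
  assumes "set c \<subseteq> Sorts Sg" "set d \<subseteq> Sorts Sg"
  shows "Eql K (Prd K c d) =
        (let cd = Prd K c d; p1 = Pr1 K cd cd; p2 = Pr2 K cd cd
         in tensor_op L K (Prd K cd cd)
              (Rdx K (pair K (Cmp K (Pr1 K c d) p1) (Cmp K (Pr1 K c d) p2)) (Eql K c))
              (Rdx K (pair K (Cmp K (Pr2 K c d) p1) (Cmp K (Pr2 K c d) p2)) (Eql K d)))"
proof -
  define n m where "n = length c" and "m = length d"
  define p1 where "p1 = (vars (c @ d) :: 'f tm list)"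
  define p2 where "p2 = (map Var [n + m..<n + m + (n + m)] :: 'f tm list)"
  define \<Gamma> where "\<Gamma> = c @ d"
  have \<Gamma>: "set \<Gamma> \<subseteq> Sorts Sg" "length \<Gamma> = n + m"
    using assms by (auto simp: \<Gamma>_def n_def m_def)
  have wts: "wt (\<Gamma> @ \<Gamma>) \<Gamma> p1" "wt (\<Gamma> @ \<Gamma>) \<Gamma> p2"
    "wt \<Gamma> c (vars c)" "wt \<Gamma> d (map Var [n..<n + m])"
    using wt_pr1[OF \<Gamma>(1,1)] wt_pr2[OF \<Gamma>(1,1)] wt_pr1[OF assms] wt_pr2[OF assms] \<Gamma>(2)
    unfolding p1_def p2_def \<Gamma>_def n_def m_def by simp_all
  \<comment> \<open>The positions of the two copies of \<open>c\<close>, and in \<open>?q2\<close>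
    of \<open>d\<close>, inside the doubled context.\<close>
  let ?q1 = "map Var [0..<n] @ map Var [n + m..<n + m + n] :: 'f tm list"
  let ?q2 = "map Var [n..<n + m] @ map Var [n + m + n..<n + m + n + m] :: 'f tm list"
  have sub: "map (tm_subst p1) (vars c) = map Var [0..<n]"
    "map (tm_subst p2) (vars c) = map Var [n + m..<n + m + n]"
    "map (tm_subst p1) (map Var [n..<n + m]) = map Var [n..<n + m]"
    "map (tm_subst p2) (map Var [n..<n + m]) = map Var [n + m + n..<n + m + n + m]"
    by (auto simp: p1_def p2_def vars_def n_def m_def nth_append intro!: nth_equalityI)
  have pairs: "pair K (Cmp K (arr \<Gamma> c (vars c)) (arr (\<Gamma> @ \<Gamma>) \<Gamma> p1)) (Cmp K (arr \<Gamma> c (vars c)) (arr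
    (\<Gamma> @ \<Gamma>) \<Gamma> p2)) =
      arr (\<Gamma> @ \<Gamma>) (c @ c) ?q1"
    "pair K (Cmp K (arr \<Gamma> d (map Var [n..<n + m])) (arr (\<Gamma> @ \<Gamma>) \<Gamma> p1))
       (Cmp K (arr \<Gamma> d (map Var [n..<n + m])) (arr (\<Gamma> @ \<Gamma>) \<Gamma> p2)) =
      arr (\<Gamma> @ \<Gamma>) (d @ d) ?q2"
    using wts wt_comp[OF wts(1,3)] wt_comp[OF wts(2,3)] wt_comp[OF wts(1,4)] wt_comp[OF wts(2,4)]
    by (simp_all add: Cmp_K pair_K sub del: map_map)
  have wq: "wt (\<Gamma> @ \<Gamma>) (c @ c) ?q1" "wt (\<Gamma> @ \<Gamma>) (d @ d) ?q2"
    using wt_append[OF wt_comp[OF wts(1,3)] wt_comp[OF wts(2,3)]]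
      wt_append[OF wt_comp[OF wts(1,4)] wt_comp[OF wts(2,4)]]
    by (simp_all add: sub del: map_map)
  let ?E1 = "map (\<lambda>i. Equ (c ! i) (Var i) (Var (n + m + i))) [0..<n]"
  let ?E2 = "map (\<lambda>i. Equ (d ! i) (Var (n + i)) (Var (n + m + n + i))) [0..<m]"
  have E: "map (fm_subst (length (\<Gamma> @ \<Gamma>)) ?q1) (var_eqs c) = ?E1"
    "map (fm_subst (length (\<Gamma> @ \<Gamma>)) ?q2) (var_eqs d) = ?E2"
    by (auto simp: var_eqs_def nth_append n_def m_def intro!: nth_equalityI)
  have wfe: "wf (c @ c) (tensor_fms L (var_eqs c))" "wf (d @ d) (tensor_fms L (var_eqs d))"
    using assms wf_var_eqs by (auto intro!: wf_tensor_fms)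
  have R: "Rdx K (arr (\<Gamma> @ \<Gamma>) (c @ c) ?q1) (Eql K c) = cls (\<Gamma> @ \<Gamma>) (tensor_fms L ?E1)"
    "Rdx K (arr (\<Gamma> @ \<Gamma>) (d @ d) ?q2) (Eql K d) = cls (\<Gamma> @ \<Gamma>) (tensor_fms L ?E2)"
    unfolding Eql_K Rdx_K[OF wq(1) wfe(1)] Rdx_K[OF wq(2) wfe(2)] fm_subst_tensor_fms E
    by (rule refl)+
  have ve: "var_eqs \<Gamma> = ?E1 @ ?E2"
    by (simp add: \<Gamma>_def var_eqs_append n_def m_def)
  have wfE: "\<forall>\<phi> \<in> set ?E1. wf (\<Gamma> @ \<Gamma>) \<phi>" "\<forall>\<phi> \<in> set ?E2. wf (\<Gamma> @ \<Gamma>) \<phi>"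
    using wf_var_eqs[OF \<Gamma>(1)] unfolding ve by (auto simp del: set_map)
  have \<Gamma>2: "set (\<Gamma> @ \<Gamma>) \<subseteq> Sorts Sg"
    using \<Gamma> by simp
  note feq = feq_tensor_fms_append[OF \<Gamma>2 wfE]
  have "cls (\<Gamma> @ \<Gamma>) (tensor_fms L (var_eqs \<Gamma>)) =
    cls (\<Gamma> @ \<Gamma>) (tensor_fm L (tensor_fms L ?E1) (tensor_fms L ?E2))"
    unfolding ve using feq feq_wf[OF feq] feq_wf[OF feq_sym[OF feq]] by (subst cls_eq_iff)
  then have "Eql K \<Gamma> = tensor_op L K (\<Gamma> @ \<Gamma>) (cls (\<Gamma> @ \<Gamma>) (tensor_fms L ?E1)) (cls (\<Gamma> @ \<Gamma>)
    (tensor_fms L ?E2))"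
    unfolding Eql_K tensor_K[OF wf_tensor_fms[OF \<Gamma>2 wfE(1)] wf_tensor_fms[OF \<Gamma>2 wfE(2)]] .
  then show ?thesis
    unfolding Let_def using pairs R
    by (simp add: \<Gamma>(2) flip: \<Gamma>_def n_def m_def p1_def p2_def)
      (simp add: p1_def p2_def \<Gamma>_def n_def m_def)
qed

lemma FA_object_K: "FA_object L K"
proof (intro FA_object.intro prop_category_K FA_object_axioms.intro)
  interpret prop_category K by (rule prop_category_K)
  fix f a b b' c d x y z k q xs x' y'
  show "Opr K c k xs \<in> Prp K c"
    if prems: "c \<in> Obj K" "k \<in> Conns L" "length xs = arity L k" "set xs \<subseteq> Prp K c"
  proof -
    have c: "set c \<subseteq> Sorts Sg" using prems by auto
    from Prp_list_K[OF c prems(4)] obtain \<phi>s where "xs = map (cls c) \<phi>s" "\<forall>\<phi> \<in> set \<phi>s. wf c \<phi>" .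
    then show ?thesis
      using prems c by (auto simp: Opr_K Prp_K wf_def)
  qed
  show "Rdx K f (Opr K b k xs) = Opr K a k (map (Rdx K f) xs)"
    if prems: "f \<in> hom K a b" "k \<in> Conns L" "length xs = arity L k" "set xs \<subseteq> Prp K b"
  proof -
    obtain ts where ts: "f = arr a b ts" "wt a b ts"
      using prems(1) unfolding hom_K by blast
    then have c: "set a \<subseteq> Sorts Sg" "set b \<subseteq> Sorts Sg" by (auto simp: wt_def)
    from Prp_list_K[OF c(2) prems(4)] obtain \<phi>s where xs: "xs = map (cls b) \<phi>s"
      "\<forall>\<phi> \<in> set \<phi>s. wf b \<phi>" .
    have "map (Rdx K f) xs = map (cls a) (map (fm_subst (length a) ts) \<phi>s)"
      using xs ts by (simp add: Rdx_K)
    moreover have "wf b (Conn k \<phi>s)"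
      using xs prems c by (auto simp: wf_def)
    moreover have "\<forall>\<phi> \<in> set (map (fm_subst (length a) ts) \<phi>s). wf a \<phi>"
      using xs wf_subst[OF _ ts(2)] by simp
    ultimately show ?thesis
      using xs prems ts c by (simp add: Opr_K Rdx_K del: map_map)
  qed
  show "tensor_op L K c (tensor_op L K c x y) z = tensor_op L K c x (tensor_op L K c y z)"
    if prems: "c \<in> Obj K" "x \<in> Prp K c" "y \<in> Prp K c" "z \<in> Prp K c"
  proof -
    obtain \<phi> \<psi> \<theta> where "x = cls c \<phi>" "wf c \<phi>" "y = cls c \<psi>" "wf c \<psi>" "z = cls c \<theta>" "wf c \<theta>"
      using prems by (auto simp: in_lists_subset Prp_K)
    then show ?thesis
      by (simp add: tensor_K wf_tensor cls_eqI feq_assoc)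
  qed
  show "tensor_op L K c (unit_op L K c) x = x" "tensor_op L K c x (unit_op L K c) = x"
    if prems: "c \<in> Obj K" "x \<in> Prp K c"
  proof -
    obtain \<phi> where "x = cls c \<phi>" "wf c \<phi>" "set c \<subseteq> Sorts Sg"
      using prems by (auto simp: in_lists_subset Prp_K)
    then show "tensor_op L K c (unit_op L K c) x = x" "tensor_op L K c x (unit_op L K c) = x"
      by (simp_all add: tensor_K unit_K wf_unit cls_eqI feq_unit_left feq_unit_right)
  qed
  show "Leq K c (tensor_op L K c x y) (tensor_op L K c x' y')"
    if prems: "c \<in> Obj K" "x \<in> Prp K c" "x' \<in> Prp K c" "y \<in> Prp K c" "y' \<in> Prp K c"
      "Leq K c x x'" "Leq K c y y'"
    using prems by (auto simp: in_lists_subset Prp_K tensor_K wf_tensor Leq_K seq_tensor_mono)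
  show "Eql K c \<in> Prp K (Prd K c c)" if prems: "c \<in> Obj K"
    using prems wf_tensor_fms[OF _ wf_var_eqs, of c] by (auto simp: in_lists_subset Eql_K Prp_K)
  show "Eql K (Trm K) = unit_op L K (Prd K (Trm K) (Trm K))"
    by (simp add: Eql_K unit_K var_eqs_def)
  show "Eql K (Prd K c d) =
      (let cd = Prd K c d; p1 = Pr1 K cd cd; p2 = Pr2 K cd cd
       in tensor_op L K (Prd K cd cd)
            (Rdx K (pair K (Cmp K (Pr1 K c d) p1) (Cmp K (Pr1 K c d) p2)) (Eql K c))
            (Rdx K (pair K (Cmp K (Pr2 K c d) p1) (Cmp K (Pr2 K c d) p2)) (Eql K d)))"
    if prems: "c \<in> Obj K" "d \<in> Obj K"
    by (rule Eql_prd_K) (use prems in auto)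
  show "Qnt K q b c x \<in> Prp K b" if prems: "q \<in> Quants L" "b \<in> Obj K" "c \<in> Obj K"
    "x \<in> Prp K (Prd K b c)"
    using prems by (auto simp: in_lists_subset Prp_K Qnt_K wf_def intro!: wf_foldr_Quant)
  show "Rdx K f (Qnt K q b c x) = Qnt K q b' c (Rdx K (map_left K f c) x)"
    if prems: "q \<in> Quants L" "f \<in> hom K b' b" "c \<in> Obj K" "x \<in> Prp K (Prd K b c)"
  proof -
    obtain ts where ts: "f = arr b' b ts" "wt b' b ts"
      using prems(2) by (auto simp: hom_K)
    then have c: "set b' \<subseteq> Sorts Sg" "set b \<subseteq> Sorts Sg" "set c \<subseteq> Sorts Sg"
      using prems by (auto simp: wt_def)
    obtain \<phi> where \<phi>: "x = cls (b @ c) \<phi>" "wf (b @ c) \<phi>"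
      using prems c by (auto simp: Prp_K)
    let ?vs = "map Var [length b'..<length b' + length c] :: 'f tm list"
    have wt: "wt (b' @ c) b ts" "wt (b' @ c) c ?vs"
      using wt_comp[OF wt_pr1[OF c(1,3)] ts(2)] tms_subst_vars[of Sg b' ts b] ts(2) wt_pr2[OF c(1,3)]
      by (auto simp: wt_def)
    \<comment> \<open>As a list of terms, this is exactly the substitution that
      \<open>fm_subst_foldr_Quant\<close> produces under a block of binders over
      \<open>c\<close>.\<close>
    have "map_left K f c = arr (b' @ c) (b @ c) (ts @ ?vs)"
      using wt ts wt_pr1[OF c(1,3)] tms_subst_vars[of Sg b' ts b]
      by (simp add: map_left_def Cmp_K pair_K wt_def)
    moreover have "wf b (foldr (Quant q) c \<phi>)"
      using \<phi> c prems by (auto simp: wf_def intro: wf_foldr_Quant)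
    ultimately show ?thesis
      using \<phi> c prems ts wt_append[OF wt]
      by (simp add: Qnt_K Rdx_K wf_subst[of "b @ c" \<phi> "b' @ c", simplified] fm_subst_foldr_Quant)
  qed
  \<comment> \<open>Appending the empty context changes nothing: the projection is an identity and
    the block of quantifiers is empty.\<close>
  show "Qnt K q b (Trm K) (Rdx K (Pr1 K b (Trm K)) x) = x"
    if prems: "q \<in> Quants L" "b \<in> Obj K" "x \<in> Prp K b"
    using prems rdx_idn[of b x] Qnt_K[of b "[]" q]
    by (auto simp: in_lists_subset Prp_K)
  show "Qnt K q b (Prd K c d) (Rdx K (assoc_arr K b c d) x) = Qnt K q b c (Qnt K q (Prd K b c) d x)"
    if prems: "q \<in> Quants L" "b \<in> Obj K" "c \<in> Obj K" "d \<in> Obj K" "x \<in> Prp K (Prd K (Prd K b c) d)"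
  proof -
    have c: "set b \<subseteq> Sorts Sg" "set c \<subseteq> Sorts Sg" "set d \<subseteq> Sorts Sg"
      using prems by (auto simp: wt_def)
    obtain \<phi> where \<phi>: "x = cls (b @ c @ d) \<phi>" "wf (b @ c @ d) \<phi>"
      using prems c by (auto simp: Prp_K)
    have cd: "set (c @ d) \<subseteq> Sorts Sg"
      using c by simp
    let ?p1 = "vars b :: 'f tm list"
    let ?p2 = "map Var [length b..<length b + length (c @ d)] :: 'f tm list"
    let ?q2 = "map Var [length c..<length c + length d] :: 'f tm list"
    note wts = wt_pr1[OF c(1) cd] wt_pr2[OF c(1) cd] wt_pr1[OF c(2,3)] wt_pr2[OF c(2,3)]
    note comps = wt_comp[OF wts(2,3)] wt_comp[OF wts(2,4)]
    \<comment> \<open>Concatenation is strictly associative, so the canonical arrow turns out to be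
      an identity and the axiom reduces to concatenating two blocks of quantifiers.\<close>
    have "assoc_arr K b c d = arr (b @ c @ d) ((b @ c) @ d)
        ((?p1 @ map (tm_subst ?p2) (vars c)) @ map (tm_subst ?p2) ?q2)"
      unfolding assoc_arr_def Let_def classifying_sel Cmp_K[OF wts(2,3)] Cmp_K[OF wts(2,4)]
        pair_K[OF wts(1) comps(1)] pair_K[OF wt_append[OF wts(1) comps(1)] comps(2)] by (rule refl)
    moreover have "(?p1 @ map (tm_subst ?p2) (vars c)) @ map (tm_subst ?p2) ?q2 = vars (b @ c @ d)"
      by (rule nth_equalityI) (auto simp: vars_def nth_append)
    ultimately have "Idn K (b @ c @ d) = assoc_arr K b c d"
      by simp
    then show ?thesis
      using \<phi> c prems rdx_idn[of "b @ c @ d" x] wf_foldr_Quant[of L Sg "b @ c" d \<phi> q] Qnt_K[of b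
        "c @ d" q \<phi>] Qnt_K[of "b @ c" d q \<phi>]
      by (auto simp: Qnt_K wf_def)
  qed
qed

end


section \<open>The functor induced by a structure\<close>

context fp_category
begin

text \<open>The direction in which \<open>split_ctx\<close> reassociates when a sort is appended;
  its inverse is the arrow occurring in \<open>qnt_prd\<close>.\<close>

definition assoc_inv :: "'o \<Rightarrow> 'o \<Rightarrow> 'o \<Rightarrow> 'm" where
  "assoc_inv b c d = (let p1 = Pr1 C (Prd C b c) d; p2 = Pr2 C (Prd C b c) d
    in pair C (Cmp C (Pr1 C b c) p1) (pair C (Cmp C (Pr2 C b c) p1) p2))"

lemma assoc_inv_arr [simp]:
  assumes "b \<in> Obj C" "c \<in> Obj C" "d \<in> Obj C"
  shows "assoc_inv b c d \<in> Arr C" "Src C (assoc_inv b c d) = Prd C (Prd C b c) d"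
    "Tgt C (assoc_inv b c d) = Prd C b (Prd C c d)"
  using assms by (simp_all add: assoc_inv_def Let_def)

lemma iso_assoc_inv:
  assumes "b \<in> Obj C" "c \<in> Obj C" "d \<in> Obj C"
  shows "iso_arr C (assoc_inv b c d)" "inv_arr C (assoc_inv b c d) = assoc_arr C b c d"
proof -
  have "Cmp C (assoc_inv b c d) (assoc_arr C b c d) = Idn C (Prd C b (Prd C c d))"
    "Cmp C (assoc_arr C b c d) (assoc_inv b c d) = Idn C (Prd C (Prd C b c) d)"
    using assms by (simp_all add: assoc_inv_def assoc_arr_def Let_def)
  then show "iso_arr C (assoc_inv b c d)" "inv_arr C (assoc_inv b c d) = assoc_arr C b c d"
    using iso_arrI[of "assoc_inv b c d" "assoc_arr C b c d"] assms by simp_all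
qed

end

text \<open>Interprets a chosen representative of each class. For the theory of \<open>M\<close> the
  choice is immaterial, since members of a class have the same interpretation.\<close>

definition int_map ::
  "('o, 'm, 'p, 'c, 'q) propcat \<Rightarrow> ('s, 'f, 'r, 'o, 'm, 'p) struct \<Rightarrow>
   ('s list, 's list \<times> 's list \<times> 'f tm list set, ('s, 'f, 'r, 'c, 'q) fm set, 'o, 'm, 'p) fa_map"
  where
  "int_map C M = \<lparr>
     on_obj = ctx_int C M,
     on_arr = (\<lambda>(\<Gamma>, \<Delta>, A). tms_int C M \<Gamma> (rep A)),
     on_prp = (\<lambda>\<Gamma> A. fm_int C M \<Gamma> (rep A)) \<rparr>"

section \<open>Interpretation of classes, and concatenation compared with products\<close>

context FA_structure
begin

sublocale th: classified_theory L Sg "theory_of L Sg C M"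
  by unfold_locales (fact lang sig Lm_theory_theory_of)+

text \<open>Provable in the theory of \<open>M\<close> means true in \<open>M\<close>; this gives
  both independence of representatives and faithfulness of \<open>int_map\<close>.\<close>

lemma teq_iff:
  assumes "th.wt \<Gamma> \<Delta> ts" "th.wt \<Gamma> \<Delta> us"
  shows "th.teq \<Gamma> \<Delta> ts us \<longleftrightarrow> tms_int C M \<Gamma> ts = tms_int C M \<Gamma> us"
  using assms tms_int_eq_iff[of \<Gamma> ts \<Delta> us]
  by (auto simp: th.teq_def th.wt_def theory_of_Eqn list_all2_conv_all_nth)

lemma feq_iff:
  assumes "th.wf \<Gamma> \<phi>" "th.wf \<Gamma> \<psi>"
  shows "th.feq \<Gamma> \<phi> \<psi> \<longleftrightarrow> fm_int C M \<Gamma> \<phi> = fm_int C M \<Gamma> \<psi>"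
  using assms fm_int_closed[of \<Gamma> \<phi>] fm_int_closed[of \<Gamma> \<psi>] leq_antisym[of "ctx_int C M \<Gamma>"]
  by (auto simp: th.feq_def th.wf_def theory_of_Seq1)

lemma on_obj_int_map [simp]: "on_obj (int_map C M) = ctx_int C M"
  by (simp add: int_map_def)

lemma on_arr_int_map:
  assumes "th.wt \<Gamma> \<Delta> ts"
  shows "on_arr (int_map C M) (th.arr \<Gamma> \<Delta> ts) = tms_int C M \<Gamma> ts"
proof -
  note teq = th.teq_rep[OF assms]
  have "th.wt \<Gamma> \<Delta> (rep (tms_class (theory_of L Sg C M) \<Gamma> \<Delta> ts))"
    using th.teq_wt[OF teq] assms by (auto simp: th.wt_def)
  from teq_iff[OF assms this] teq show ?thesis
    by (simp add: int_map_def tms_arr_def)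
qed

lemma on_prp_int_map: "th.wf \<Gamma> \<phi> \<Longrightarrow> on_prp (int_map C M) \<Gamma> (th.cls \<Gamma> \<phi>) = fm_int C M \<Gamma> \<phi>"
  using th.feq_rep[of \<Gamma> \<phi>] th.feq_wf[OF th.feq_rep] by (simp add: int_map_def feq_iff)

text \<open>The comparison arrow of \<open>int_map\<close>, from the left-nested interpretation of a
  concatenation to the product of the two interpretations.\<close>

definition split_ctx :: "'s list \<Rightarrow> 's list \<Rightarrow> 'm" where
  "split_ctx \<Gamma> \<Delta> = pair C (tms_int C M (\<Gamma> @ \<Delta>) (vars \<Gamma>))
    (tms_int C M (\<Gamma> @ \<Delta>) (map Var [length \<Gamma>..<length \<Gamma> + length \<Delta>]))"

lemma pr_tms_arr:
  assumes "set \<Gamma> \<subseteq> Sorts Sg" "set \<Delta> \<subseteq> Sorts Sg"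
  defines "p1 \<equiv> tms_int C M (\<Gamma> @ \<Delta>) (vars \<Gamma>)"
    and "p2 \<equiv> tms_int C M (\<Gamma> @ \<Delta>) (map Var [length \<Gamma>..<length \<Gamma> + length \<Delta>])"
  shows "p1 \<in> Arr C" "Src C p1 = ctx_int C M (\<Gamma> @ \<Delta>)" "Tgt C p1 = ctx_int C M \<Gamma>"
    and "p2 \<in> Arr C" "Src C p2 = ctx_int C M (\<Gamma> @ \<Delta>)" "Tgt C p2 = ctx_int C M \<Delta>"
  using tms_int_arr[of "\<Gamma> @ \<Delta>"] th.wt_pr1[OF assms(1,2)] th.wt_pr2[OF assms(1,2)]
  by (auto simp: p1_def p2_def th.wt_def)

lemma split_ctx_arr:
  assumes "set \<Gamma> \<subseteq> Sorts Sg" "set \<Delta> \<subseteq> Sorts Sg"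
  shows "split_ctx \<Gamma> \<Delta> \<in> Arr C" "Src C (split_ctx \<Gamma> \<Delta>) = ctx_int C M (\<Gamma> @ \<Delta>)"
    "Tgt C (split_ctx \<Gamma> \<Delta>) = Prd C (ctx_int C M \<Gamma>) (ctx_int C M \<Delta>)"
  using pr_tms_arr[OF assms] by (simp_all add: split_ctx_def)

lemma split_ctx_Nil: "set \<Gamma> \<subseteq> Sorts Sg \<Longrightarrow>
  split_ctx \<Gamma> [] = pair C (Idn C (ctx_int C M \<Gamma>)) (bang C (ctx_int C M \<Gamma>))"
  by (simp add: split_ctx_def tms_int_vars) (simp add: tms_int_def)

text \<open>The recursion that makes \<open>split_ctx\<close> invertible and its inverse computable:
  split off the shorter context beside the new sort, then reassociate.\<close>

lemma split_ctx_snoc: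
  assumes "set \<Gamma> \<subseteq> Sorts Sg" "set \<Delta> \<subseteq> Sorts Sg" "\<sigma> \<in> Sorts Sg"
  shows "split_ctx \<Gamma> (\<Delta> @ [\<sigma>]) =
    Cmp C (assoc_inv (ctx_int C M \<Gamma>) (ctx_int C M \<Delta>) (sort_int M \<sigma>))
      (map_left C (split_ctx \<Gamma> \<Delta>) (sort_int M \<sigma>))"
proof -
  let ?p2 = "map Var [length \<Gamma>..<length \<Gamma> + length \<Delta>] :: 'f tm list"
  have "tms_int C M ((\<Gamma> @ \<Delta>) @ [\<sigma>]) (vars \<Gamma>) =
      Cmp C (tms_int C M (\<Gamma> @ \<Delta>) (vars \<Gamma>)) (Pr1 C (ctx_int C M (\<Gamma> @ \<Delta>)) (sort_int M \<sigma>))"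
    "tms_int C M ((\<Gamma> @ \<Delta>) @ [\<sigma>]) ?p2 =
      Cmp C (tms_int C M (\<Gamma> @ \<Delta>) ?p2) (Pr1 C (ctx_int C M (\<Gamma> @ \<Delta>)) (sort_int M \<sigma>))"
    using th.wt_pr1[OF assms(1,2)] th.wt_pr2[OF assms(1,2)] assms
      tms_int_weaken[of "\<Gamma> @ \<Delta>" "vars \<Gamma>" \<Gamma>] tms_int_weaken[of "\<Gamma> @ \<Delta>" ?p2 \<Delta>]
    by (simp_all add: th.wt_def)
  moreover have "tm_int C M ((\<Gamma> @ \<Delta>) @ [\<sigma>]) (Var (length \<Gamma> + length \<Delta>)) =
      Pr2 C (ctx_int C M (\<Gamma> @ \<Delta>)) (sort_int M \<sigma>)"
    using list_proj_snoc[of C "map (sort_int M) (\<Gamma> @ \<Delta>)" "sort_int M \<sigma>" "length \<Gamma> + length \<Delta>"]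
    by (simp add: ctx_int_def)
  moreover have "map Var [length \<Gamma>..<length \<Gamma> + length (\<Delta> @ [\<sigma>])] = ?p2 @ [Var (length \<Gamma> + length \<Delta>)]"
    by simp
  ultimately have "split_ctx \<Gamma> (\<Delta> @ [\<sigma>]) =
    pair C (Cmp C (tms_int C M (\<Gamma> @ \<Delta>) (vars \<Gamma>)) (Pr1 C (ctx_int C M (\<Gamma> @ \<Delta>)) (sort_int M \<sigma>)))
     (pair C (Cmp C (tms_int C M (\<Gamma> @ \<Delta>) ?p2) (Pr1 C (ctx_int C M (\<Gamma> @ \<Delta>)) (sort_int M \<sigma>)))
       (Pr2 C (ctx_int C M (\<Gamma> @ \<Delta>)) (sort_int M \<sigma>)))"
    unfolding split_ctx_def by (simp only: tms_int_snoc append_assoc[symmetric])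
  then show ?thesis
    using pr_tms_arr[OF assms(1,2)] assms
    by (simp add: assoc_inv_def map_left_def Let_def split_ctx_def)
qed

lemma iso_split_ctx:
  assumes "set \<Gamma> \<subseteq> Sorts Sg" "set \<Delta> \<subseteq> Sorts Sg"
  shows "iso_arr C (split_ctx \<Gamma> \<Delta>)"
  using assms(2)
proof (induction \<Delta> rule: rev_induct)
  case Nil
  show ?case
    unfolding split_ctx_Nil[OF assms(1)]
    by (rule iso_pair_bang(1)) (simp add: assms)
next
  case (snoc \<sigma> \<Delta>)
  then show ?case
    using assms(1) split_ctx_arr[OF assms(1), of \<Delta>]
    by (auto simp: split_ctx_snoc intro!: iso_cmp iso_assoc_inv iso_map_left)
qed

text \<open>A block of quantifiers is one quantification along the product object. The innermost
  quantifier, at the right end of the block, is moved past the inverse of \<open>split_ctx\<close>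
  by naturality and then merged with the others by \<open>qnt_prd\<close>; the empty block is
  \<open>qnt_trm\<close>.\<close>

lemma fm_int_foldr_Quant:
  assumes "set \<Gamma> \<subseteq> Sorts Sg" "set \<Delta> \<subseteq> Sorts Sg" "q \<in> Quants L" "wf_fm L Sg (\<Gamma> @ \<Delta>) \<phi>"
  shows "fm_int C M \<Gamma> (foldr (Quant q) \<Delta> \<phi>) =
    Qnt C q (ctx_int C M \<Gamma>) (ctx_int C M \<Delta>)
      (Rdx C (inv_arr C (split_ctx \<Gamma> \<Delta>)) (fm_int C M (\<Gamma> @ \<Delta>) \<phi>))"
  using assms(2,4)
proof (induction \<Delta> arbitrary: \<phi> rule: rev_induct)
  case Nil
  then show ?case
    using assms(1,3) iso_pair_bang(2)[of "ctx_int C M \<Gamma>"] fm_int_closed[of \<Gamma> \<phi>] qnt_trm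
    by (simp add: split_ctx_Nil)
next
  case (snoc \<sigma> \<Delta>)
  let ?g = "ctx_int C M \<Gamma>" and ?d = "ctx_int C M \<Delta>" and ?s = "sort_int M \<sigma>"
  let ?inv = "inv_arr C (split_ctx \<Gamma> \<Delta>)" and ?x = "fm_int C M (\<Gamma> @ \<Delta> @ [\<sigma>]) \<phi>"
  have \<Delta>: "set \<Delta> \<subseteq> Sorts Sg" "\<sigma> \<in> Sorts Sg" and wf: "wf_fm L Sg (\<Gamma> @ \<Delta>) (Quant q \<sigma> \<phi>)"
    using snoc.prems assms(3) by auto
  have x: "?x \<in> Prp C (Prd C (ctx_int C M (\<Gamma> @ \<Delta>)) ?s)"
    using fm_int_closed[of "(\<Gamma> @ \<Delta>) @ [\<sigma>]" \<phi>] snoc.prems assms(1) by (simp flip: append_assoc)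
  note iso = iso_split_ctx[OF assms(1) \<Delta>(1)]
  note s = split_ctx_arr[OF assms(1) \<Delta>(1)] inv_arr_props[OF iso]
  have "fm_int C M \<Gamma> (foldr (Quant q) (\<Delta> @ [\<sigma>]) \<phi>) =
    Qnt C q ?g ?d (Rdx C ?inv (fm_int C M (\<Gamma> @ \<Delta>) (Quant q \<sigma> \<phi>)))"
    using snoc.IH[OF \<Delta>(1) wf] by simp
  also have "fm_int C M (\<Gamma> @ \<Delta>) (Quant q \<sigma> \<phi>) = Qnt C q (ctx_int C M (\<Gamma> @ \<Delta>)) ?s ?x"
    by simp
  also have "Rdx C ?inv \<dots> = Qnt C q (Prd C ?g ?d) ?s (Rdx C (map_left C ?inv ?s) ?x)"
    using s assms \<Delta> x by (intro qnt_natural) (auto simp: hom_iff)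
  also have "Qnt C q ?g ?d \<dots> =
    Qnt C q ?g (Prd C ?d ?s) (Rdx C (assoc_arr C ?g ?d ?s) (Rdx C (map_left C ?inv ?s) ?x))"
    using s assms \<Delta> x by (intro qnt_prd[symmetric]) auto
  also have "Rdx C (assoc_arr C ?g ?d ?s) (Rdx C (map_left C ?inv ?s) ?x) =
    Rdx C (Cmp C (map_left C ?inv ?s) (assoc_arr C ?g ?d ?s)) ?x"
    using s assms \<Delta> x by (intro rdx_rdx) auto
  \<comment> \<open>This is the recursion \<open>split_ctx_snoc\<close> with both of its factors
    inverted.\<close>
  also have "Cmp C (map_left C ?inv ?s) (assoc_arr C ?g ?d ?s) = inv_arr C (split_ctx \<Gamma> (\<Delta> @ [\<sigma>]))"
    using s(1-3) assms \<Delta> iso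
    by (simp add: split_ctx_snoc iso_cmp iso_assoc_inv iso_map_left)
  finally show ?case by simp
qed

text \<open>\<open>list_tensor\<close> ends in a unit where \<open>tensor_fms\<close> does not; the
  right unit law accounts for the difference.\<close>

lemma fm_int_tensor_fms:
  assumes "set \<Gamma> \<subseteq> Sorts Sg" "\<forall>\<phi> \<in> set \<phi>s. wf_fm L Sg \<Gamma> \<phi>"
  shows "fm_int C M \<Gamma> (tensor_fms L \<phi>s) = list_tensor L C (ctx_int C M \<Gamma>) (map (fm_int C M \<Gamma>) \<phi>s)"
  using assms(2) by (induction \<phi>s rule: induct_list012) (simp_all add: fm_int_closed assms(1))

text \<open>
  The elements $Eq_c$ are not assumed to be invariant under isomorphisms of $c$, so $Eq$ at the
  object of a context has to be computed from its values at $1$ and at binary products.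
\<close>

lemma rdx_eql_ctx:
  assumes "set \<Gamma> \<subseteq> Sorts Sg" "f \<in> Arr C" "g \<in> Arr C" "Src C f = x" "Src C g = x"
    "Tgt C f = ctx_int C M \<Gamma>" "Tgt C g = ctx_int C M \<Gamma>"
  shows "Rdx C (pair C f g) (Eql C (ctx_int C M \<Gamma>)) =
    list_tensor L C x (map (\<lambda>i. Rdx C (pair C (Cmp C (list_proj C (map (sort_int M) \<Gamma>) i) f)
        (Cmp C (list_proj C (map (sort_int M) \<Gamma>) i) g)) (Eql C (sort_int M (\<Gamma> ! i)))) [0..<length \<Gamma>])"
  using assms
proof (induction \<Gamma> arbitrary: f g rule: rev_induct)
  case Nil
  then show ?case
    using rdx_unit[of "pair C f g"] eql_trm by simp
next
  case (snoc \<sigma> \<Gamma>)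
  have \<Gamma>: "set \<Gamma> \<subseteq> Sorts Sg" "\<sigma> \<in> Sorts Sg" using snoc.prems by auto
  note [simp] = snoc.prems(2-7) \<Gamma>
  let ?g = "ctx_int C M \<Gamma>" and ?s = "sort_int M \<sigma>"
  let ?gs = "Prd C ?g ?s"
  have x: "x \<in> Obj C" using snoc.prems(2,4) src_in_obj by blast
  let ?a = "pair C (Cmp C (Pr1 C ?g ?s) (Pr1 C ?gs ?gs)) (Cmp C (Pr1 C ?g ?s) (Pr2 C ?gs ?gs))"
  let ?b = "pair C (Cmp C (Pr2 C ?g ?s) (Pr1 C ?gs ?gs)) (Cmp C (Pr2 C ?g ?s) (Pr2 C ?gs ?gs))"
  let ?f = "Cmp C (Pr1 C ?g ?s) f" and ?h = "Cmp C (Pr1 C ?g ?s) g"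
  let ?P = "\<lambda>i. list_proj C (map (sort_int M) \<Gamma>) i"
  let ?L = "map (\<lambda>i. Rdx C (pair C (Cmp C (?P i) ?f) (Cmp C (?P i) ?h)) (Eql C (sort_int M (\<Gamma> !
    i)))) [0..<length \<Gamma>]"
  let ?R = "Rdx C (pair C (Cmp C (Pr2 C ?g ?s) f) (Cmp C (Pr2 C ?g ?s) g)) (Eql C ?s)"
  have e: "Eql C ?g \<in> Prp C (Prd C ?g ?g)" "Eql C ?s \<in> Prp C (Prd C ?s ?s)"
    by (simp_all add: eql_closed)
  \<comment> \<open>The axiom \<open>eql_prd\<close> separates equality at the last sort from
    equality at the shorter context.\<close>
  have "Rdx C (pair C f g) (Eql C ?gs) =
    tensor_op L C x (Rdx C (pair C f g) (Rdx C ?a (Eql C ?g))) (Rdx C (pair C f g) (Rdx C ?b (Eql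
      C ?s)))"
    using rdx_tensor[of "pair C f g" "Rdx C ?a (Eql C ?g)" "Rdx C ?b (Eql C ?s)"] e
    by (simp add: eql_prd Let_def)
  also have "Rdx C (pair C f g) (Rdx C ?a (Eql C ?g)) = Rdx C (pair C ?f ?h) (Eql C ?g)"
    using e by (simp add: rdx_rdx)
  \<comment> \<open>The induction hypothesis is used at \<open>f\<close> and \<open>g\<close>
    followed by the first projection, which is why both are generalised.\<close>
  also have "\<dots> = list_tensor L C x ?L"
    by (rule snoc.IH) simp_all
  also have "Rdx C (pair C f g) (Rdx C ?b (Eql C ?s)) = ?R"
    using e by (simp add: rdx_rdx)
  also have "tensor_op L C x (list_tensor L C x ?L) ?R = list_tensor L C x (?L @ [?R])"
  proof (subst list_tensor_append)
    show "set ?L \<subseteq> Prp C x"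
      using sorts_obj[OF \<Gamma>(1)] subsetD[OF \<Gamma>(1) nth_mem]
      by (auto simp: ctx_int_def[of C M \<Gamma>] intro!: rdx_in eql_closed sort_obj)
  qed (use x e in simp_all)
  also have "?L @ [?R] = map (\<lambda>i. Rdx C (pair C (Cmp C (list_proj C (map (sort_int M) (\<Gamma> @ [\<sigma>])) i) f)
        (Cmp C (list_proj C (map (sort_int M) (\<Gamma> @ [\<sigma>])) i) g)) (Eql C (sort_int M ((\<Gamma> @ [\<sigma>]) !
          i)))) [0..<length (\<Gamma> @ [\<sigma>])]"
    using sorts_obj[OF \<Gamma>(1)] by (auto simp: list_proj_snoc nth_append simp flip: ctx_int_def) 
  finally show ?case by simp
qed

text \<open>\<open>rdx_eql_ctx\<close> at the two projections from a doubled context; it provides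
  \<open>on_prp_eql\<close> for \<open>int_map\<close>.\<close>

lemma fm_int_var_eqs:
  assumes "set \<Gamma> \<subseteq> Sorts Sg"
  shows "fm_int C M (\<Gamma> @ \<Gamma>) (tensor_fms L (var_eqs \<Gamma>)) =
    Rdx C (split_ctx \<Gamma> \<Gamma>) (Eql C (ctx_int C M \<Gamma>))"
proof -
  have "fm_int C M (\<Gamma> @ \<Gamma>) (tensor_fms L (var_eqs \<Gamma>)) =
    list_tensor L C (ctx_int C M (\<Gamma> @ \<Gamma>)) (map (fm_int C M (\<Gamma> @ \<Gamma>)) (var_eqs \<Gamma>))"
    using assms th.wf_var_eqs[OF assms] by (intro fm_int_tensor_fms) (auto simp: th.wf_def)
  also have "map (fm_int C M (\<Gamma> @ \<Gamma>)) (var_eqs \<Gamma>) =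
    map (\<lambda>i. Rdx C (pair C
        (Cmp C (list_proj C (map (sort_int M) \<Gamma>) i) (tms_int C M (\<Gamma> @ \<Gamma>) (vars \<Gamma>)))
        (Cmp C (list_proj C (map (sort_int M) \<Gamma>) i) (tms_int C M (\<Gamma> @ \<Gamma>) (map Var [length
          \<Gamma>..<length \<Gamma> + length \<Gamma>]))))
        (Eql C (sort_int M (\<Gamma> ! i)))) [0..<length \<Gamma>]"
    using th.wt_pr1[OF assms assms] th.wt_pr2[OF assms assms] assms
    by (auto simp: var_eqs_def th.wt_def proj_tms_int vars_def)
  also have "list_tensor L C (ctx_int C M (\<Gamma> @ \<Gamma>)) \<dots> = Rdx C (split_ctx \<Gamma> \<Gamma>) (Eql C (ctx_int C M \<Gamma>))"
    unfolding split_ctx_def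
    by (rule rdx_eql_ctx[symmetric]) (use assms pr_tms_arr[OF assms assms] in simp_all)
  finally show ?thesis .
qed

section \<open>Interpretation as a morphism of FA\<close>

lemma comparison_int_map:
  assumes "set \<Gamma> \<subseteq> Sorts Sg" "set \<Delta> \<subseteq> Sorts Sg"
  shows "comparison th.K C (int_map C M) \<Gamma> \<Delta> = split_ctx \<Gamma> \<Delta>"
  using th.wt_pr1[OF assms] th.wt_pr2[OF assms]
  by (simp add: comparison_def split_ctx_def on_arr_int_map)

lemma FA_morphism_int_map: "FA_morphism L th.K C (int_map C M)"
proof (intro FA_morphism.intro fp_functor.intro FA_morphism_axioms.intro)
  fix a b c f g x y k q xs
  show "on_obj (int_map C M) a \<in> Obj C" if "a \<in> Obj th.K"
    using that by (auto simp: in_lists_subset)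
  show "on_arr (int_map C M) f \<in> hom C (on_obj (int_map C M) a) (on_obj (int_map C M) b)"
    if "f \<in> hom th.K a b"
    using that by (auto simp: th.hom_K on_arr_int_map hom_iff th.wt_def tms_int_arr)
  show "on_arr (int_map C M) (Idn th.K a) = Idn C (on_obj (int_map C M) a)" if "a \<in> Obj th.K"
    using that by (auto simp: in_lists_subset on_arr_int_map th.wt_idn tms_int_vars)
  show "on_arr (int_map C M) (Cmp th.K g f) = Cmp C (on_arr (int_map C M) g) (on_arr (int_map C M) f)"
    if prems: "f \<in> hom th.K a b" "g \<in> hom th.K b c"
  proof -
    obtain ts us where "f = th.arr a b ts" "th.wt a b ts" "g = th.arr b c us" "th.wt b c us"
      using prems by (auto simp: th.hom_K)
    then show ?thesis
      by (simp add: th.Cmp_K on_arr_int_map th.wt_comp) (auto simp: th.wt_def intro: tms_int_subst)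
  qed
  \<comment> \<open>The empty context is interpreted by the terminal object itself, so the arrow is
    an identity.\<close>
  show "iso_arr C (bang C (on_obj (int_map C M) (Trm th.K)))"
    using iso_arrI[of "Idn C (Trm C)" "Idn C (Trm C)"] bang_unique[of "Idn C (Trm C)"] by simp
  show "iso_arr C (comparison th.K C (int_map C M) a b)" if "a \<in> Obj th.K" "b \<in> Obj th.K"
    using that by (auto simp: in_lists_subset comparison_int_map iso_split_ctx)
  show "on_prp (int_map C M) c x \<in> Prp C (on_obj (int_map C M) c)"
    if "c \<in> Obj th.K" "x \<in> Prp th.K c"
    using that by (auto simp: in_lists_subset th.Prp_K on_prp_int_map th.wf_def intro: fm_int_closed)
  show "Leq C (on_obj (int_map C M) c) (on_prp (int_map C M) c x) (on_prp (int_map C M) c y)"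
    if "c \<in> Obj th.K" "x \<in> Prp th.K c" "y \<in> Prp th.K c" "Leq th.K c x y"
    using that by (auto simp: in_lists_subset th.Prp_K on_prp_int_map th.Leq_K theory_of_Seq1)
  show "on_prp (int_map C M) a (Rdx th.K f x) = Rdx C (on_arr (int_map C M) f) (on_prp (int_map C
    M) b x)"
    if prems: "f \<in> hom th.K a b" "x \<in> Prp th.K b"
  proof -
    obtain ts where ts: "f = th.arr a b ts" "th.wt a b ts"
      using prems by (auto simp: th.hom_K)
    then obtain \<phi> where "x = th.cls b \<phi>" "th.wf b \<phi>"
      using prems by (auto simp: th.Prp_K th.wt_def)
    then show ?thesis
      using ts by (simp add: th.Rdx_K on_arr_int_map on_prp_int_map th.wf_subst)
        (auto simp: th.wt_def th.wf_def intro: fm_int_subst)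
  qed
  show "on_prp (int_map C M) c (Opr th.K c k xs) =
      Opr C (on_obj (int_map C M) c) k (map (on_prp (int_map C M) c) xs)"
    if prems: "c \<in> Obj th.K" "k \<in> Conns L" "length xs = arity L k" "set xs \<subseteq> Prp th.K c"
  proof -
    have c: "set c \<subseteq> Sorts Sg" using prems by auto
    from th.Prp_list_K[OF c prems(4)] obtain \<phi>s where
      xs: "xs = map (th.cls c) \<phi>s" "\<forall>\<phi> \<in> set \<phi>s. th.wf c \<phi>" .
    have "map (on_prp (int_map C M) c) xs = map (fm_int C M c) \<phi>s"
      using xs by (simp add: on_prp_int_map)
    moreover have "th.wf c (Conn k \<phi>s)"
      using xs prems c by (auto simp: th.wf_def)
    ultimately show ?thesis
      using xs prems c by (simp add: th.Opr_K on_prp_int_map del: map_map)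
  qed
  show "on_prp (int_map C M) (Prd th.K c c) (Eql th.K c) =
      Rdx C (comparison th.K C (int_map C M) c c) (Eql C (on_obj (int_map C M) c))"
    if "c \<in> Obj th.K"
    using that th.wf_tensor_fms[OF _ th.wf_var_eqs, of c]
    by (auto simp: in_lists_subset th.Eql_K on_prp_int_map comparison_int_map fm_int_var_eqs)
  show "on_prp (int_map C M) b (Qnt th.K q b c x) =
        Qnt C q (on_obj (int_map C M) b) (on_obj (int_map C M) c)
          (Rdx C (inv_arr C (comparison th.K C (int_map C M) b c)) (on_prp (int_map C M) (Prd th.K
            b c) x))"
    if prems: "q \<in> Quants L" "b \<in> Obj th.K" "c \<in> Obj th.K" "x \<in> Prp th.K (Prd th.K b c)"
  proof -
    have c: "set b \<subseteq> Sorts Sg" "set c \<subseteq> Sorts Sg" using prems by auto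
    then obtain \<phi> where x: "x = th.cls (b @ c) \<phi>" "th.wf (b @ c) \<phi>"
      using prems by (auto simp: th.Prp_K)
    have "th.wf b (foldr (Quant q) c \<phi>)"
      using x c prems by (auto simp: th.wf_def intro: wf_foldr_Quant)
    then show ?thesis
      using x c prems fm_int_foldr_Quant[OF c, of q \<phi>]
      by (simp add: th.Qnt_K on_prp_int_map comparison_int_map) (simp add: th.wf_def)
  qed
qed

text \<open>Faithfulness and reflection of order rest on taking the full theory: whatever
  \<open>M\<close> identifies or orders is provable in it.\<close>

theorem subprop_classifying_theory_of: "subprop_category L (classifying L Sg (theory_of L Sg C M)) C"
  unfolding subprop_category_def
proof (intro conjI exI)
  show "th.K \<in> Ob_FA L"
    by (simp add: Ob_FA_def th.FA_object_K)
  show "FA_morphism L th.K C (int_map C M)"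
    by (rule FA_morphism_int_map)
  show "faithful th.K (int_map C M)"
    unfolding faithful_def
  proof (intro ballI impI)
    fix \<Gamma> \<Delta> f g
    assume "f \<in> hom th.K \<Gamma> \<Delta>" "g \<in> hom th.K \<Gamma> \<Delta>"
    then obtain ts us where "f = th.arr \<Gamma> \<Delta> ts" "th.wt \<Gamma> \<Delta> ts" "g = th.arr \<Gamma> \<Delta> us" "th.wt \<Gamma> \<Delta> us"
      by (auto simp: th.hom_K)
    moreover assume "on_arr (int_map C M) f = on_arr (int_map C M) g"
    ultimately show "f = g"
      by (simp add: on_arr_int_map teq_iff th.arr_eq_iff)
  qed
  show "order_embedding th.K C (int_map C M)"
    unfolding order_embedding_def
  proof (intro ballI)
    fix \<Gamma> x y
    assume "\<Gamma> \<in> Obj th.K" "x \<in> Prp th.K \<Gamma>" "y \<in> Prp th.K \<Gamma>"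
    then obtain \<phi> \<psi> where "x = th.cls \<Gamma> \<phi>" "th.wf \<Gamma> \<phi>" "y = th.cls \<Gamma> \<psi>" "th.wf \<Gamma> \<psi>"
      by (auto simp: in_lists_subset th.Prp_K)
    then show "Leq C (on_obj (int_map C M) \<Gamma>) (on_prp (int_map C M) \<Gamma> x) (on_prp (int_map C M) \<Gamma> y) \<longleftrightarrow>
        Leq th.K \<Gamma> x y"
      by (simp add: on_prp_int_map th.Leq_K theory_of_Seq1) (simp add: th.wf_def)
  qed
qed

end


section \<open>The structure induced by a classifying subprop-category\<close>

locale classified_in = classified_theory L Sg T + FA_language L D + FA_morphism L
  "classifying L Sg T" D F
  for L :: "('c, 'q) language" and Sg :: "('s, 'f, 'r) signature"
    and T :: "('s, 'f, 'r, 'c, 'q) assertion set"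
    and D :: "('o, 'm, 'p, 'c, 'q) propcat"
    and F :: "('s list, 's list \<times> 's list \<times> 'f tm list set, ('s, 'f, 'r, 'c, 'q) fm set, 'o, 'm,
      'p) fa_map" +
  assumes faithful: "faithful (classifying L Sg T) F"
    and embedding: "order_embedding (classifying L Sg T) D F"
begin

section \<open>Images of contexts and left-nested products\<close>

abbreviation "FO \<equiv> on_obj F"
abbreviation "FA \<Gamma> \<Delta> ts \<equiv> on_arr F (arr \<Gamma> \<Delta> ts)"
abbreviation "FP \<Gamma> \<phi> \<equiv> on_prp F \<Gamma> (cls \<Gamma> \<phi>)"
abbreviation "sorts \<Gamma> \<equiv> map (\<lambda>\<sigma>. FO [\<sigma>]) \<Gamma>"

lemma FO_obj [simp]: "set \<Gamma> \<subseteq> Sorts Sg \<Longrightarrow> FO \<Gamma> \<in> Obj D"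
  by (rule on_obj_closed) (simp add: in_lists_subset)

lemma sorts_obj: "set \<Gamma> \<subseteq> Sorts Sg \<Longrightarrow> set (sorts \<Gamma>) \<subseteq> Obj D"
  by (auto intro!: FO_obj)

lemma FA_arr [simp]:
  assumes "wt \<Gamma> \<Delta> ts"
  shows "FA \<Gamma> \<Delta> ts \<in> Arr D" "Src D (FA \<Gamma> \<Delta> ts) = FO \<Gamma>" "Tgt D (FA \<Gamma> \<Delta> ts) = FO \<Delta>"
  using on_arr_hom[OF arr_hom[OF assms]] by (simp_all add: hom_iff)

lemma FA_cmp:
  assumes "wt \<Gamma> \<Delta> ts" "wt \<Delta> \<Theta> us"
  shows "Cmp D (FA \<Delta> \<Theta> us) (FA \<Gamma> \<Delta> ts) = FA \<Gamma> \<Theta> (map (tm_subst ts) us)"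
  using on_arr_cmp[OF arr_hom[OF assms(1)] arr_hom[OF assms(2)]] assms by (simp add: Cmp_K)

lemma FP_in: "wf \<Gamma> \<phi> \<Longrightarrow> FP \<Gamma> \<phi> \<in> Prp D (FO \<Gamma>)"
  using cls_in by (intro on_prp_closed) (auto simp: wf_def in_lists_subset)

text \<open>
  The canonical isomorphism from the image of a context to the product of the images of its sorts.
  It turns the interpretation in the structure \<open>M\<close> below into the image under \<open>F\<close>.
\<close>

definition kappa :: "'s list \<Rightarrow> 'm" where
  "kappa \<Gamma> = list_tuple D (FO \<Gamma>) (map (\<lambda>i. FA \<Gamma> [\<Gamma> ! i] [Var i]) [0..<length \<Gamma>])"

lemma wt_Var: "set \<Gamma> \<subseteq> Sorts Sg \<Longrightarrow> i < length \<Gamma> \<Longrightarrow> wt \<Gamma> [\<Gamma> ! i] [Var i]"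
  by (auto simp: wt_def wt_tm_Var)

lemma kappa_args:
  assumes "set \<Gamma> \<subseteq> Sorts Sg"
  shows "\<forall>f \<in> set (map (\<lambda>i. FA \<Gamma> [\<Gamma> ! i] [Var i]) [0..<length \<Gamma>]). f \<in> Arr D \<and> Src D f = FO \<Gamma>"
    and "map (Tgt D) (map (\<lambda>i. FA \<Gamma> [\<Gamma> ! i] [Var i]) [0..<length \<Gamma>]) = sorts \<Gamma>"
  using wt_Var[OF assms] by (auto intro!: nth_equalityI)

lemma kappa_arr [simp]:
  assumes "set \<Gamma> \<subseteq> Sorts Sg"
  shows "kappa \<Gamma> \<in> Arr D" "Src D (kappa \<Gamma>) = FO \<Gamma>" "Tgt D (kappa \<Gamma>) = list_prd D (sorts \<Gamma>)"
  using list_tuple_arr[OF FO_obj[OF assms] kappa_args(1)[OF assms]] kappa_args(2)[OF assms]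
  by (simp_all add: kappa_def)

lemma proj_kappa:
  assumes "set \<Gamma> \<subseteq> Sorts Sg" "i < length \<Gamma>"
  shows "Cmp D (list_proj D (sorts \<Gamma>) i) (kappa \<Gamma>) = FA \<Gamma> [\<Gamma> ! i] [Var i]"
  using list_proj_tuple[OF FO_obj[OF assms(1)] kappa_args(1)[OF assms(1)] _ kappa_args(2)[OF
    assms(1), symmetric], of i]
    assms(2) by (simp add: kappa_def)

lemma comparison_arr:
  assumes "set \<Gamma> \<subseteq> Sorts Sg" "set \<Delta> \<subseteq> Sorts Sg"
  shows "comparison K D F \<Gamma> \<Delta> \<in> Arr D" "Src D (comparison K D F \<Gamma> \<Delta>) = FO (\<Gamma> @ \<Delta>)"
    "Tgt D (comparison K D F \<Gamma> \<Delta>) = Prd D (FO \<Gamma>) (FO \<Delta>)"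
  using wt_pr1[OF assms] wt_pr2[OF assms] by (simp_all add: comparison_def)

text \<open>Exhibits \<open>kappa\<close> as built from the comparison arrows, which are invertible
  because \<open>F\<close> preserves products.\<close>

lemma kappa_snoc:
  assumes "set \<Gamma> \<subseteq> Sorts Sg" "\<sigma> \<in> Sorts Sg"
  shows "kappa (\<Gamma> @ [\<sigma>]) = Cmp D (map_left D (kappa \<Gamma>) (FO [\<sigma>])) (comparison K D F \<Gamma> [\<sigma>])"
proof -
  have wts: "wt (\<Gamma> @ [\<sigma>]) \<Gamma> (vars \<Gamma>)" "wt (\<Gamma> @ [\<sigma>]) [\<sigma>] [Var (length \<Gamma>)]"
    using wt_pr1[of \<Gamma> "[\<sigma>]"] wt_pr2[of \<Gamma> "[\<sigma>]"] assms by simp_all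
  have "Cmp D (kappa \<Gamma>) (FA (\<Gamma> @ [\<sigma>]) \<Gamma> (vars \<Gamma>)) =
    list_tuple D (FO (\<Gamma> @ [\<sigma>])) (map (\<lambda>i. FA (\<Gamma> @ [\<sigma>]) [(\<Gamma> @ [\<sigma>]) ! i] [Var i]) [0..<length \<Gamma>])"
    unfolding kappa_def using wts wt_Var[OF assms(1)] assms(1)
    by (subst list_tuple_cmp[OF FO_obj[OF assms(1)] kappa_args(1)[OF assms(1)]])
      (auto simp: FA_cmp vars_def nth_append intro!: arg_cong[where f="list_tuple D _"])
  then have "kappa (\<Gamma> @ [\<sigma>]) =
    pair D (Cmp D (kappa \<Gamma>) (FA (\<Gamma> @ [\<sigma>]) \<Gamma> (vars \<Gamma>))) (FA (\<Gamma> @ [\<sigma>]) [\<sigma>] [Var (length \<Gamma>)])"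
    unfolding kappa_def[of "\<Gamma> @ [\<sigma>]"] by simp
  then show ?thesis
    using assms wts by (simp add: map_left_def comparison_def)
qed

lemma iso_kappa: "set \<Gamma> \<subseteq> Sorts Sg \<Longrightarrow> iso_arr D (kappa \<Gamma>)"
proof (induction \<Gamma> rule: rev_induct)
  case Nil
  then show ?case using preserves_trm by (simp add: kappa_def)
next
  case (snoc \<sigma> \<Gamma>)
  then have "set \<Gamma> \<subseteq> Sorts Sg" "set [\<sigma>] \<subseteq> Sorts Sg" by auto
  then show ?case
    using snoc.IH comparison_arr[of \<Gamma> "[\<sigma>]"] preserves_prd[of \<Gamma> "[\<sigma>]"]
    by (subst kappa_snoc) (auto intro!: iso_cmp iso_map_left simp: in_lists_subset)
qed

text \<open>A function symbol f is sent to the image of the term f applied to the variables, a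
  relation symbol to that of its generic atom. The inverses of \<open>kappa\<close> correct the
  source, since a structure expects the left-nested product of the sorts.\<close>

definition M :: "('s, 'f, 'r, 'o, 'm, 'p) struct" where
  "M = \<lparr>
     sort_int = (\<lambda>\<sigma>. FO [\<sigma>]),
     fun_int = (\<lambda>f. Cmp D (FA (fdom Sg f) [fcod Sg f] [Fun f (vars (fdom Sg f))]) (inv_arr D
       (kappa (fdom Sg f)))),
     rel_int = (\<lambda>r. Rdx D (inv_arr D (kappa (rdom Sg r))) (FP (rdom Sg r) (Rel r (vars (rdom Sg
       r))))) \<rparr>"

lemma sort_int_M [simp]: "sort_int M = (\<lambda>\<sigma>. FO [\<sigma>])"
  and fun_int_M: "fun_int M f =
    Cmp D (FA (fdom Sg f) [fcod Sg f] [Fun f (vars (fdom Sg f))]) (inv_arr D (kappa (fdom Sg f)))"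
  and rel_int_M: "rel_int M r =
    Rdx D (inv_arr D (kappa (rdom Sg r))) (FP (rdom Sg r) (Rel r (vars (rdom Sg r))))"
  by (simp_all add: M_def)

section \<open>Interpretation in the induced structure is the image under the embedding\<close>

lemma ctx_int_M: "ctx_int D M \<Gamma> = list_prd D (sorts \<Gamma>)"
  by (simp add: ctx_int_def)

lemma wt_Fun_vars: "f \<in> Funs Sg \<Longrightarrow> wt (fdom Sg f) [fcod Sg f] [Fun f (vars (fdom Sg f))]"
  using sig wt_vars_same by (auto simp: wt_def wt_tm_Fun is_signature_def)

lemma wf_Rel_vars: "r \<in> Rels Sg \<Longrightarrow> wf (rdom Sg r) (Rel r (vars (rdom Sg r)))"
  using sig wt_vars_same by (auto simp: wf_def is_signature_def)

lemma struct_M: "is_structure Sg D M"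
  unfolding is_structure_def
proof (intro conjI ballI)
  show "sort_int M \<sigma> \<in> Obj D" if "\<sigma> \<in> Sorts Sg" for \<sigma>
    using that by simp
  show "fun_int M f \<in> hom D (ctx_int D M (fdom Sg f)) (sort_int M (fcod Sg f))" if "f \<in> Funs Sg" for f
    using wt_Fun_vars[OF that] inv_arr_props[OF iso_kappa, of "fdom Sg f"]
    by (simp add: fun_int_M hom_iff ctx_int_M wt_def)
  show "rel_int M r \<in> Prp D (ctx_int D M (rdom Sg r))" if "r \<in> Rels Sg" for r
    using FP_in[OF wf_Rel_vars[OF that]] wf_Rel_vars[OF that] inv_arr_props[OF iso_kappa, of
      "rdom Sg r"]
    by (simp add: rel_int_M ctx_int_M wf_def)
qed

sublocale st: FA_structure L D Sg M
  by unfold_locales (fact sig struct_M)+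

text \<open>Arrows into a left-nested product are determined by their components, and those of the
  composite are images of single terms because \<open>F\<close> preserves composition. The next
  facts on terms are proved through this criterion.\<close>

lemma kappa_FA:
  assumes "wt \<Gamma> \<Delta> ts" "h \<in> Arr D" "Src D h = FO \<Gamma>" "Tgt D h = list_prd D (sorts \<Delta>)"
    and "\<And>i. i < length \<Delta> \<Longrightarrow> Cmp D (list_proj D (sorts \<Delta>) i) h = FA \<Gamma> [\<Delta> ! i] [ts ! i]"
  shows "h = Cmp D (kappa \<Delta>) (FA \<Gamma> \<Delta> ts)"
proof (rule list_prd_ext[of "sorts \<Delta>"])
  have \<Delta>: "set \<Delta> \<subseteq> Sorts Sg" using assms(1) by (simp add: wt_def)
  show "set (sorts \<Delta>) \<subseteq> Obj D" by (rule sorts_obj[OF \<Delta>])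
  show "Cmp D (list_proj D (sorts \<Delta>) i) h = Cmp D (list_proj D (sorts \<Delta>) i) (Cmp D (kappa \<Delta>) (FA \<Gamma>
    \<Delta> ts))"
    if "i < length (sorts \<Delta>)" for i
  proof -
    have i: "i < length \<Delta>" using that by simp
    have "Cmp D (list_proj D (sorts \<Delta>) i) (Cmp D (kappa \<Delta>) (FA \<Gamma> \<Delta> ts)) =
      Cmp D (Cmp D (list_proj D (sorts \<Delta>) i) (kappa \<Delta>)) (FA \<Gamma> \<Delta> ts)"
      using i \<Delta> sorts_obj[OF \<Delta>] assms(1) by (subst cmp_assoc_simp) (simp_all del: cmp_assoc_simp)
    then show ?thesis
      using i \<Delta> assms(1) wt_Var[OF \<Delta> i] by (simp add: proj_kappa FA_cmp assms(5))
  qed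
qed (use assms in \<open>simp_all add: wt_def\<close>)

text \<open>A variable is a component of \<open>kappa\<close>. For a function symbol, the tuple of
  arguments passes through \<open>kappa\<close>, whose inverse in \<open>fun_int\<close> then
  cancels, leaving the substitution of the arguments into the generic term.\<close>

lemma tm_int_kappa:
  assumes "wt_tm Sg \<Gamma> t \<sigma>" "set \<Gamma> \<subseteq> Sorts Sg"
  shows "Cmp D (tm_int D M \<Gamma> t) (kappa \<Gamma>) = FA \<Gamma> [\<sigma>] [t]"
  using assms
proof (induction rule: wt_tm.induct)
  case (1 i)
  then show ?case using proj_kappa by simp
next
  case (2 f ts)
  have ts: "list_all2 (wt_tm Sg \<Gamma>) ts (fdom Sg f)"
    using 2 by (auto elim: list_all2_mono)
  then have wt: "wt \<Gamma> (fdom Sg f) ts" using 2 by (simp add: wt_def)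
  note tms = st.tms_int_arr[OF ts "2.prems"]
  have dom: "set (fdom Sg f) \<subseteq> Sorts Sg" using 2 by simp
  have "Cmp D (tms_int D M \<Gamma> ts) (kappa \<Gamma>) = Cmp D (kappa (fdom Sg f)) (FA \<Gamma> (fdom Sg f) ts)"
  proof (rule kappa_FA[OF wt])
    fix i assume i: "i < length (fdom Sg f)"
    have "Cmp D (list_proj D (sorts (fdom Sg f)) i) (Cmp D (tms_int D M \<Gamma> ts) (kappa \<Gamma>)) =
      Cmp D (Cmp D (list_proj D (sorts (fdom Sg f)) i) (tms_int D M \<Gamma> ts)) (kappa \<Gamma>)"
      using i tms "2.prems" sorts_obj[OF dom]
      by (subst cmp_assoc_simp) (simp_all add: ctx_int_M del: cmp_assoc_simp)
    also have "\<dots> = Cmp D (tm_int D M \<Gamma> (ts ! i)) (kappa \<Gamma>)"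
      using st.proj_tms_int[OF ts "2.prems" i] by simp
    also have "\<dots> = FA \<Gamma> [fdom Sg f ! i] [ts ! i]"
      using 2 i by (auto simp: list_all2_conv_all_nth)
    finally show "Cmp D (list_proj D (sorts (fdom Sg f)) i) (Cmp D (tms_int D M \<Gamma> ts) (kappa \<Gamma>)) =
      FA \<Gamma> [fdom Sg f ! i] [ts ! i]" .
  qed (use tms "2.prems" in \<open>simp_all add: ctx_int_M\<close>)
  then have "Cmp D (tm_int D M \<Gamma> (Fun f ts)) (kappa \<Gamma>) =
    Cmp D (fun_int M f) (Cmp D (kappa (fdom Sg f)) (FA \<Gamma> (fdom Sg f) ts))"
    using 2 tms by (simp add: tm_int_Fun ctx_int_M del: tm_int.simps(2))
  also have "\<dots> = Cmp D (Cmp D (fun_int M f) (kappa (fdom Sg f))) (FA \<Gamma> (fdom Sg f) ts)"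
    using 2 wt dom by (subst cmp_assoc_simp) (simp_all add: ctx_int_M del: cmp_assoc_simp)
  also have "Cmp D (fun_int M f) (kappa (fdom Sg f)) =
     FA (fdom Sg f) [fcod Sg f] [Fun f (vars (fdom Sg f))]"
    using inv_arr_props[OF iso_kappa[OF dom]] wt_Fun_vars[OF 2(1)] dom by (simp add: fun_int_M)
  also have "Cmp D \<dots> (FA \<Gamma> (fdom Sg f) ts) = FA \<Gamma> [fcod Sg f] [Fun f ts]"
    using wt wt_Fun_vars[OF 2(1)] tms_subst_vars_self[OF wt_length[OF wt]] by (simp add: FA_cmp)
  finally show ?case .
qed

lemma tms_int_kappa:
  assumes "wt \<Gamma> \<Delta> ts"
  shows "Cmp D (tms_int D M \<Gamma> ts) (kappa \<Gamma>) = Cmp D (kappa \<Delta>) (FA \<Gamma> \<Delta> ts)"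
proof (rule kappa_FA[OF assms])
  have ts: "list_all2 (wt_tm Sg \<Gamma>) ts \<Delta>" and \<Gamma>: "set \<Gamma> \<subseteq> Sorts Sg" "set \<Delta> \<subseteq> Sorts Sg"
    using assms by (simp_all add: wt_def)
  note tms = st.tms_int_arr[OF ts \<Gamma>(1)]
  show "Cmp D (tms_int D M \<Gamma> ts) (kappa \<Gamma>) \<in> Arr D" "Src D (Cmp D (tms_int D M \<Gamma> ts) (kappa \<Gamma>)) =
    FO \<Gamma>"
    "Tgt D (Cmp D (tms_int D M \<Gamma> ts) (kappa \<Gamma>)) = list_prd D (sorts \<Delta>)"
    using tms \<Gamma> by (simp_all add: ctx_int_M)
  fix i assume i: "i < length \<Delta>"
  have "Cmp D (list_proj D (sorts \<Delta>) i) (Cmp D (tms_int D M \<Gamma> ts) (kappa \<Gamma>)) =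
    Cmp D (Cmp D (list_proj D (sorts \<Delta>) i) (tms_int D M \<Gamma> ts)) (kappa \<Gamma>)"
    using i tms \<Gamma> sorts_obj[OF \<Gamma>(2)]
    by (subst cmp_assoc_simp) (simp_all add: ctx_int_M del: cmp_assoc_simp)
  also have "\<dots> = Cmp D (tm_int D M \<Gamma> (ts ! i)) (kappa \<Gamma>)"
    using st.proj_tms_int[OF ts \<Gamma>(1) i] by simp
  also have "\<dots> = FA \<Gamma> [\<Delta> ! i] [ts ! i]"
    using ts \<Gamma> i by (intro tm_int_kappa) (auto simp: list_all2_conv_all_nth)
  finally show "Cmp D (list_proj D (sorts \<Delta>) i) (Cmp D (tms_int D M \<Gamma> ts) (kappa \<Gamma>)) =
    FA \<Gamma> [\<Delta> ! i] [ts ! i]" .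
qed

lemma FP_subst:
  assumes "wt \<Gamma> \<Delta> ts" "wf \<Delta> \<phi>"
  shows "Rdx D (FA \<Gamma> \<Delta> ts) (FP \<Delta> \<phi>) = FP \<Gamma> (fm_subst (length \<Gamma>) ts \<phi>)"
  using on_prp_natural[OF arr_hom[OF assms(1)] cls_in[OF assms(2)]] assms by (simp add: Rdx_K)

lemma comparison_pair:
  assumes "wt \<Gamma> \<Delta> ts" "wt \<Gamma> \<Theta> us"
  shows "Cmp D (comparison K D F \<Delta> \<Theta>) (FA \<Gamma> (\<Delta> @ \<Theta>) (ts @ us)) = pair D (FA \<Gamma> \<Delta> ts) (FA \<Gamma> \<Theta> us)"
proof -
  have "set \<Delta> \<subseteq> Sorts Sg" "set \<Theta> \<subseteq> Sorts Sg"
    using assms by (auto simp: wt_def)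
  then show ?thesis
    using wt_append[OF assms] wt_pr1[of \<Delta> \<Theta>] wt_pr2[of \<Delta> \<Theta>] assms[THEN wt_length]
    by (simp add: comparison_def FA_cmp tms_subst_pr1 tms_subst_pr2 del: map_map)
qed

text \<open>Each case is one compatibility of \<open>F\<close>: naturality for relations,
  \<open>on_prp_eql\<close>, \<open>on_prp_opr\<close> and \<open>on_prp_qnt\<close> for the others,
  with \<open>kappa\<close> absorbing the difference between the two readings of a context.\<close>

lemma fm_int_kappa:
  assumes "wf_fm L Sg \<Gamma> \<phi>" "set \<Gamma> \<subseteq> Sorts Sg"
  shows "Rdx D (kappa \<Gamma>) (fm_int D M \<Gamma> \<phi>) = FP \<Gamma> \<phi>"
  using assms
proof (induction rule: wf_fm.induct)
  case (1 r \<Gamma> ts)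
  let ?d = "rdom Sg r"
  have d: "set ?d \<subseteq> Sorts Sg" using 1 by simp
  have wt: "wt \<Gamma> ?d ts" using 1 d by (simp add: wt_def)
  note tms = st.tms_int_arr[OF 1(2,3)]
  note inv = inv_arr_props[OF iso_kappa[OF d]]
  note P = FP_in[OF wf_Rel_vars[OF 1(1)]]
  have "Rdx D (kappa \<Gamma>) (fm_int D M \<Gamma> (Rel r ts)) =
    Rdx D (Cmp D (kappa ?d) (FA \<Gamma> ?d ts)) (rel_int M r)"
    using 1 tms st.rel_in[OF 1(1)] by (simp add: fm_int_Rel rdx_rdx tms_int_kappa[OF wt] ctx_int_M
      del: fm_int.simps(1))
  also have "\<dots> = Rdx D (Cmp D (inv_arr D (kappa ?d)) (Cmp D (kappa ?d) (FA \<Gamma> ?d ts))) (FP ?d (Rel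
    r (vars ?d)))"
    using wt d inv P by (simp add: rel_int_M rdx_rdx)
  also have "Cmp D (inv_arr D (kappa ?d)) (Cmp D (kappa ?d) (FA \<Gamma> ?d ts)) =
     Cmp D (Cmp D (inv_arr D (kappa ?d)) (kappa ?d)) (FA \<Gamma> ?d ts)"
    using wt d inv by (subst cmp_assoc_simp) (simp_all del: cmp_assoc_simp)
  also have "\<dots> = FA \<Gamma> ?d ts"
    using wt d inv by simp
  also have "Rdx D \<dots> (FP ?d (Rel r (vars ?d))) = FP \<Gamma> (Rel r ts)"
    using FP_subst[OF wt wf_Rel_vars[OF 1(1)]] tms_subst_vars_self[OF wt_length[OF wt]] by simp
  finally show ?case .
next
  case (2 \<sigma> \<Gamma> t u)
  note t = st.tm_int_arr[OF 2(2,4)] st.tm_int_arr[OF 2(3,4)]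
  have wt: "wt \<Gamma> [\<sigma>] [t]" "wt \<Gamma> [\<sigma>] [u]" using 2 by (simp_all add: wt_def)
  have \<sigma>: "set [\<sigma>] \<subseteq> Sorts Sg" using 2 by simp
  have e: "Eql D (FO [\<sigma>]) \<in> Prp D (Prd D (FO [\<sigma>]) (FO [\<sigma>]))"
    using FO_obj[OF \<sigma>] by (rule eql_closed)
  have "Rdx D (kappa \<Gamma>) (fm_int D M \<Gamma> (Equ \<sigma> t u)) =
    Rdx D (pair D (FA \<Gamma> [\<sigma>] [t]) (FA \<Gamma> [\<sigma>] [u])) (Eql D (FO [\<sigma>]))"
    using 2 t e by (simp add: rdx_rdx ctx_int_M tm_int_kappa)
  also have "\<dots> = Rdx D (FA \<Gamma> [\<sigma>, \<sigma>] [t, u]) (Rdx D (comparison K D F [\<sigma>] [\<sigma>]) (Eql D (FO [\<sigma>])))"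
    using comparison_pair[OF wt] comparison_arr[OF \<sigma> \<sigma>] e wt_append[OF wt] by (simp add: rdx_rdx)
  \<comment> \<open>Every equality formula is a substitution instance of the generic one over two
    variables, and that one is \<open>Eql\<close> at a one-sort context, where
    \<open>on_prp_eql\<close> applies.\<close>
  also have "Rdx D (comparison K D F [\<sigma>] [\<sigma>]) (Eql D (FO [\<sigma>])) = FP [\<sigma>, \<sigma>] (Equ \<sigma> (Var 0) (Var 1))"
    using on_prp_eql[of "[\<sigma>]"] \<sigma> by (simp add: Eql_K var_eqs_def)
  also have "Rdx D (FA \<Gamma> [\<sigma>, \<sigma>] [t, u]) \<dots> = FP \<Gamma> (Equ \<sigma> t u)"
    using FP_subst[of \<Gamma> "[\<sigma>, \<sigma>]" "[t, u]" "Equ \<sigma> (Var 0) (Var 1)"] wt_append[OF wt] \<sigma>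
    by (simp add: wf_def wt_tm_Var)
  finally show ?case .
next
  case (3 k \<phi>s \<Gamma>)
  have wfs: "\<forall>\<phi> \<in> set \<phi>s. wf \<Gamma> \<phi>" using 3 by (auto simp: wf_def)
  have "Rdx D (kappa \<Gamma>) (fm_int D M \<Gamma> (Conn k \<phi>s)) =
    Opr D (FO \<Gamma>) k (map (Rdx D (kappa \<Gamma>)) (map (fm_int D M \<Gamma>) \<phi>s))"
    using 3 st.fms_int_closed[of \<phi>s \<Gamma>] rdx_opr[of "kappa \<Gamma>" "FO \<Gamma>" "ctx_int D M \<Gamma>" k
      "map (fm_int D M \<Gamma>) \<phi>s"]
    by (simp add: hom_iff ctx_int_M del: map_map set_map)
  also have "map (Rdx D (kappa \<Gamma>)) (map (fm_int D M \<Gamma>) \<phi>s) = map (on_prp F \<Gamma>) (map (cls \<Gamma>) \<phi>s)"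
    using 3 by simp
  also have "Opr D (FO \<Gamma>) k \<dots> = on_prp F \<Gamma> (Opr K \<Gamma> k (map (cls \<Gamma>) \<phi>s))"
    using 3 wfs cls_in by (intro on_prp_opr[symmetric]) (auto simp: in_lists_subset)
  also have "\<dots> = FP \<Gamma> (Conn k \<phi>s)"
    using 3 wfs by (simp add: Opr_K)
  finally show ?case .
next
  case (4 q \<sigma> \<Gamma> \<phi>)
  let ?cmp = "comparison K D F \<Gamma> [\<sigma>]" and ?x = "fm_int D M (\<Gamma> @ [\<sigma>]) \<phi>"
  have \<sigma>: "set [\<sigma>] \<subseteq> Sorts Sg" "set (\<Gamma> @ [\<sigma>]) \<subseteq> Sorts Sg" using 4 by simp_all
  have wf: "wf (\<Gamma> @ [\<sigma>]) \<phi>" using 4 \<sigma> by (simp add: wf_def)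
  have iso: "iso_arr D ?cmp" using preserves_prd[of \<Gamma> "[\<sigma>]"] \<sigma> 4 by (auto simp: in_lists_subset)
  note c = comparison_arr[OF \<open>set \<Gamma> \<subseteq> Sorts Sg\<close> \<sigma>(1)] inv_arr_props[OF iso]
  have x: "?x \<in> Prp D (Prd D (ctx_int D M \<Gamma>) (FO [\<sigma>]))"
    using st.fm_int_closed[OF 4(3) \<sigma>(2)] by simp
  have "Rdx D (kappa \<Gamma>) (fm_int D M \<Gamma> (Quant q \<sigma> \<phi>)) =
    Qnt D q (FO \<Gamma>) (FO [\<sigma>]) (Rdx D (map_left D (kappa \<Gamma>) (FO [\<sigma>])) ?x)"
    using 4 x \<sigma> qnt_natural[of q "kappa \<Gamma>" "FO \<Gamma>" "ctx_int D M \<Gamma>" "FO [\<sigma>]" ?x]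
    by (simp add: hom_iff ctx_int_M)
  \<comment> \<open>The recursion for \<open>kappa\<close> solved for this factor; the inverse
    comparison arrow required by \<open>on_prp_qnt\<close> appears.\<close>
  also have "map_left D (kappa \<Gamma>) (FO [\<sigma>]) = Cmp D (kappa (\<Gamma> @ [\<sigma>])) (inv_arr D ?cmp)"
    using 4 \<sigma> c by (simp add: kappa_snoc)
  also have "Rdx D \<dots> ?x = Rdx D (inv_arr D ?cmp) (Rdx D (kappa (\<Gamma> @ [\<sigma>])) ?x)"
    using x \<sigma> c by (intro rdx_rdx[symmetric]) (simp_all flip: ctx_int_M)
  also have "Rdx D (kappa (\<Gamma> @ [\<sigma>])) ?x = FP (\<Gamma> @ [\<sigma>]) \<phi>"
    by (rule 4(4)[OF \<sigma>(2)])
  also have "Qnt D q (FO \<Gamma>) (FO [\<sigma>]) (Rdx D (inv_arr D ?cmp) (FP (\<Gamma> @ [\<sigma>]) \<phi>)) =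
    on_prp F \<Gamma> (Qnt K q \<Gamma> [\<sigma>] (cls (\<Gamma> @ [\<sigma>]) \<phi>))"
    using on_prp_qnt[of q \<Gamma> "[\<sigma>]" "cls (\<Gamma> @ [\<sigma>]) \<phi>"] 4 \<sigma> cls_in[OF wf] by (simp add: in_lists_subset)
  also have "\<dots> = FP \<Gamma> (Quant q \<sigma> \<phi>)"
    using Qnt_K[of \<Gamma> "[\<sigma>]" q \<phi>] 4 \<sigma> wf by simp
  finally show ?case .
qed

lemma theory_of_M: "theory_of L Sg D M = T"
proof (rule set_eqI)
  fix a
  show "a \<in> theory_of L Sg D M \<longleftrightarrow> a \<in> T"
  proof (cases a)
    case (Eqn \<Gamma> \<sigma> t u)
    show ?thesis
    proof (cases "set \<Gamma> \<subseteq> Sorts Sg \<and> wt_tm Sg \<Gamma> t \<sigma> \<and> wt_tm Sg \<Gamma> u \<sigma>")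
      case True
      then have \<Gamma>: "set \<Gamma> \<subseteq> Sorts Sg" and t: "wt_tm Sg \<Gamma> t \<sigma>" "wt_tm Sg \<Gamma> u \<sigma>" by auto
      have wt: "wt \<Gamma> [\<sigma>] [t]" "wt \<Gamma> [\<sigma>] [u]"
        using \<Gamma> t st.wt_tm_sort[OF t(1)] by (simp_all add: wt_def)
      note ts = st.tm_int_arr[OF t(1) \<Gamma>] st.tm_int_arr[OF t(2) \<Gamma>]
      note inv = inv_arr_props[OF iso_kappa[OF \<Gamma>]]
      \<comment> \<open>\<open>kappa\<close> is invertible, hence can be cancelled; faithfulness
        then brings the equation back to the classifying category.\<close>
      have "tm_int D M \<Gamma> t = tm_int D M \<Gamma> u \<longleftrightarrow>
        Cmp D (tm_int D M \<Gamma> t) (kappa \<Gamma>) = Cmp D (tm_int D M \<Gamma> u) (kappa \<Gamma>)"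
      proof
        assume "Cmp D (tm_int D M \<Gamma> t) (kappa \<Gamma>) = Cmp D (tm_int D M \<Gamma> u) (kappa \<Gamma>)"
        then have "Cmp D (Cmp D (tm_int D M \<Gamma> t) (kappa \<Gamma>)) (inv_arr D (kappa \<Gamma>)) =
          Cmp D (Cmp D (tm_int D M \<Gamma> u) (kappa \<Gamma>)) (inv_arr D (kappa \<Gamma>))" by simp
        then show "tm_int D M \<Gamma> t = tm_int D M \<Gamma> u"
          using ts inv \<Gamma> by (simp add: ctx_int_M)
      qed simp
      also have "\<dots> \<longleftrightarrow> FA \<Gamma> [\<sigma>] [t] = FA \<Gamma> [\<sigma>] [u]"
        using t \<Gamma> by (simp add: tm_int_kappa)
      also have "\<dots> \<longleftrightarrow> arr \<Gamma> [\<sigma>] [t] = arr \<Gamma> [\<sigma>] [u]"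
      proof -
        have "\<Gamma> \<in> Obj K" "[\<sigma>] \<in> Obj K"
          using wt(1) by (auto simp: wt_def)
        then show ?thesis
          using faithful arr_hom[OF wt(1)] arr_hom[OF wt(2)] unfolding faithful_def by metis
      qed
      also have "\<dots> \<longleftrightarrow> a \<in> T"
        using wt \<Gamma> by (simp add: arr_eq_iff teq_def Eqn)
      finally show ?thesis
        using \<Gamma> t by (simp add: Eqn st.theory_of_Eqn)
    qed (use wf_Eqn[of \<Gamma> \<sigma> t u] Eqn in \<open>auto simp: st.theory_of_Eqn\<close>)
  next
    case (Seq \<Gamma> \<Phi> \<phi>)
    show ?thesis
    proof (cases "set \<Gamma> \<subseteq> Sorts Sg \<and> (\<forall>\<psi> \<in> set \<Phi>. wf_fm L Sg \<Gamma> \<psi>) \<and> wf_fm L Sg \<Gamma> \<phi>")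
      case True
      then have \<Gamma>: "set \<Gamma> \<subseteq> Sorts Sg" and wfs: "\<forall>\<psi> \<in> set \<Phi>. wf_fm L Sg \<Gamma> \<psi>" "wf_fm L Sg \<Gamma> \<phi>" by auto
      have wf: "wf \<Gamma> (tensor_fms L \<Phi>)" "wf \<Gamma> \<phi>"
        using \<Gamma> wfs by (auto simp: wf_def intro!: wf_tensor_fms[unfolded wf_def, THEN conjunct2])
      then have wf': "wf_fm L Sg \<Gamma> (tensor_fms L \<Phi>)" by (simp add: wf_def)
      \<comment> \<open>The antecedent is folded into one formula, since the embedding speaks only
        of the order between single elements.\<close>
      have "a \<in> theory_of L Sg D M \<longleftrightarrow> Leq D (ctx_int D M \<Gamma>) (fm_int D M \<Gamma> (tensor_fms L \<Phi>)) (fm_int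
        D M \<Gamma> \<phi>)"
        using \<Gamma> wfs by (simp add: Seq st.theory_of_Seq st.fm_int_tensor_fms)
      also have "\<dots> \<longleftrightarrow> Leq D (FO \<Gamma>) (FP \<Gamma> (tensor_fms L \<Phi>)) (FP \<Gamma> \<phi>)"
        using rdx_iso_leq[OF iso_kappa[OF \<Gamma>], of "fm_int D M \<Gamma> (tensor_fms L \<Phi>)" "fm_int D M \<Gamma> \<phi>"]
          st.fm_int_closed[OF wf' \<Gamma>] st.fm_int_closed[OF wfs(2) \<Gamma>]
          fm_int_kappa[OF wf' \<Gamma>] fm_int_kappa[OF wfs(2) \<Gamma>] \<Gamma> by (simp add: ctx_int_M)
      also have "\<dots> \<longleftrightarrow> Leq K \<Gamma> (cls \<Gamma> (tensor_fms L \<Phi>)) (cls \<Gamma> \<phi>)"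
        using embedding \<Gamma> wf cls_in by (simp add: order_embedding_def in_lists_subset)
      also have "\<dots> \<longleftrightarrow> Seq \<Gamma> [tensor_fms L \<Phi>] \<phi> \<in> T"
        using wf by (rule Leq_K)
      also have "\<dots> \<longleftrightarrow> a \<in> T"
        using Seq_tensor_fms_iff[of \<Gamma> "[]" \<Phi> \<phi>] by (simp add: Seq)
      finally show ?thesis .
    qed (use wf_Seq[of \<Gamma> \<Phi> \<phi>] Seq in \<open>auto simp: st.theory_of_Seq\<close>)
  qed
qed

end

text \<open>Trades embeddings for structures. It is used in both directions: for \<open>D\<close>,
  and to pass between theories and embeddings into a product.\<close>

theorem subprop_classifying_iff_theory_of:
  assumes "is_language L" "is_signature Sg" "D \<in> Ob_FA L"
  shows "Lm_theory L Sg T \<and> subprop_category L (classifying L Sg T) D \<longleftrightarrow>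
    (\<exists>M. is_structure Sg D M \<and> theory_of L Sg D M = T)"
proof
  assume T: "Lm_theory L Sg T \<and> subprop_category L (classifying L Sg T) D"
  then obtain F where F: "FA_morphism L (classifying L Sg T) D F"
    "faithful (classifying L Sg T) F" "order_embedding (classifying L Sg T) D F"
    by (auto simp: subprop_category_def)
  interpret classified_in L Sg T D F
    using assms T F
    by (auto simp: Ob_FA_def intro!: classified_in.intro classified_theory.intro FA_language.intro
        FA_language_axioms.intro classified_in_axioms.intro)
  show "\<exists>M. is_structure Sg D M \<and> theory_of L Sg D M = T"
    using struct_M theory_of_M by blast
next
  assume "\<exists>M. is_structure Sg D M \<and> theory_of L Sg D M = T"
  then obtain M where M: "is_structure Sg D M" "T = theory_of L Sg D M" by blast
  interpret FA_structure L D Sg M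
    using assms M
    by (auto simp: Ob_FA_def intro!: FA_structure.intro FA_language.intro FA_language_axioms.intro
        FA_structure_axioms.intro)
  show "Lm_theory L Sg T \<and> subprop_category L (classifying L Sg T) D"
    unfolding M using Lm_theory_theory_of subprop_classifying_theory_of by simp
qed


section \<open>Products\<close>

locale FA_family =
  fixes L :: "('c, 'q) language" and I :: "'i set" and C :: "'i \<Rightarrow> ('o, 'm, 'p, 'c, 'q) propcat"
  assumes lang: "is_language L" and obj: "i \<in> I \<Longrightarrow> FA_object L (C i)"
begin

abbreviation "P \<equiv> product_propcat I C"

lemma fp: "i \<in> I \<Longrightarrow> fp_category (C i)" and pc: "i \<in> I \<Longrightarrow> prop_category (C i)"
  using obj by (auto simp: FA_object_def prop_category_def)

section \<open>Finite products in a product of prop-categories\<close>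

lemma product_sel:
  "a \<in> Obj P \<longleftrightarrow> a \<in> extensional I \<and> (\<forall>i\<in>I. a i \<in> Obj (C i))"
  "f \<in> Arr P \<longleftrightarrow> f \<in> extensional I \<and> (\<forall>i\<in>I. f i \<in> Arr (C i))"
  "x \<in> Prp P a \<longleftrightarrow> x \<in> extensional I \<and> (\<forall>i\<in>I. x i \<in> Prp (C i) (a i))"
  by (auto simp: product_propcat_def PiE_iff)

lemma product_app:
  assumes "i \<in> I"
  shows "Src P f i = Src (C i) (f i)" "Tgt P f i = Tgt (C i) (f i)"
    "Idn P a i = Idn (C i) (a i)" "Cmp P g f i = Cmp (C i) (g i) (f i)"
    "Trm P i = Trm (C i)" "Prd P a b i = Prd (C i) (a i) (b i)"
    "Pr1 P a b i = Pr1 (C i) (a i) (b i)" "Pr2 P a b i = Pr2 (C i) (a i) (b i)"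
    "Rdx P f x i = Rdx (C i) (f i) (x i)"
    "Opr P a k xs i = Opr (C i) (a i) k (map (\<lambda>x. x i) xs)"
    "Eql P a i = Eql (C i) (a i)" "Qnt P q a b x i = Qnt (C i) q (a i) (b i) (x i)"
  using assms by (simp_all add: product_propcat_def)

lemma Leq_P: "Leq P a x y \<longleftrightarrow> (\<forall>i\<in>I. Leq (C i) (a i) (x i) (y i))"
  by (simp add: product_propcat_def)

lemma product_ext [simp]:
  "Src P f \<in> extensional I" "Tgt P f \<in> extensional I" "Idn P a \<in> extensional I"
  "Cmp P g f \<in> extensional I" "Trm P \<in> extensional I" "Prd P a b \<in> extensional I"
  "Pr1 P a b \<in> extensional I" "Pr2 P a b \<in> extensional I" "Rdx P f x \<in> extensional I"
  "Opr P a k xs \<in> extensional I" "Eql P a \<in> extensional I" "Qnt P q a b x \<in> extensional I"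
  by (simp_all add: product_propcat_def)

lemma ext_iff: "f \<in> extensional I \<Longrightarrow> g \<in> extensional I \<Longrightarrow> f = g \<longleftrightarrow> (\<forall>i\<in>I. f i = g i)"
  by (auto intro: extensionalityI)

text \<open>Source and target have to be extensional as well, because \<open>Src\<close> and
  \<open>Tgt\<close> of the product return functions restricted to \<open>I\<close>.\<close>

lemma hom_P:
  "f \<in> hom P a b \<longleftrightarrow> f \<in> extensional I \<and> a \<in> extensional I \<and> b \<in> extensional I \<and>
    (\<forall>i\<in>I. f i \<in> hom (C i) (a i) (b i))"
proof -
  have "f \<in> hom P a b \<longleftrightarrow> f \<in> extensional I \<and> (\<forall>i\<in>I. f i \<in> Arr (C i)) \<and>
    a \<in> extensional I \<and> b \<in> extensional I \<and> Src P f = a \<and> Tgt P f = b"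
    by (auto simp: hom_def product_sel)
  then show ?thesis
    by (auto simp: hom_def ext_iff product_app)
qed

lemma fp_category_P: "fp_category P"
proof
  fix f g h a b c d
  show "Src P f \<in> Obj P" "Tgt P f \<in> Obj P" if "f \<in> Arr P"
    using that fp fp_category.src_obj fp_category.tgt_obj
    by (fastforce simp: product_sel product_app)+
  show "Idn P a \<in> hom P a a" if "a \<in> Obj P"
    using that by (auto simp: product_sel hom_P product_app intro: fp fp_category.idn_hom)
  show "Cmp P g f \<in> hom P a c" if "f \<in> hom P a b" "g \<in> hom P b c"
    using that by (auto simp: hom_P product_app intro: fp fp_category.cmp_hom)
  show "Cmp P f (Idn P a) = f" "Cmp P (Idn P b) f = f" if "f \<in> hom P a b"
    using that by (auto simp: hom_P ext_iff product_app
      intro: fp fp_category.cmp_idn_right fp_category.cmp_idn_left)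
  show "Cmp P h (Cmp P g f) = Cmp P (Cmp P h g) f"
    if "f \<in> hom P a b" "g \<in> hom P b c" "h \<in> hom P c d"
    using that by (auto simp: hom_P ext_iff product_app intro: fp fp_category.cmp_assoc)
  show "Trm P \<in> Obj P"
    by (auto simp: product_sel product_app intro: fp fp_category.trm_obj)
  show "\<exists>!h. h \<in> hom P a (Trm P)" if "a \<in> Obj P"
  proof (rule ex1I[of _ "\<lambda>i\<in>I. bang (C i) (a i)"])
    show "(\<lambda>i\<in>I. bang (C i) (a i)) \<in> hom P a (Trm P)"
      using that by (auto simp: hom_P product_sel product_app intro: fp fp_category.bang_hom)
    fix h assume "h \<in> hom P a (Trm P)"
    then show "h = (\<lambda>i\<in>I. bang (C i) (a i))"
      using that by (auto simp: hom_P product_sel product_app ext_iff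
        intro: fp fp_category.trm_ext fp_category.bang_hom)
  qed
  show "Prd P a b \<in> Obj P" if "a \<in> Obj P" "b \<in> Obj P"
    using that by (auto simp: product_sel product_app intro: fp fp_category.prd_obj)
  show "Pr1 P a b \<in> hom P (Prd P a b) a" "Pr2 P a b \<in> hom P (Prd P a b) b"
    if "a \<in> Obj P" "b \<in> Obj P"
    using that by (auto simp: product_sel product_app hom_P
      intro: fp fp_category.pr1_hom fp_category.pr2_hom)
  show "\<exists>!h. h \<in> hom P d (Prd P a b) \<and> Cmp P (Pr1 P a b) h = f \<and> Cmp P (Pr2 P a b) h = g"
    if fg: "f \<in> hom P d a" "g \<in> hom P d b"
  proof -
    have *: "\<exists>!h. h \<in> hom (C i) (d i) (Prd (C i) (a i) (b i)) \<and>
        Cmp (C i) (Pr1 (C i) (a i) (b i)) h = f i \<and> Cmp (C i) (Pr2 (C i) (a i) (b i)) h = g i"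
      if "i \<in> I" for i
      using fg that by (intro fp_category.prd_universal fp) (auto simp: hom_P)
    then obtain h where h: "\<forall>i\<in>I. h i \<in> hom (C i) (d i) (Prd (C i) (a i) (b i)) \<and>
        Cmp (C i) (Pr1 (C i) (a i) (b i)) (h i) = f i \<and> Cmp (C i) (Pr2 (C i) (a i) (b i)) (h i) = g i"
      by metis
    \<comment> \<open>The componentwise mediating arrows are restricted to \<open>I\<close> to lie
      in the carrier; extensionality then makes the family unique.\<close>
    show ?thesis
    proof (rule ex1I[of _ "restrict h I"])
      show "restrict h I \<in> hom P d (Prd P a b) \<and>
        Cmp P (Pr1 P a b) (restrict h I) = f \<and> Cmp P (Pr2 P a b) (restrict h I) = g"
        using h fg by (auto simp: hom_P product_app ext_iff)
      fix k assume "k \<in> hom P d (Prd P a b) \<and> Cmp P (Pr1 P a b) k = f \<and> Cmp P (Pr2 P a b) k = g"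
      then have k: "k \<in> extensional I" "\<forall>i\<in>I. k i \<in> hom (C i) (d i) (Prd (C i) (a i) (b i)) \<and>
        Cmp (C i) (Pr1 (C i) (a i) (b i)) (k i) = f i \<and> Cmp (C i) (Pr2 (C i) (a i) (b i)) (k i) = g i"
        using fg by (auto simp: hom_P product_app ext_iff)
      have "k i = h i" if "i \<in> I" for i
        using *[OF that] h k(2) that by blast
      then show "k = restrict h I"
        using k(1) by (simp add: ext_iff)
    qed
  qed
qed

sublocale fp_P: fp_category P
  by (rule fp_category_P)

lemma bang_P: "a \<in> Obj P \<Longrightarrow> i \<in> I \<Longrightarrow> bang P a i = bang (C i) (a i)"
  using fp_P.bang_hom[of a] fp_category.trm_ext[OF fp] fp_category.bang_hom[OF fp]
  by (fastforce simp: hom_P product_sel product_app)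

text \<open>\<open>pair\<close> is a definite description and does not unfold componentwise; each
  component satisfies the universal property in its own category, and uniqueness there identifies
  it.\<close>

lemma pair_P:
  assumes "f \<in> hom P d a" "g \<in> hom P d b" "i \<in> I"
  shows "pair P f g i = pair (C i) (f i) (g i)"
proof -
  interpret Ci: fp_category "C i" by (rule fp[OF assms(3)])
  have "pair P f g \<in> hom P d (Prd P a b)" "Cmp P (Pr1 P a b) (pair P f g) = f"
    "Cmp P (Pr2 P a b) (pair P f g) = g"
    using assms by (auto simp: fp_P.hom_iff)
  then have *: "pair P f g i \<in> hom (C i) (d i) (Prd (C i) (a i) (b i))"
    "Cmp (C i) (Pr1 (C i) (a i) (b i)) (pair P f g i) = f i"
    "Cmp (C i) (Pr2 (C i) (a i) (b i)) (pair P f g i) = g i"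
    using assms by (auto simp: hom_P ext_iff product_app)
  have "f i \<in> hom (C i) (d i) (a i)" "g i \<in> hom (C i) (d i) (b i)"
    using assms by (auto simp: hom_P)
  then have "a i \<in> Obj (C i)" "b i \<in> Obj (C i)"
    using Ci.tgt_obj[of "f i"] Ci.tgt_obj[of "g i"] by (simp_all add: Ci.hom_iff)
  then show ?thesis
    using Ci.pair_eta[of "pair P f g i" "a i" "b i"] * by (simp add: Ci.hom_iff)
qed

lemma map_left_P:
  assumes "f \<in> hom P a b" "c \<in> Obj P" "i \<in> I"
  shows "map_left P f c i = map_left (C i) (f i) (c i)"
proof -
  have "Src P f = a" using assms by (simp add: fp_P.hom_iff)
  then show ?thesis
    using assms unfolding map_left_def
    by (subst pair_P[of _ "Prd P a c" b _ c]) (auto simp: fp_P.hom_iff product_app)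
qed

lemma assoc_arr_P:
  assumes "b \<in> Obj P" "c \<in> Obj P" "d \<in> Obj P" "i \<in> I"
  shows "assoc_arr P b c d i = assoc_arr (C i) (b i) (c i) (d i)"
  using assms unfolding assoc_arr_def Let_def
  by (subst pair_P[of _ "Prd P b (Prd P c d)" "Prd P b c" _ d])
    (auto simp: fp_P.hom_iff product_app pair_P[of _ "Prd P b (Prd P c d)" b _ c])

section \<open>Order, connectives, equality and quantifiers of a product\<close>

lemma prop_category_P: "prop_category P"
proof
  fix f g a b c x y z
  show "Leq P c x x" if "c \<in> Obj P" "x \<in> Prp P c"
    using that by (auto simp: product_sel Leq_P intro: pc prop_category.leq_refl)
  show "Leq P c x z" if "c \<in> Obj P" "x \<in> Prp P c" "y \<in> Prp P c" "z \<in> Prp P c" "Leq P c x y"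
    "Leq P c y z"
    unfolding Leq_P
  proof
    fix i assume "i \<in> I"
    then show "Leq (C i) (c i) (x i) (z i)"
      using that prop_category.leq_trans[OF pc, of i "c i" "x i" "y i" "z i"]
      by (simp add: product_sel Leq_P)
  qed
  show "x = y" if "c \<in> Obj P" "x \<in> Prp P c" "y \<in> Prp P c" "Leq P c x y" "Leq P c y x"
    using that by (auto simp: product_sel Leq_P ext_iff intro: pc prop_category.leq_antisym)
  show "Rdx P f x \<in> Prp P a" if "f \<in> hom P a b" "x \<in> Prp P b"
    using that by (auto simp: hom_P product_sel product_app intro: pc prop_category.rdx_closed)
  show "Leq P a (Rdx P f x) (Rdx P f y)"
    if "f \<in> hom P a b" "x \<in> Prp P b" "y \<in> Prp P b" "Leq P b x y"
    using that by (auto simp: hom_P product_sel product_app Leq_P intro: pc prop_category.rdx_mono)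
  show "Rdx P (Idn P c) x = x" if "c \<in> Obj P" "x \<in> Prp P c"
    using that by (auto simp: product_sel product_app ext_iff intro: pc prop_category.rdx_idn)
  show "Rdx P (Cmp P g f) x = Rdx P f (Rdx P g x)"
    if "f \<in> hom P a b" "g \<in> hom P b c" "x \<in> Prp P c"
    using that by (auto simp: hom_P product_sel product_app ext_iff intro: pc prop_category.rdx_cmp)
qed

lemma FA_object_P: "FA_object L P"
proof (intro FA_object.intro prop_category_P FA_object_axioms.intro)
  fix f a b b' c d x y z k q xs x' y'
  show "Opr P c k xs \<in> Prp P c"
    if "c \<in> Obj P" "k \<in> Conns L" "length xs = arity L k" "set xs \<subseteq> Prp P c"
    using that by (auto simp: product_sel product_app subset_eq intro!: FA_object.opr_closed[OF obj])
  show "Rdx P f (Opr P b k xs) = Opr P a k (map (Rdx P f) xs)"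
    if "f \<in> hom P a b" "k \<in> Conns L" "length xs = arity L k" "set xs \<subseteq> Prp P b"
    using that
    by (auto simp: hom_P product_sel product_app subset_eq ext_iff o_def
        FA_object.rdx_opr[OF obj, where a="a _" and b="b _"])
  show "tensor_op L P c (tensor_op L P c x y) z = tensor_op L P c x (tensor_op L P c y z)"
    if "c \<in> Obj P" "x \<in> Prp P c" "y \<in> Prp P c" "z \<in> Prp P c"
    using that by (auto simp: product_sel product_app ext_iff intro: FA_object.tensor_assoc[OF obj])
  show "tensor_op L P c (unit_op L P c) x = x" "tensor_op L P c x (unit_op L P c) = x"
    if "c \<in> Obj P" "x \<in> Prp P c"
    using that by (auto simp: product_sel product_app ext_iff
      intro: FA_object.tensor_unit_left[OF obj] FA_object.tensor_unit_right[OF obj])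
  show "Leq P c (tensor_op L P c x y) (tensor_op L P c x' y')"
    if "c \<in> Obj P" "x \<in> Prp P c" "x' \<in> Prp P c" "y \<in> Prp P c" "y' \<in> Prp P c"
      "Leq P c x x'" "Leq P c y y'"
    using that by (auto simp: product_sel product_app Leq_P intro: FA_object.tensor_mono[OF obj])
  show "Eql P c \<in> Prp P (Prd P c c)" if "c \<in> Obj P"
    using that by (auto simp: product_sel product_app intro: FA_object.eql_closed[OF obj])
  show "Eql P (Trm P) = unit_op L P (Prd P (Trm P) (Trm P))"
    by (auto simp: product_app ext_iff intro: FA_object.eql_trm[OF obj])
  show "Eql P (Prd P c d) =
      (let cd = Prd P c d; p1 = Pr1 P cd cd; p2 = Pr2 P cd cd
       in tensor_op L P (Prd P cd cd)
            (Rdx P (pair P (Cmp P (Pr1 P c d) p1) (Cmp P (Pr1 P c d) p2)) (Eql P c))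
            (Rdx P (pair P (Cmp P (Pr2 P c d) p1) (Cmp P (Pr2 P c d) p2)) (Eql P d)))"
    if cd: "c \<in> Obj P" "d \<in> Obj P"
  proof -
    let ?cd = "Prd P c d"
    have "pair P (Cmp P (Pr1 P c d) (Pr1 P ?cd ?cd)) (Cmp P (Pr1 P c d) (Pr2 P ?cd ?cd)) i =
        pair (C i) (Cmp P (Pr1 P c d) (Pr1 P ?cd ?cd) i) (Cmp P (Pr1 P c d) (Pr2 P ?cd ?cd) i)"
      "pair P (Cmp P (Pr2 P c d) (Pr1 P ?cd ?cd)) (Cmp P (Pr2 P c d) (Pr2 P ?cd ?cd)) i =
        pair (C i) (Cmp P (Pr2 P c d) (Pr1 P ?cd ?cd) i) (Cmp P (Pr2 P c d) (Pr2 P ?cd ?cd) i)"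
      if "i \<in> I" for i
      using cd that by (auto intro!: pair_P[of _ "Prd P ?cd ?cd"] simp: fp_P.hom_iff)
    then show ?thesis
      using cd FA_object.eql_prd[OF obj] unfolding Let_def
      by (auto simp: product_sel product_app ext_iff)
  qed
  show "Qnt P q b c x \<in> Prp P b" if "q \<in> Quants L" "b \<in> Obj P" "c \<in> Obj P" "x \<in> Prp P (Prd P b c)"
    using that by (auto simp: product_sel product_app intro: FA_object.qnt_closed[OF obj])
  show "Rdx P f (Qnt P q b c x) = Qnt P q b' c (Rdx P (map_left P f c) x)"
    if "q \<in> Quants L" "f \<in> hom P b' b" "c \<in> Obj P" "x \<in> Prp P (Prd P b c)"
    using that map_left_P[OF that(2,3)]
    by (auto simp: product_sel product_app ext_iff hom_P intro: FA_object.qnt_natural[OF obj])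
  show "Qnt P q b (Trm P) (Rdx P (Pr1 P b (Trm P)) x) = x"
    if "q \<in> Quants L" "b \<in> Obj P" "x \<in> Prp P b"
    using that by (auto simp: product_sel product_app ext_iff intro: FA_object.qnt_trm[OF obj])
  show "Qnt P q b (Prd P c d) (Rdx P (assoc_arr P b c d) x) = Qnt P q b c (Qnt P q (Prd P b c) d x)"
    if "q \<in> Quants L" "b \<in> Obj P" "c \<in> Obj P" "d \<in> Obj P" "x \<in> Prp P (Prd P (Prd P b c) d)"
    using that assoc_arr_P[OF that(2-4)]
    by (auto simp: product_sel product_app ext_iff intro: FA_object.qnt_prd[OF obj])
qed

end

section \<open>Structures in a product and their components\<close>

definition component :: "('s, 'f, 'r, 'i \<Rightarrow> 'o, 'i \<Rightarrow> 'm, 'i \<Rightarrow> 'p) struct \<Rightarrow> 'i \<Rightarrow> ('s, 'f, 'r, 'o,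
  'm, 'p) struct"
  where
  "component M i = \<lparr>sort_int = (\<lambda>\<sigma>. sort_int M \<sigma> i), fun_int = (\<lambda>f. fun_int M f i), rel_int =
    (\<lambda>r. rel_int M r i)\<rparr>"

definition tuple_struct ::
  "'i set \<Rightarrow> ('i \<Rightarrow> ('s, 'f, 'r, 'o, 'm, 'p) struct) \<Rightarrow> ('s, 'f, 'r, 'i \<Rightarrow> 'o, 'i \<Rightarrow> 'm, 'i \<Rightarrow> 'p) struct"
  where
  "tuple_struct I N = \<lparr>sort_int = (\<lambda>\<sigma>. \<lambda>i\<in>I. sort_int (N i) \<sigma>),
     fun_int = (\<lambda>f. \<lambda>i\<in>I. fun_int (N i) f), rel_int = (\<lambda>r. \<lambda>i\<in>I. rel_int (N i) r)\<rparr>"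

lemma component_sel [simp]:
  "sort_int (component M i) = (\<lambda>\<sigma>. sort_int M \<sigma> i)"
  "fun_int (component M i) = (\<lambda>f. fun_int M f i)"
  "rel_int (component M i) = (\<lambda>r. rel_int M r i)"
  by (simp_all add: component_def)

lemma component_tuple_struct: "i \<in> I \<Longrightarrow> component (tuple_struct I N) i = N i"
  by (simp add: component_def tuple_struct_def)

context FA_family
begin

lemma list_prd_P: "i \<in> I \<Longrightarrow> list_prd P as i = list_prd (C i) (map (\<lambda>a. a i) as)"
  by (induction as rule: rev_induct) (simp_all add: product_app)

lemma list_prd_P_ext [simp]: "list_prd P as \<in> extensional I"
  by (cases as rule: rev_cases) simp_all

lemma ctx_int_P_ext [simp]: "ctx_int P M \<Gamma> \<in> extensional I"
  by (simp add: ctx_int_def)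

lemma ctx_int_P: "i \<in> I \<Longrightarrow> ctx_int P M \<Gamma> i = ctx_int (C i) (component M i) \<Gamma>"
  by (simp add: ctx_int_def list_prd_P o_def)

lemma list_proj_P:
  "i \<in> I \<Longrightarrow> n < length as \<Longrightarrow> list_proj P as n i = list_proj (C i) (map (\<lambda>a. a i) as) n"
  by (induction as rule: rev_induct) (auto simp: list_proj_snoc product_app list_prd_P)

lemma list_tuple_P:
  assumes "i \<in> I" "x \<in> Obj P" "\<forall>f \<in> set fs. f \<in> Arr P \<and> Src P f = x"
  shows "list_tuple P x fs i = list_tuple (C i) (x i) (map (\<lambda>f. f i) fs)"
  using assms(3)
proof (induction fs rule: rev_induct)
  case Nil
  then show ?case using assms by (simp add: bang_P)
next
  case (snoc f fs)
  then have "list_tuple P x fs \<in> hom P x (list_prd P (map (Tgt P) fs))" "f \<in> hom P x (Tgt P f)"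
    using fp_P.list_tuple_arr[OF assms(2), of fs] by (auto simp: fp_P.hom_iff)
  from pair_P[OF this assms(1)] show ?case
    using snoc by simp
qed

text \<open>Carriers of a product consist of extensional functions, hence the extra conditions.
  Codomains of function symbols are listed separately since \<open>Sg\<close> is arbitrary here and
  they are not known to be among its sorts.\<close>

lemma structure_P_iff:
  "is_structure Sg P M \<longleftrightarrow>
    (\<forall>\<sigma> \<in> Sorts Sg. sort_int M \<sigma> \<in> extensional I) \<and> (\<forall>f \<in> Funs Sg. fun_int M f \<in> extensional I \<and>
      sort_int M (fcod Sg f) \<in> extensional I) \<and>
    (\<forall>r \<in> Rels Sg. rel_int M r \<in> extensional I) \<and> (\<forall>i\<in>I. is_structure Sg (C i) (component M i))"
  unfolding is_structure_def
  by (auto simp: product_sel hom_P ctx_int_P)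

end

locale structure_in_product = FA_family L I C
  for L :: "('c, 'q) language" and I :: "'i set" and C :: "'i \<Rightarrow> ('o, 'm, 'p, 'c, 'q) propcat" +
  fixes Sg :: "('s, 'f, 'r) signature" and M :: "('s, 'f, 'r, 'i \<Rightarrow> 'o, 'i \<Rightarrow> 'm, 'i \<Rightarrow> 'p) struct"
  assumes sig: "is_signature Sg" and struct: "is_structure Sg P M"
begin

sublocale FA_structure L P Sg M
  by (intro FA_structure.intro FA_language.intro FA_language_axioms.intro FA_structure_axioms.intro
    FA_object_P lang sig struct)

lemma tm_int_P:
  assumes "wt_tm Sg \<Gamma> t \<sigma>" "set \<Gamma> \<subseteq> Sorts Sg" "i \<in> I"
  shows "tm_int P M \<Gamma> t i = tm_int (C i) (component M i) \<Gamma> t"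
  using assms
proof (induction rule: wt_tm.induct)
  case (1 n)
  then show ?case by (simp add: list_proj_P o_def)
next
  case (2 f ts)
  have ts: "list_all2 (wt_tm Sg \<Gamma>) ts (fdom Sg f)"
    using 2 by (auto elim: list_all2_mono)
  have "map (\<lambda>g. g i) (map (tm_int P M \<Gamma>) ts) = map (tm_int (C i) (component M i) \<Gamma>) ts"
    using 2 by (auto simp: list_all2_conv_all_nth in_set_conv_nth)
  then show ?case
    using list_tuple_P[OF 2(4) ctx_obj[OF 2(3)] tms_int_args(1)[OF ts 2(3)]] 2(4)
    by (simp add: product_app ctx_int_P del: map_map)
qed

lemma tms_int_P:
  assumes "list_all2 (wt_tm Sg \<Gamma>) ts \<Delta>" "set \<Gamma> \<subseteq> Sorts Sg" "i \<in> I"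
  shows "tms_int P M \<Gamma> ts i = tms_int (C i) (component M i) \<Gamma> ts"
proof -
  have "tm_int P M \<Gamma> (ts ! n) i = tm_int (C i) (component M i) \<Gamma> (ts ! n)" if "n < length \<Delta>" for n
    using assms that tm_int_P[of \<Gamma> "ts ! n" "\<Delta> ! n"] by (simp add: list_all2_conv_all_nth)
  then have "map (\<lambda>g. g i) (map (tm_int P M \<Gamma>) ts) = map (tm_int (C i) (component M i) \<Gamma>) ts"
    using assms(1) by (auto simp: list_all2_conv_all_nth in_set_conv_nth)
  then show ?thesis
    using list_tuple_P[OF assms(3) ctx_obj[OF assms(2)] tms_int_args(1)[OF assms(1,2)]] assms(3)
    by (simp add: tms_int_def product_app ctx_int_P del: map_map)
qed

lemma fm_int_P:
  assumes "wf_fm L Sg \<Gamma> \<phi>" "set \<Gamma> \<subseteq> Sorts Sg" "i \<in> I"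
  shows "fm_int P M \<Gamma> \<phi> i = fm_int (C i) (component M i) \<Gamma> \<phi>"
  using assms
proof (induction rule: wf_fm.induct)
  case (1 r \<Gamma> ts)
  then show ?case
    by (simp add: fm_int_Rel product_app tms_int_P del: fm_int.simps(1))
next
  case (2 \<sigma> \<Gamma> t u)
  have "pair P (tm_int P M \<Gamma> t) (tm_int P M \<Gamma> u) i = pair (C i) (tm_int P M \<Gamma> t i) (tm_int P M \<Gamma> u i)"
    using tm_int_arr[OF 2(2,4)] tm_int_arr[OF 2(3,4)] 2(5)
    by (intro pair_P[of _ "ctx_int P M \<Gamma>"]) (auto simp: fp_P.hom_iff)
  then show ?case
    using 2 by (simp add: product_app tm_int_P)
next
  case (3 k \<phi>s \<Gamma>)
  then have "map (\<lambda>x. x i) (map (fm_int P M \<Gamma>) \<phi>s) = map (fm_int (C i) (component M i) \<Gamma>) \<phi>s"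
    by simp
  then show ?case
    using 3 by (simp add: product_app ctx_int_P del: map_map)
next
  case (4 q \<sigma> \<Gamma> \<phi>)
  then show ?case
    by (simp add: product_app ctx_int_P)
qed

lemma list_tensor_P:
  "i \<in> I \<Longrightarrow> list_tensor L P c xs i = list_tensor L (C i) (c i) (map (\<lambda>x. x i) xs)"
  by (induction xs) (simp_all add: list_tensor_def product_app)

lemma theory_of_P:
  "theory_of L Sg P M = {a. wf_assertion L Sg a \<and> (\<forall>i\<in>I. satisfies L (C i) (component M i) a)}"
proof (rule set_eqI)
  fix a
  show "a \<in> theory_of L Sg P M \<longleftrightarrow>
    a \<in> {a. wf_assertion L Sg a \<and> (\<forall>i\<in>I. satisfies L (C i) (component M i) a)}"
  proof (cases a)
    case (Eqn \<Gamma> \<sigma> t u)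
    have "tm_int P M \<Gamma> t = tm_int P M \<Gamma> u \<longleftrightarrow>
      (\<forall>i\<in>I. tm_int (C i) (component M i) \<Gamma> t = tm_int (C i) (component M i) \<Gamma> u)"
      if "wt_tm Sg \<Gamma> t \<sigma>" "wt_tm Sg \<Gamma> u \<sigma>" "set \<Gamma> \<subseteq> Sorts Sg"
      using that tm_int_arr[OF that(1,3)] tm_int_arr[OF that(2,3)]
      by (simp add: ext_iff product_sel tm_int_P)
    then show ?thesis
      by (auto simp: Eqn theory_of_def)
  next
    case (Seq \<Gamma> \<Phi> \<phi>)
    have "Leq P (ctx_int P M \<Gamma>) (list_tensor L P (ctx_int P M \<Gamma>) (map (fm_int P M \<Gamma>) \<Phi>)) (fm_int P
      M \<Gamma> \<phi>) \<longleftrightarrow>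
      (\<forall>i\<in>I. satisfies L (C i) (component M i) (Seq \<Gamma> \<Phi> \<phi>))"
      if "\<forall>\<psi>\<in>set \<Phi>. wf_fm L Sg \<Gamma> \<psi>" "wf_fm L Sg \<Gamma> \<phi>" "set \<Gamma> \<subseteq> Sorts Sg"
    proof -
      have "map (\<lambda>x. x i) (map (fm_int P M \<Gamma>) \<Phi>) = map (fm_int (C i) (component M i) \<Gamma>) \<Phi>" if
        "i \<in> I" for i
        using fm_int_P \<open>set \<Gamma> \<subseteq> Sorts Sg\<close> \<open>\<forall>\<psi>\<in>set \<Phi>. wf_fm L Sg \<Gamma> \<psi>\<close> that by simp
      then show ?thesis
        using that by (simp add: Leq_P list_tensor_P ctx_int_P fm_int_P del: map_map)
    qed
    then show ?thesis
      by (auto simp: Seq theory_of_def)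
  qed
qed

end


section \<open>Smallness and the main theorem\<close>

text \<open>A coding of syntax by indices: \<open>join\<close> codes lists of codes, and
  \<open>tag\<close> both marks constructors and codes variables. Tags have to differ only within
  one syntactic category.\<close>

locale encoding =
  fixes join :: "'i list \<Rightarrow> 'i" and tag :: "nat \<Rightarrow> 'i"
    and eS :: "'s \<Rightarrow> 'i" and eF :: "'f \<Rightarrow> 'i" and eR :: "'r \<Rightarrow> 'i" and eC :: "'c \<Rightarrow> 'i" and eQ ::
      "'q \<Rightarrow> 'i"
    and L :: "('c, 'q) language" and Sg :: "('s, 'f, 'r) signature"
  assumes sig: "is_signature Sg" and inj_join: "inj join" and inj_tag: "inj tag"
    and inj_eS: "inj_on eS (Sorts Sg)" and inj_eF: "inj_on eF (Funs Sg)" and inj_eR: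
      "inj_on eR (Rels Sg)"
    and inj_eC: "inj_on eC (Conns L)" and inj_eQ: "inj_on eQ (Quants L)"
begin

lemma join_eq [simp]: "join xs = join ys \<longleftrightarrow> xs = ys"
  using inj_join by (auto dest: injD)

lemma tag_eq [simp]: "tag m = tag n \<longleftrightarrow> m = n"
  using inj_tag by (auto dest: injD)

primrec enc_tm :: "'f tm \<Rightarrow> 'i" where
  "enc_tm (Var i) = join [tag 0, tag i]"
| "enc_tm (Fun f ts) = join (tag 1 # eF f # map enc_tm ts)"

primrec enc_fm :: "('s, 'f, 'r, 'c, 'q) fm \<Rightarrow> 'i" where
  "enc_fm (Rel r ts) = join (tag 0 # eR r # map enc_tm ts)"
| "enc_fm (Equ \<sigma> t u) = join [tag 1, eS \<sigma>, enc_tm t, enc_tm u]"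
| "enc_fm (Conn k \<phi>s) = join (tag 2 # eC k # map enc_fm \<phi>s)"
| "enc_fm (Quant q \<sigma> \<phi>) = join [tag 3, eQ q, eS \<sigma>, enc_fm \<phi>]"

primrec enc_assertion :: "('s, 'f, 'r, 'c, 'q) assertion \<Rightarrow> 'i" where
  "enc_assertion (Eqn \<Gamma> \<sigma> t u) = join [tag 0, join (map eS \<Gamma>), eS \<sigma>, enc_tm t, enc_tm u]"
| "enc_assertion (Seq \<Gamma> \<Phi> \<phi>) = join [tag 1, join (map eS \<Gamma>), join (map enc_fm \<Phi>), enc_fm \<phi>]"

text \<open>Confined to well-typed terms because the codes of symbols are injective only on the
  symbols of the signature.\<close>

lemma enc_tm_inj: "wt_tm Sg \<Gamma> t \<sigma> \<Longrightarrow> wt_tm Sg \<Gamma> u \<tau> \<Longrightarrow> enc_tm t = enc_tm u \<Longrightarrow> t = u"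
proof (induction arbitrary: u \<tau> rule: wt_tm.induct)
  case (1 i)
  then show ?case by (cases u) auto
next
  case (2 f ts)
  then obtain us where u: "u = Fun f us" "map enc_tm ts = map enc_tm us"
    by (cases u) (auto simp: wt_tm_Fun dest: inj_onD[OF inj_eF])
  have "ts = us"
  proof (rule nth_equalityI)
    show "length ts = length us" using u(2) by (rule map_eq_imp_length_eq)
    fix j assume j: "j < length ts"
    then have "enc_tm (ts ! j) = enc_tm (us ! j)"
      using u(2) \<open>length ts = length us\<close> by (metis nth_map)
    moreover have "\<forall>u. (\<exists>\<tau>. wt_tm Sg \<Gamma> u \<tau>) \<longrightarrow> enc_tm (ts ! j) = enc_tm u \<longrightarrow> ts ! j = u"
      using 2(2) j by (auto simp: list_all2_conv_all_nth)
    moreover have "wt_tm Sg \<Gamma> (us ! j) (fdom Sg f ! j)"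
      using 2(3) u(1) j \<open>length ts = length us\<close> by (auto simp: wt_tm_Fun list_all2_conv_all_nth)
    ultimately show "ts ! j = us ! j"
      by blast
  qed
  then show ?case by (simp add: u)
qed

lemma enc_tms_inj:
  assumes "list_all2 (wt_tm Sg \<Gamma>) ts \<Delta>" "list_all2 (wt_tm Sg \<Gamma>) us \<Theta>" "map enc_tm ts = map enc_tm us"
  shows "ts = us"
proof (rule nth_equalityI)
  show len: "length ts = length us" using assms(3) by (rule map_eq_imp_length_eq)
  fix j assume j: "j < length ts"
  then have "enc_tm (ts ! j) = enc_tm (us ! j)"
    using assms(3) len by (metis nth_map)
  then show "ts ! j = us ! j"
    using assms(1,2) j len enc_tm_inj[of \<Gamma> "ts ! j" "\<Delta> ! j" "us ! j" "\<Theta> ! j"]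
    by (simp add: list_all2_conv_all_nth)
qed

lemma enc_fm_inj: "wf_fm L Sg \<Gamma> \<phi> \<Longrightarrow> wf_fm L Sg \<Gamma> \<psi> \<Longrightarrow> enc_fm \<phi> = enc_fm \<psi> \<Longrightarrow> \<phi> = \<psi>"
proof (induction arbitrary: \<psi> rule: wf_fm.induct)
  case (1 r \<Gamma> ts)
  then show ?case
    by (cases \<psi>) (auto dest: inj_onD[OF inj_eR] enc_tms_inj)
next
  case (2 \<sigma> \<Gamma> t u)
  then show ?case
    by (cases \<psi>) (auto dest: inj_onD[OF inj_eS] enc_tm_inj)
next
  case (3 k \<phi>s \<Gamma>)
  then obtain \<psi>s where u: "\<psi> = Conn k \<psi>s" "map enc_fm \<phi>s = map enc_fm \<psi>s"
    "\<forall>\<psi> \<in> set \<psi>s. wf_fm L Sg \<Gamma> \<psi>"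
    by (cases \<psi>) (auto dest: inj_onD[OF inj_eC])
  have "\<phi>s = \<psi>s"
  proof (rule nth_equalityI)
    show len: "length \<phi>s = length \<psi>s" using u(2) by (rule map_eq_imp_length_eq)
    fix j assume j: "j < length \<phi>s"
    then have "enc_fm (\<phi>s ! j) = enc_fm (\<psi>s ! j)"
      using u(2) len by (metis nth_map)
    then show "\<phi>s ! j = \<psi>s ! j"
      using 3(3) u(3) j len by auto
  qed
  then show ?case by (simp add: u)
next
  case (4 q \<sigma> \<Gamma> \<phi>)
  then obtain q' \<sigma>' \<psi>' where \<psi>: "\<psi> = Quant q' \<sigma>' \<psi>'" "eQ q = eQ q'" "eS \<sigma> = eS \<sigma>'"
    "enc_fm \<phi> = enc_fm \<psi>'" "q' \<in> Quants L" "\<sigma>' \<in> Sorts Sg" "wf_fm L Sg (\<Gamma> @ [\<sigma>']) \<psi>'"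
    by (cases \<psi>) auto
  \<comment> \<open>The sorts are decoded before the bodies: the induction hypothesis compares
    bodies over the same extended context.\<close>
  then have "q = q'" "\<sigma> = \<sigma>'"
    using 4(1,2) inj_onD[OF inj_eQ] inj_onD[OF inj_eS] by blast+
  then show ?case
    using 4(4)[of \<psi>'] \<psi> by simp
qed

lemma enc_sorts_inj: "set \<Gamma> \<subseteq> Sorts Sg \<Longrightarrow> set \<Delta> \<subseteq> Sorts Sg \<Longrightarrow> map eS \<Gamma> = map eS \<Delta> \<Longrightarrow> \<Gamma> = \<Delta>"
  using inj_on_subset[OF inj_eS, of "set \<Gamma> \<union> set \<Delta>"] by (blast intro: map_inj_on)

lemma enc_assertion_inj: "inj_on enc_assertion {a. wf_assertion L Sg a}"
proof (rule inj_onI)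
  fix a b
  assume a: "a \<in> {a. wf_assertion L Sg a}" and b: "b \<in> {a. wf_assertion L Sg a}"
    and eq: "enc_assertion a = enc_assertion b"
  show "a = b"
  proof (cases a)
    case (Eqn \<Gamma> \<sigma> t u)
    then obtain \<Delta> \<tau> t' u' where b': "b = Eqn \<Delta> \<tau> t' u'"
      using eq by (cases b) auto
    have *: "set \<Gamma> \<subseteq> Sorts Sg" "set \<Delta> \<subseteq> Sorts Sg" "map eS \<Gamma> = map eS \<Delta>" "eS \<sigma> = eS \<tau>"
      "enc_tm t = enc_tm t'" "enc_tm u = enc_tm u'" "wt_tm Sg \<Gamma> t \<sigma>" "wt_tm Sg \<Gamma> u \<sigma>"
      "wt_tm Sg \<Delta> t' \<tau>" "wt_tm Sg \<Delta> u' \<tau>"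
      using a b eq by (auto simp: Eqn b')
    have \<Gamma>: "\<Gamma> = \<Delta>"
      by (rule enc_sorts_inj[OF *(1-3)])
    \<comment> \<open>\<open>wf_assertion\<close> does not mention membership of the sort of an
      equation; it follows from the typing of its terms.\<close>
    have "\<sigma> \<in> Sorts Sg" "\<tau> \<in> Sorts Sg"
      using wt_tm_in_Sorts[OF sig *(7,1)] wt_tm_in_Sorts[OF sig *(9,2)] .
    then have "\<sigma> = \<tau>"
      using inj_onD[OF inj_eS *(4)] by blast
    then show ?thesis
      using * enc_tm_inj[of \<Delta>] by (simp add: Eqn b' \<Gamma>)
  next
    case (Seq \<Gamma> \<Phi> \<phi>)
    then obtain \<Delta> \<Psi> \<psi> where b': "b = Seq \<Delta> \<Psi> \<psi>"
      using eq by (cases b) auto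
    have *: "set \<Gamma> \<subseteq> Sorts Sg" "set \<Delta> \<subseteq> Sorts Sg" "map eS \<Gamma> = map eS \<Delta>"
      "map enc_fm \<Phi> = map enc_fm \<Psi>" "enc_fm \<phi> = enc_fm \<psi>"
      "\<forall>\<theta> \<in> set \<Phi>. wf_fm L Sg \<Gamma> \<theta>" "\<forall>\<theta> \<in> set \<Psi>. wf_fm L Sg \<Delta> \<theta>"
      "wf_fm L Sg \<Gamma> \<phi>" "wf_fm L Sg \<Delta> \<psi>"
      using a b eq by (auto simp: Seq b')
    have \<Gamma>: "\<Gamma> = \<Delta>"
      by (rule enc_sorts_inj[OF *(1-3)])
    have "inj_on enc_fm (set \<Phi> \<union> set \<Psi>)"
      using *(6,7) enc_fm_inj[of \<Delta>] unfolding \<Gamma> by (intro inj_onI) blast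
    with *(4) have "\<Phi> = \<Psi>"
      by (rule map_inj_on)
    moreover have "\<phi> = \<psi>"
      using *(5,8,9) enc_fm_inj[of \<Delta>] unfolding \<Gamma> by blast
    ultimately show ?thesis
      by (simp add: Seq b' \<Gamma>)
  qed
qed

end

text \<open>An infinite type is in bijection with its square, so iterated pairing codes the lists of
  any fixed length; storing the length as well makes the code injective on all lists.\<close>

lemma infinite_list_encoding:
  assumes "infinite (UNIV :: 'i set)"
  obtains join :: "'i list \<Rightarrow> 'i" and tag :: "nat \<Rightarrow> 'i" where "inj join" "inj tag"
proof -
  obtain tag :: "nat \<Rightarrow> 'i" where tag: "inj tag"
    using infinite_countable_subset[OF assms] by blast
  obtain p :: "'i \<times> 'i \<Rightarrow> 'i" where bij: "bij_betw p (UNIV \<times> UNIV) UNIV"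
    using card_of_Times_same_infinite[OF assms] unfolding card_of_ordIso[symmetric] by blast
  then have "inj p"
    using bij_betw_imp_inj_on[OF bij] by simp
  then have p: "p x = p y \<longleftrightarrow> x = y" for x y
    by (rule inj_eq)
  \<comment> \<open>The end value \<open>tag 0\<close> is an arbitrary fixed element.\<close>
  define fold where "fold = (\<lambda>xs. foldr (\<lambda>x y. p (x, y)) xs (tag 0))"
  have fold: "fold xs = fold ys \<Longrightarrow> length xs = length ys \<Longrightarrow> xs = ys" for xs ys
  proof (induction xs arbitrary: ys)
    case (Cons x xs)
    then show ?case
      by (cases ys) (auto simp: fold_def p)
  qed simp
  have "inj (\<lambda>xs. p (tag (length xs), fold xs))"
  proof (rule injI)
    fix xs ys
    assume "p (tag (length xs), fold xs) = p (tag (length ys), fold ys)"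
    then have "tag (length xs) = tag (length ys)" "fold xs = fold ys"
      by (simp_all add: p)
    then show "xs = ys"
      using fold injD[OF tag] by blast
  qed
  then show ?thesis
    using that tag by blast
qed

lemma small_wf_assertions:
  fixes L :: "('c, 'q) language" and Sg :: "('s, 'f, 'r) signature"
  assumes "is_signature Sg" "infinite (UNIV :: 'i set)" "small_language TYPE('i) L"
    "small_signature TYPE('i) Sg"
  shows "small TYPE('i) {a. wf_assertion L Sg a}"
proof -
  obtain join :: "'i list \<Rightarrow> 'i" and tag :: "nat \<Rightarrow> 'i" where 1: "inj join" "inj tag"
    using infinite_list_encoding[OF assms(2)] by blast
  have "\<exists>e :: _ \<Rightarrow> 'i. inj_on e (Sorts Sg)"
    "\<exists>e :: _ \<Rightarrow> 'i. inj_on e (Funs Sg)"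
    "\<exists>e :: _ \<Rightarrow> 'i. inj_on e (Rels Sg)"
    "\<exists>e :: _ \<Rightarrow> 'i. inj_on e (Conns L)"
    "\<exists>e :: _ \<Rightarrow> 'i. inj_on e (Quants L)"
    using assms(3,4)
    by (simp_all add: small_language_def small_signature_def small_def lepoll_def)
  then obtain eS :: "'s \<Rightarrow> 'i" and eF :: "'f \<Rightarrow> 'i" and eR :: "'r \<Rightarrow> 'i" and eC :: "'c \<Rightarrow> 'i"
    and eQ :: "'q \<Rightarrow> 'i"
    where "inj_on eS (Sorts Sg)" "inj_on eF (Funs Sg)" "inj_on eR (Rels Sg)"
      "inj_on eC (Conns L)" "inj_on eQ (Quants L)"
    by (elim exE conjE)
  with 1 assms(1) interpret encoding join tag eS eF eR eC eQ L Sg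
    by unfold_locales
  show ?thesis
    unfolding small_def lepoll_def using enc_assertion_inj by blast
qed

section \<open>Theories of structures in products, and the two inclusions\<close>

lemma prod_op_subset_Ob_FA:
  assumes "is_language L" "\<X> \<subseteq> Ob_FA L" "P \<in> prod_op \<X>"
  shows "P \<in> Ob_FA L"
proof -
  obtain I C where P: "P = product_propcat I C" "\<forall>i\<in>I. C i \<in> \<X>"
    using assms(3) by (auto simp: prod_op_def)
  interpret FA_family L I C
    using assms(1,2) P(2) by (intro FA_family.intro) (auto simp: Ob_FA_def)
  show ?thesis
    using FA_object_P by (simp add: P Ob_FA_def)
qed

lemma theory_in_product:
  assumes "is_language L" "is_signature Sg" "\<X> \<subseteq> Ob_FA L" "\<forall>i\<in>I. C i \<in> \<X>"
    and "is_structure Sg (product_propcat I C) M"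
  shows "theory_of L Sg (product_propcat I C) M =
      {a. wf_assertion L Sg a \<and> (\<forall>i\<in>I. satisfies L (C i) (component M i) a)}"
    and "\<forall>i\<in>I. is_structure Sg (C i) (component M i)"
proof -
  interpret FA_family L I C
    using assms(1,3,4) by (intro FA_family.intro) (auto simp: Ob_FA_def)
  interpret structure_in_product L I C Sg M
    using assms by (intro structure_in_product.intro structure_in_product_axioms.intro
      FA_family_axioms)
  show "theory_of L Sg P M = {a. wf_assertion L Sg a \<and> (\<forall>i\<in>I. satisfies L (C i) (component M i) a)}"
    by (rule theory_of_P)
  show "\<forall>i\<in>I. is_structure Sg (C i) (component M i)"
    using assms(5) unfolding structure_P_iff by blast
qed

lemma tuple_is_structure:
  assumes "is_language L" "is_signature Sg" "\<X> \<subseteq> Ob_FA L" "\<forall>i\<in>I. C i \<in> \<X>"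
    and "\<forall>i\<in>I. is_structure Sg (C i) (N i)"
  shows "is_structure Sg (product_propcat I C) (tuple_struct I N)"
proof -
  interpret FA_family L I C
    using assms(1,3,4) by (intro FA_family.intro) (auto simp: Ob_FA_def)
  show ?thesis
    unfolding structure_P_iff using assms(5) by (auto simp: component_tuple_struct) (auto simp:
      tuple_struct_def)
qed

theorem mainTheorem15:
  fixes L :: "('c, 'q) language"
    and Sg :: "('s, 'f, 'r) signature"
    and \<X> :: "('o, 'm, 'p, 'c, 'q) propcat set"
  assumes "is_language L" and "is_signature Sg"
    and "infinite (UNIV :: 'i set)"
    and "small_language TYPE('i) L" and "small_signature TYPE('i) Sg"
    and "\<X> \<subseteq> Ob_FA L"
  shows "{D \<in> Ob_FA L :: ('o', 'm', 'p', 'c, 'q) propcat set.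
            \<forall>T T'. is_theory L Sg T \<and> is_theory L Sg T' \<and> entails L Sg \<X> T T' \<longrightarrow>
                   entails L Sg {D} T T'} =
         classifying_op L Sg
           (sub_op L (prod_op \<X> :: ('i \<Rightarrow> 'o, 'i \<Rightarrow> 'm, 'i \<Rightarrow> 'p, 'c, 'q) propcat set))"
proof (intro equalityI subsetI)
  fix D :: "('o', 'm', 'p', 'c, 'q) propcat"
  assume "D \<in> {D \<in> Ob_FA L. \<forall>T T'. is_theory L Sg T \<and> is_theory L Sg T' \<and> entails L Sg \<X> T T' \<longrightarrow>
    entails L Sg {D} T T'}"
  then have D: "D \<in> Ob_FA L"
    and closed: "\<And>T T'. is_theory L Sg T \<Longrightarrow> is_theory L Sg T' \<Longrightarrow> entails L Sg \<X> T T' \<Longrightarrow>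
      entails L Sg {D} T T'"
    by blast+
  show "D \<in> classifying_op L Sg
    (sub_op L (prod_op \<X> :: ('i \<Rightarrow> 'o, 'i \<Rightarrow> 'm, 'i \<Rightarrow> 'p, 'c, 'q) propcat set))"
    unfolding classifying_op_def
  proof (intro CollectI conjI D allI impI)
    fix T assume T: "Lm_theory L Sg T \<and> subprop_category L (classifying L Sg T) D"
    then obtain M where M: "is_structure Sg D M" "theory_of L Sg D M = T"
      using subprop_classifying_iff_theory_of[OF assms(1,2) D] by blast
    have thy: "is_theory L Sg T"
      using T by (simp add: Lm_theory_def)
    define W where "W = {a. wf_assertion L Sg a} - T"
    \<comment> \<open>Without a counterexample the theory consisting of \<open>a\<close> alone would
      be a consequence of \<open>T\<close> over \<open>\<X>\<close>, hence over \<open>D\<close>,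
      and so hold in \<open>M\<close>, whose theory is \<open>T\<close>.\<close>
    have "\<exists>C N. C \<in> \<X> \<and> is_model L Sg C N T \<and> \<not> satisfies L C N a" if a: "a \<in> W" for a
    proof (rule ccontr)
      assume "\<nexists>C N. C \<in> \<X> \<and> is_model L Sg C N T \<and> \<not> satisfies L C N a"
      then have "entails L Sg \<X> T {a}"
        by (auto simp: entails_def)
      moreover have "is_theory L Sg {a}"
        using a by (simp add: W_def is_theory_def)
      ultimately have "entails L Sg {D} T {a}"
        using closed thy by blast
      moreover have "is_model L Sg D M T"
        using M by (auto simp: is_model_def theory_of_def)
      ultimately have "satisfies L D M a"
        by (auto simp: entails_def)
      then have "a \<in> T"
        using a M(2) by (auto simp: W_def theory_of_def)
      then show False
        using a by (simp add: W_def)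
    qed
    then obtain Ca Na where CN: "\<And>a. a \<in> W \<Longrightarrow>
        Ca a \<in> \<X> \<and> is_model L Sg (Ca a) (Na a) T \<and> \<not> satisfies L (Ca a) (Na a) a"
      by metis
    obtain e :: "('s, 'f, 'r, 'c, 'q) assertion \<Rightarrow> 'i" where "inj_on e {a. wf_assertion L Sg a}"
      using small_wf_assertions[OF assms(2-5)] unfolding small_def lepoll_def by blast
    then have e: "inj_on e W"
      by (rule inj_on_subset) (auto simp: W_def)
    \<comment> \<open>Products are indexed by subsets of the type of indices, so the family indexed
      by refuted assertions is re-indexed by their codes, and \<open>the_inv_into\<close>
      decodes.\<close>
    define I where "I = e ` W"
    define C where "C = Ca \<circ> the_inv_into W e"
    define N where "N = Na \<circ> the_inv_into W e"
    have C: "\<forall>i\<in>I. C i \<in> \<X>" and N: "\<forall>i\<in>I. is_structure Sg (C i) (N i)"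
      using CN by (auto simp: I_def C_def N_def the_inv_into_f_f[OF e] is_model_def)
    have struct: "is_structure Sg (product_propcat I C) (tuple_struct I N)"
      by (rule tuple_is_structure[OF assms(1,2,6) C N])
    have "theory_of L Sg (product_propcat I C) (tuple_struct I N) =
      {a. wf_assertion L Sg a \<and> (\<forall>i\<in>I. satisfies L (C i) (N i) a)}"
      using theory_in_product(1)[OF assms(1,2,6) C struct]
      by (simp add: component_tuple_struct cong: ball_cong)
    also have "\<dots> = {a. wf_assertion L Sg a \<and> (\<forall>b\<in>W. satisfies L (Ca b) (Na b) a)}"
      by (simp add: I_def C_def N_def the_inv_into_f_f[OF e])
    \<comment> \<open>All the structures are models of \<open>T\<close>, and an assertion outside
      \<open>T\<close> fails in the structure chosen for it.\<close>
    also have "\<dots> = T"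
      using CN thy by (auto simp: W_def is_theory_def is_model_def)
    finally have "subprop_category L (classifying L Sg T) (product_propcat I C)"
      using subprop_classifying_iff_theory_of[OF assms(1,2), of "product_propcat I C" T]
        prod_op_subset_Ob_FA[OF assms(1,6), of "product_propcat I C"] C struct
      by (auto simp: prod_op_def)
    then show "classifying L Sg T \<in> sub_op L (prod_op \<X> :: ('i \<Rightarrow> 'o, 'i \<Rightarrow> 'm, 'i \<Rightarrow> 'p, 'c, 'q)
      propcat set)"
      using C unfolding sub_op_def prod_op_def by blast
  qed
next
  fix D :: "('o', 'm', 'p', 'c, 'q) propcat"
  assume "D \<in> classifying_op L Sg
    (sub_op L (prod_op \<X> :: ('i \<Rightarrow> 'o, 'i \<Rightarrow> 'm, 'i \<Rightarrow> 'p, 'c, 'q) propcat set))"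
  then have D: "D \<in> Ob_FA L"
    and cl: "\<And>T. Lm_theory L Sg T \<Longrightarrow> subprop_category L (classifying L Sg T) D \<Longrightarrow>
      classifying L Sg T \<in> sub_op L (prod_op \<X> :: ('i \<Rightarrow> 'o, 'i \<Rightarrow> 'm, 'i \<Rightarrow> 'p, 'c, 'q) propcat set)"
    by (auto simp: classifying_op_def)
  have "entails L Sg {D} T T'"
    if T: "is_theory L Sg T" "is_theory L Sg T'" and ent: "entails L Sg \<X> T T'" for T T'
    unfolding entails_def
  proof (intro ballI allI impI)
    fix C M a assume "C \<in> {D}" and M: "is_model L Sg C M T" and a: "a \<in> T'"
    then have CD: "C = D" by simp
    \<comment> \<open>\<open>T\<close> need not be closed under the logic; the theory of the given
      model is, and it contains \<open>T\<close>.\<close>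
    let ?T = "theory_of L Sg D M"
    have struct: "is_structure Sg D M" and TM: "T \<subseteq> ?T"
      using M T(1) by (auto simp: CD is_model_def theory_of_def is_theory_def)
    have Th: "Lm_theory L Sg ?T" "subprop_category L (classifying L Sg ?T) D"
      using subprop_classifying_iff_theory_of[OF assms(1,2) D] struct by blast+
    then obtain I and A :: "'i \<Rightarrow> ('o, 'm, 'p, 'c, 'q) propcat" where A: "\<forall>i\<in>I. A i \<in> \<X>"
      "subprop_category L (classifying L Sg ?T) (product_propcat I A)"
      using cl[OF Th] by (auto simp: sub_op_def prod_op_def)
    have "product_propcat I A \<in> Ob_FA L"
      using A(1) by (intro prod_op_subset_Ob_FA[OF assms(1,6)]) (auto simp: prod_op_def)
    \<comment> \<open>The theory of \<open>M\<close> is realised again, now in a product of members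
      of \<open>\<X>\<close>, where the assumed consequence can be applied componentwise.\<close>
    then obtain N where N: "is_structure Sg (product_propcat I A) N"
      "theory_of L Sg (product_propcat I A) N = ?T"
      using subprop_classifying_iff_theory_of[OF assms(1,2)] Th(1) A(2) by blast
    have "satisfies L (A i) (component N i) a" if "i \<in> I" for i
    proof -
      have "is_model L Sg (A i) (component N i) T"
        using theory_in_product[OF assms(1,2,6) A(1) N(1)] N(2) TM that by (auto simp: is_model_def)
      then show ?thesis
        using ent A(1) that a by (auto simp: entails_def)
    qed
    then have "a \<in> ?T"
      using theory_in_product(1)[OF assms(1,2,6) A(1) N(1)] N(2) T(2) a by (auto simp: is_theory_def)
    then show "satisfies L C M a"
      by (simp add: CD theory_of_def)
  qed
  then show "D \<in> {D \<in> Ob_FA L. \<forall>T T'. is_theory L Sg T \<and> is_theory L Sg T' \<and> entails L Sg \<X> T T' \<longrightarrow>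
    entails L Sg {D} T T'}"
    using D by blast
qed

end
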